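(* Let $1\le k\le N$ and let $\varphi$ be a linear fractional self-map of $B_N$ such that $\varphi$ maps $B_k=\{(z_1,\dots,z_N)\in B_N: z_i=0 \text{ for } i>k\}$ into itself and the restriction of $\varphi$ to $B_k$ is an automorphism of $B_k$ which is not a rotation (not a unitary map). Then $C_\varphi$ is not essentially normal on $H^2(B_N)$, and not essentially normal on $A^2_s(B_N)$ for any real $s>-1$.
   Context: $B_N$ is the open unit ball of $\mathbb{C}^N$ with $\langle z,w\rangle=\sum_j z_j\overline{w_j}$; $B_k$ is identified with the unit ball of $\mathbb{C}^k$. A linear fractional map is $\varphi(z)=\frac{Az+B}{\langle z,C\rangle+d}$ with $A$ an $N\times N$ complex matrix, $B,C\in\mathbb{C}^N$, $d\in\mathbb{C}$; it is a self-map of $B_N$ if it maps $B_N$ into $B_N$. $H^2(B_N)$ is the Hardy space ($\|f\|^2=\sup_{0<r<1}\int_{\partial B_N}|f(r\zeta)|^2d\sigma(\zeta)$, $\sigma$ normalized surface measure), and for $s>-1$, $A^2_s(B_N)$ is the space of holomorphic $f$ with $\int_{B_N}|f|^2\frac{\Gamma(N+s+1)}{N!\Gamma(s+1)}(1-|z|^2)^sdv(z)<\infty$ ($v$ normalized volume measure). $C_\varphi f=f\circ\varphi$. A bounded operator $T$ is essentially normal if $T^*T-TT^*$ is compact. *)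

theory Defs
  imports "HOL-Analysis.Analysis"
begin

definition cinner :: "complex^'n \<Rightarrow> complex^'n \<Rightarrow> complex" where
  "cinner z w = (\<Sum>j\<in>UNIV. z$j * cnj (w$j))"

definition ballN :: "(complex^'n) set" where
  "ballN = {z. norm z < 1}"

definition first_idx :: "nat \<Rightarrow> ('n::{finite,linorder}) set" where
  "first_idx k = {i. card {j. j < i} < k}"

definition subspE :: "nat \<Rightarrow> (complex^('n::{finite,linorder})) set" where
  "subspE k = {z. \<forall>i. i \<notin> first_idx k \<longrightarrow> z$i = 0}"

definition ballK :: "nat \<Rightarrow> (complex^('n::{finite,linorder})) set" where
  "ballK k = ballN \<inter> subspE k"

definition lf_map :: "complex^'n^'n \<Rightarrow> complex^'n \<Rightarrow> complex^'n \<Rightarrow> complex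
     \<Rightarrow> complex^'n \<Rightarrow> complex^'n" where
  "lf_map A B C d z = (1 / (cinner z C + d)) *s (A *v z + B)"

definition lf_selfmap :: "complex^'n^'n \<Rightarrow> complex^'n \<Rightarrow> complex^'n \<Rightarrow> complex \<Rightarrow> bool" where
  "lf_selfmap A B C d \<longleftrightarrow>
     (\<forall>z\<in>ballN. cinner z C + d \<noteq> 0 \<and> lf_map A B C d z \<in> ballN)"

definition rotation_on_Bk :: "nat \<Rightarrow> (complex^('n::{finite,linorder}) \<Rightarrow> complex^('n::{finite,linorder})) \<Rightarrow> bool" where
  "rotation_on_Bk k \<phi> \<longleftrightarrow>
     (\<exists>U. (\<forall>z\<in>ballK k. \<phi> z = U *v z) \<and>
        (\<forall>z\<in>subspE k. \<forall>w\<in>subspE k. cinner (U *v z) (U *v w) = cinner z w))"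

definition holo_ball :: "(complex^'n \<Rightarrow> complex) \<Rightarrow> bool" where
  "holo_ball f \<longleftrightarrow> (\<forall>z\<in>ballN. \<exists>L. (f has_derivative L) (at z) \<and>
                         (\<forall>c v. L (c *s v) = c * L v))"

text \<open>Normalized volume measure v on B_N and normalized surface measure
  sigma on the sphere (the cone/radial-projection image of v).\<close>

definition vol_ball :: "(complex^'n) measure" where
  "vol_ball = uniform_measure lborel ballN"

definition sph :: "(complex^'n) measure" where
  "sph = distr vol_ball borel (\<lambda>x. (1 / norm x) *\<^sub>R x)"

definition H2 :: "(complex^'n \<Rightarrow> complex) set" where
  "H2 = {f. holo_ball f \<and> (\<forall>z. z \<notin> ballN \<longrightarrow> f z = 0) \<and>
           (SUP r\<in>{0<..<1::real}. \<integral>\<^sup>+ \<zeta>. ennreal ((cmod (f (r *\<^sub>R \<zeta>)))\<^sup>2) \<partial>sph) < \<infinity>}"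

definition H2_ip :: "(complex^'n \<Rightarrow> complex) \<Rightarrow> (complex^'n \<Rightarrow> complex) \<Rightarrow> complex" where
  "H2_ip f g = Lim (at_left 1) (\<lambda>r::real. \<integral>\<zeta>. f (r *\<^sub>R \<zeta>) * cnj (g (r *\<^sub>R \<zeta>)) \<partial>sph)"

definition bergman_weight :: "real \<Rightarrow> complex^'n \<Rightarrow> real" where
  "bergman_weight s z =
     Gamma (real CARD('n) + s + 1) / (fact CARD('n) * Gamma (s + 1)) * (1 - (norm z)\<^sup>2) powr s"

definition A2 :: "real \<Rightarrow> (complex^'n \<Rightarrow> complex) set" where
  "A2 s = {f. holo_ball f \<and> (\<forall>z. z \<notin> ballN \<longrightarrow> f z = 0) \<and>
             (\<integral>\<^sup>+ z. ennreal ((cmod (f z))\<^sup>2 * bergman_weight s z) \<partial>vol_ball) < \<infinity>}"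

definition A2_ip :: "real \<Rightarrow> (complex^'n \<Rightarrow> complex) \<Rightarrow> (complex^'n \<Rightarrow> complex) \<Rightarrow> complex" where
  "A2_ip s f g = (\<integral>z. f z * cnj (g z) * complex_of_real (bergman_weight s z) \<partial>vol_ball)"

definition Cop :: "(complex^'n \<Rightarrow> complex^'n) \<Rightarrow> (complex^'n \<Rightarrow> complex) \<Rightarrow> (complex^'n \<Rightarrow> complex)" where
  "Cop \<phi> f = (\<lambda>z. if z \<in> ballN then f (\<phi> z) else 0)"

definition ipnorm :: "('a \<Rightarrow> 'a \<Rightarrow> complex) \<Rightarrow> 'a \<Rightarrow> real" where
  "ipnorm ip f = sqrt (Re (ip f f))"

definition compact_op :: "('b \<Rightarrow> complex) set \<Rightarrow> (('b \<Rightarrow> complex) \<Rightarrow> ('b \<Rightarrow> complex) \<Rightarrow> complex)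
     \<Rightarrow> (('b \<Rightarrow> complex) \<Rightarrow> ('b \<Rightarrow> complex)) \<Rightarrow> bool" where
  "compact_op S ip K \<longleftrightarrow>
     (\<forall>u::nat \<Rightarrow> ('b \<Rightarrow> complex). (\<forall>n. u n \<in> S) \<and> (\<exists>M. \<forall>n. ipnorm ip (u n) \<le> M) \<longrightarrow>
        (\<exists>r::nat \<Rightarrow> nat. strict_mono r \<and> (\<forall>e>0. \<exists>M. \<forall>m\<ge>M. \<forall>n\<ge>M.
            ipnorm ip (\<lambda>x. K (u (r m)) x - K (u (r n)) x) < e)))"

definition ess_normal :: "('b \<Rightarrow> complex) set \<Rightarrow> (('b \<Rightarrow> complex) \<Rightarrow> ('b \<Rightarrow> complex) \<Rightarrow> complex)
     \<Rightarrow> (('b \<Rightarrow> complex) \<Rightarrow> ('b \<Rightarrow> complex)) \<Rightarrow> bool" where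
  "ess_normal S ip T \<longleftrightarrow>
     (\<forall>f\<in>S. T f \<in> S) \<and> (\<exists>M. \<forall>f\<in>S. ipnorm ip (T f) \<le> M * ipnorm ip f) \<and>
     (\<exists>Ts. (\<forall>g\<in>S. Ts g \<in> S) \<and> (\<forall>f\<in>S. \<forall>g\<in>S. ip (T f) g = ip f (Ts g)) \<and>
        compact_op S ip (\<lambda>f x. Ts (T f) x - T (Ts f) x))"

end

theory Submission
  imports Defs "HOL-Complex_Analysis.Complex_Analysis" "HOL-Real_Asymp.Real_Asymp"
begin

text \<open>
  Write \<open>\<phi> = num / den\<close> and \<open>E\<close> for the subspace spanned by \<open>B_k\<close>. Since \<open>\<phi>\<close> restricts to an
  automorphism of \<open>B_k\<close>, there is \<open>\<kappa> > 0\<close> with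
  \<open>den z * cnj (den u) - \<langle>num z, num u\<rangle> = \<kappa> (1 - \<langle>z, u\<rangle>)\<close> for all \<open>z\<close> and all \<open>u \<noteq> 0\<close> in \<open>E\<close>.

  Both spaces have a reproducing kernel \<open>K_w(z) = (1 - \<langle>z, w\<rangle>)^(-\<gamma>)\<close>, with \<open>\<gamma> = N\<close> for the Hardy space
  and \<open>\<gamma> = N + s + 1\<close> for the Bergman spaces. Let \<open>\<zeta>\<close> be a unit vector of \<open>E\<close>, let \<open>u\<close> tend to \<open>\<zeta>\<close> along
  the radius, and let \<open>k\<close> be the normalized kernel function at \<open>\<phi> u\<close>. As \<open>C_\<phi>^* K_w = K_(\<phi> w)\<close>,
  the identity above gives \<open>\<parallel>C_\<phi>^* k\<parallel>^2 \<rightarrow> (|den (\<phi> \<zeta>)|^2 / \<kappa>)^\<gamma>\<close>; it also shows that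
  \<open>|k \<circ> \<phi>|\<close> is \<open>|den|^\<gamma>\<close> times a multiple of \<open>|K_u|\<close>, and as the mass of \<open>K_u\<close> concentrates at \<open>\<zeta>\<close>,
  \<open>\<parallel>C_\<phi> k\<parallel>^2 \<rightarrow> (|den \<zeta>|^2 / \<kappa>)^\<gamma>\<close>. The functions \<open>k\<close> tend weakly to zero, so essential normality
  makes the two limits equal: \<open>|den (\<phi> \<zeta>)| = |den \<zeta>|\<close> for all unit vectors \<open>\<zeta>\<close> of \<open>E\<close>, which
  forces \<open>den\<close> to be constant on \<open>E\<close> and \<open>\<phi>\<close> to be unitary there.

  The reproducing property follows from the invariance of the measures under unitary maps, which
  reduces it to the moments of \<open>|z_i|^(2m)\<close>.
\<close>

section \<open>The Hermitian inner product\<close>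

text \<open>The obstacle is that \<open>\<phi>\<close> is an automorphism only on
  \<open>B_k\<close>, while composition with \<open>\<phi>\<close> involves all of
  \<open>B_N\<close>. On \<open>E\<close> the identity with \<open>\<kappa>\<close> comes from both
  sides being Hermitian polynomials that vanish on the sphere of \<open>E\<close>. For
  \<open>z\<close> outside \<open>E\<close> it is a matter of rigidity: for \<open>u\<close> on the
  sphere of \<open>E\<close> the left side is affine in \<open>z\<close> and has no zero in the
  ball, which fixes its direction.

  The two norm limits are obtained differently. The norm of the adjoint is an exact formula at each
  \<open>u\<close>. For \<open>k \<circ> \<phi>\<close>, evaluation at \<open>u\<close> already
  gives the lower bound, so concentration serves only for the upper one.

  Weak convergence to zero is deduced from the decay of the mutual inner products of the functions
  \<open>k\<close>, without density of the kernel functions or completeness of the space. Of the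
  self-commutator only the quadratic form along one sequence is used.

  The Hardy inner product is a limit over radii whose existence is part of the work; its properties
  are proved at each radius below 1 and passed to the limit.\<close>

lemma cinner_add_left: "cinner (x + y) z = cinner x z + cinner y z"
  by (simp add: cinner_def distrib_right sum.distrib)

lemma cinner_add_right: "cinner x (y + z) = cinner x y + cinner x z"
  by (simp add: cinner_def distrib_left sum.distrib)

lemma cinner_scale_left: "cinner (c *s x) y = c * cinner x y"
  by (simp add: cinner_def sum_distrib_left mult.assoc)

lemma cinner_scale_right: "cinner x (c *s y) = cnj c * cinner x y"
  by (simp add: cinner_def sum_distrib_left mult_ac)

lemma cinner_commute: "cinner y x = cnj (cinner x y)"
  by (simp add: cinner_def mult.commute)

lemma cinner_zero_left [simp]: "cinner 0 x = 0"
  by (simp add: cinner_def)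

lemma cinner_zero_right [simp]: "cinner x 0 = 0"
  by (simp add: cinner_def)

lemma scaleR_eq_smult: "r *\<^sub>R (x::complex^'n) = complex_of_real r *s x"
  by (auto simp: vec_eq_iff scaleR_conv_of_real[where 'a=complex])

lemma cinner_scaleR_left: "cinner (r *\<^sub>R x) y = of_real r * cinner x y"
  by (simp add: scaleR_eq_smult cinner_scale_left)

lemma cinner_scaleR_right: "cinner x (r *\<^sub>R y) = of_real r * cinner x y"
  by (simp add: scaleR_eq_smult cinner_scale_right)

lemma cinner_minus_left: "cinner (- x) y = - cinner x y"
  using cinner_scaleR_left[of "-1" x y] by simp

lemma cinner_minus_right: "cinner x (- y) = - cinner x y"
  using cinner_scaleR_right[of x "-1" y] by simp

lemma cinner_diff_left: "cinner (x - y) z = cinner x z - cinner y z"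
  using cinner_add_left[of x "- y" z] by (simp add: cinner_minus_left)

lemma cinner_diff_right: "cinner x (y - z) = cinner x y - cinner x z"
  using cinner_add_right[of x y "- z"] by (simp add: cinner_minus_right)

lemmas cinner_simps = cinner_add_left cinner_add_right cinner_scale_left cinner_scale_right
  cinner_minus_left cinner_minus_right cinner_diff_left cinner_diff_right

lemma mult_cnj_self: "z * cnj z = (complex_of_real (cmod z))\<^sup>2"
  using complex_norm_square[of z] by simp

lemma cinner_self: "cinner x x = (complex_of_real (norm x))\<^sup>2"
proof -
  have "cinner x x = (\<Sum>j\<in>UNIV. of_real ((cmod (x$j))\<^sup>2))"
    unfolding cinner_def by (rule sum.cong) (simp_all add: mult_cnj_self)
  also have "\<dots> = (complex_of_real (norm x))\<^sup>2"
    by (simp flip: of_real_power of_real_sum add: norm_vec_def L2_set_def sum_nonneg)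
  finally show ?thesis .
qed

lemma norm_smult [simp]: "norm (c *s (x::complex^'n)) = cmod c * norm x"
proof -
  have "complex_of_real ((norm (c *s x))\<^sup>2) = complex_of_real ((cmod c * norm x)\<^sup>2)"
    using cinner_scale_left[of c x "c *s x"]
    by (simp add: cinner_scale_right cinner_self mult.assoc[symmetric] mult_cnj_self power_mult_distrib)
  hence "(norm (c *s x))\<^sup>2 = (cmod c * norm x)\<^sup>2"
    using of_real_eq_iff by blast
  thus ?thesis
    by (simp add: power2_eq_iff_nonneg)
qed

lemma cinner_Cauchy_Schwarz: "cmod (cinner x y) \<le> norm x * norm y"
proof -
  have "cmod (cinner x y) \<le> (\<Sum>j\<in>UNIV. cmod (x$j * cnj (y$j)))"
    unfolding cinner_def by (rule norm_sum)
  also have "\<dots> \<le> (\<Sum>j\<in>UNIV. \<bar>cmod (x$j)\<bar> * \<bar>cmod (y$j)\<bar>)"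
    by (simp add: norm_mult)
  also have "\<dots> \<le> norm x * norm y"
    unfolding norm_vec_def by (rule L2_set_mult_ineq)
  finally show ?thesis .
qed

lemma bounded_linear_cinner_left: "bounded_linear (\<lambda>x. cinner x y)"
  by (rule bounded_linear_intro[where K = "norm y"])
     (simp_all add: cinner_add_left cinner_scaleR_left scaleR_conv_of_real[where 'a=complex] cinner_Cauchy_Schwarz)

lemmas continuous_cinner_left [continuous_intros] =
    bounded_linear.continuous[OF bounded_linear_cinner_left]
  and continuous_on_cinner_left [continuous_intros] =
    bounded_linear.continuous_on[OF bounded_linear_cinner_left]

lemma continuous_on_matrix_vector_mult [continuous_intros]:
  fixes A :: "complex^'n^'m"
  assumes "continuous_on S f"
  shows "continuous_on S (\<lambda>x. A *v f x)"
  unfolding matrix_vector_mult_def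
  by (intro continuous_intros continuous_on_vec_lambda assms)

lemma mem_ballN: "z \<in> ballN \<longleftrightarrow> norm z < 1"
  by (simp add: ballN_def)

lemma ballN_eq_ball: "ballN = ball 0 1"
  by (auto simp: ballN_def)

lemma subspE_add: "x \<in> subspE k \<Longrightarrow> y \<in> subspE k \<Longrightarrow> x + y \<in> subspE k"
  and subspE_diff: "x \<in> subspE k \<Longrightarrow> y \<in> subspE k \<Longrightarrow> x - y \<in> subspE k"
  and subspE_minus: "x \<in> subspE k \<Longrightarrow> - x \<in> subspE k"
  and subspE_smult: "x \<in> subspE k \<Longrightarrow> c *s x \<in> subspE k"
  and subspE_scaleR: "x \<in> subspE k \<Longrightarrow> r *\<^sub>R x \<in> subspE k"
  and subspE_zero: "0 \<in> subspE k"
  by (simp_all add: subspE_def)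

lemmas subspE_intros = subspE_add subspE_diff subspE_minus subspE_smult subspE_scaleR subspE_zero

section \<open>Linear fractional self-maps that restrict to automorphisms\<close>

locale lf_automorphism =
  fixes A :: "complex^('n::{finite,linorder})^('n::{finite,linorder})"
    and B C :: "complex^('n::{finite,linorder})" and d :: complex and k :: nat
  assumes selfmap: "lf_selfmap A B C d"
    and bij: "bij_betw (lf_map A B C d) (ballK k) (ballK k)"
begin

abbreviation "\<phi> \<equiv> lf_map A B C d"
abbreviation "E \<equiv> (subspE k :: ((complex,'n) vec) set)"

definition den :: "(complex,'n) vec \<Rightarrow> complex" where "den z = cinner z C + d"
definition num :: "(complex,'n) vec \<Rightarrow> (complex,'n) vec" where "num z = A *v z + B"

lemma lf_map_eq: "\<phi> z = (1 / den z) *s num z"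
  by (simp add: lf_map_def den_def num_def)

lemma num_eq: "den z \<noteq> 0 \<Longrightarrow> num z = den z *s \<phi> z"
  by (simp add: lf_map_eq vector_smult_assoc)

lemma den_nonzero_ball: "z \<in> ballN \<Longrightarrow> den z \<noteq> 0"
  and lf_map_ball: "z \<in> ballN \<Longrightarrow> \<phi> z \<in> ballN"
  using selfmap by (auto simp: lf_selfmap_def den_def)

lemma num_less_den: "z \<in> ballN \<Longrightarrow> norm (num z) < cmod (den z)"
  using lf_map_ball[of z] den_nonzero_ball[of z]
  by (simp add: num_eq mem_ballN)

text \<open>\<open>\<phi>\<close> has no a priori values on the sphere, where \<open>den\<close>
  might vanish, so the bound is stated for \<open>num\<close> and \<open>den\<close>, which are
  continuous everywhere.\<close>

lemma num_le_den:
  assumes "norm z \<le> 1"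
  shows "norm (num z) \<le> cmod (den z)"
proof -
  have "closure ballN = cball (0::(complex,'n) vec) 1"
    by (subst ballN_eq_ball) simp
  moreover have "norm (num z) - cmod (den z) \<le> 0"
  proof (rule continuous_le_on_closure[where S = ballN])
    show "continuous_on (closure ballN) (\<lambda>z. norm (num z) - cmod (den z))"
      unfolding num_def den_def by (intro continuous_intros)
    show "z \<in> closure ballN" using assms calculation by simp
    show "\<And>x. x \<in> ballN \<Longrightarrow> norm (num x) - cmod (den x) \<le> 0"
      using num_less_den less_imp_le by fastforce
  qed
  ultimately show ?thesis by simp
qed

lemma ballK_iff: "z \<in> ballK k \<longleftrightarrow> norm z < 1 \<and> z \<in> E"
  by (auto simp: ballK_def ballN_def)

lemma lf_map_ballK: "z \<in> ballK k \<Longrightarrow> \<phi> z \<in> ballK k"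
  using bij by (auto simp: bij_betw_def)

lemma matrix_smult: "A *v (c *s z) = c *s (A *v z)"
  by (simp add: matrix_vector_mult_def vec_eq_iff sum_distrib_left mult_ac)

lemma num_affine: "num (a *s x + b *s y) = a *s num x + b *s num y" if "a + b = 1"
proof -
  have "a *s B + b *s B = B"
    using that by (metis vector_sadd_rdistrib vector_smult_lid)
  thus ?thesis
    by (simp add: num_def matrix_vector_right_distrib matrix_smult vector_add_ldistrib)
qed

lemma den_affine: "den (a *s x + b *s y) = a * den x + b * den y" if "a + b = 1"
proof -
  have "a * d + b * d = d" using that by (metis distrib_right mult_1)
  thus ?thesis by (simp add: den_def cinner_simps algebra_simps)
qed

lemma num_in_E:
  assumes "norm z \<le> 1" "z \<in> E"
  shows "num z \<in> E"
proof -
  have *: "num x \<in> E" if "x \<in> ballK k" for x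
    using lf_map_ballK[OF that] num_eq[OF den_nonzero_ball, of x] that
    by (auto simp: ballK_def intro: subspE_intros)
  have "num ((1/2) *s z) \<in> E" "num 0 \<in> E"
    using assms by (simp_all add: * ballK_iff subspE_smult subspE_zero)
  \<comment> \<open>The coefficients add up to 1, so this affine combination extrapolates from the
    open ball to its boundary.\<close>
  moreover have "num z = 2 *s num ((1/2) *s z) + (-1) *s num 0"
    using num_affine[of 2 "-1" "(1/2) *s z" 0] by (simp add: vector_smult_assoc)
  ultimately show ?thesis
    by (metis subspE_add subspE_smult)
qed

text \<open>If a boundary point \<open>z\<close> were mapped to an interior point \<open>\<phi> y\<close>, then the whole segment from
  \<open>y\<close> to \<open>z\<close> would be mapped to that point, contradicting injectivity.\<close>

lemma norm_num_eq_sphere: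
  assumes z: "norm z = 1" "z \<in> E"
  shows "norm (num z) = cmod (den z)"
proof (rule ccontr)
  assume "norm (num z) \<noteq> cmod (den z)"
  hence less: "norm (num z) < cmod (den z)" using num_le_den[of z] z by simp
  hence nz: "den z \<noteq> 0" by auto
  have "\<phi> z \<in> ballK k"
    using less nz num_in_E[of z] z
    by (auto simp: ballK_iff lf_map_eq norm_divide field_simps intro: subspE_intros)
  then obtain y where y: "y \<in> ballK k" "\<phi> y = \<phi> z"
    using bij by (metis bij_betw_def imageE)
  \<comment> \<open>The midpoint lies in the open ball, so injectivity applies to it although
    \<open>z\<close> is on the sphere.\<close>
  define w where "w = (1/2) *s y + (1/2) *s z"
  have "norm w \<le> norm ((1/2::complex) *s y) + norm ((1/2::complex) *s z)"
    unfolding w_def by (rule norm_triangle_ineq)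
  also have "\<dots> < 1" using z y by (simp add: ballK_iff)
  finally have w: "w \<in> ballK k"
    using y z by (auto simp: ballK_iff w_def intro!: subspE_add subspE_smult)
  have dy: "den y \<noteq> 0" and dw: "den w \<noteq> 0"
    using y w den_nonzero_ball by (auto simp: ballK_def)
  have "num w = (1/2) *s (den y *s \<phi> z) + (1/2) *s (den z *s \<phi> z)"
    using num_eq[OF dy] num_eq[OF nz] y by (simp add: w_def num_affine)
  also have "\<dots> = den w *s \<phi> z"
    by (simp add: w_def den_affine vector_smult_assoc vector_sadd_rdistrib)
  finally have "\<phi> w = \<phi> z"
    using dw by (simp add: lf_map_eq[of w] vector_smult_assoc)
  hence "w = y"
    using bij w y by (metis bij_betw_def inj_on_eq_iff)
  hence "z = y"
    unfolding w_def vec_eq_iff complex_eq_iff by (simp add: field_simps)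
  thus False using z y by (simp add: ballK_iff)
qed

text \<open>The form \<open>1 - cinner z u\<close> of the ball, in homogeneous coordinates, pulled
  back by the matrix of \<open>\<phi>\<close>. Using \<open>num\<close> and \<open>den\<close>
  instead of \<open>\<phi>\<close> keeps it polynomial and defined everywhere.\<close>

definition herm :: "(complex,'n) vec \<Rightarrow> (complex,'n) vec \<Rightarrow> complex" where
  "herm z u = den z * cnj (den u) - cinner (num z) (num u)"

text \<open>The parts of \<open>herm\<close> by bidegree: \<open>kap\<close> and
  \<open>hquad\<close> are unchanged when both arguments are multiplied by the same unimodular
  scalar, the linear terms are not.\<close>

definition hlin :: "(complex,'n) vec \<Rightarrow> complex" where
  "hlin z = cinner z C * cnj d - cinner (A *v z) B"

definition hquad :: "(complex,'n) vec \<Rightarrow> (complex,'n) vec \<Rightarrow> complex" where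
  "hquad z u = cinner z C * cnj (cinner u C) - cinner (A *v z) (A *v u)"

text \<open>The value \<open>herm 0 0\<close>.\<close>

definition kap :: real where
  "kap = (cmod d)\<^sup>2 - (norm B)\<^sup>2"

lemma kap_pos: "kap > 0"
proof -
  have "norm B < cmod d"
    using num_less_den[of 0] by (simp add: num_def den_def ballN_def)
  thus ?thesis by (simp add: kap_def power_strict_mono)
qed

lemma herm_eq: "herm z u = of_real kap + hlin z + cnj (hlin u) + hquad z u"
proof -
  have "complex_of_real kap = d * cnj d - cinner B B"
    by (simp add: kap_def cinner_self complex_norm_square del: of_real_power)
      (simp add: of_real_power)
  thus ?thesis
    by (simp add: herm_def den_def num_def hlin_def hquad_def cinner_simps algebra_simps
        cinner_commute[of "A *v u" B])
qed

lemma hlin_smult: "hlin (c *s z) = c * hlin z"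
  by (simp add: hlin_def cinner_simps matrix_smult algebra_simps)

lemma hlin_add: "hlin (z + w) = hlin z + hlin w"
  by (simp add: hlin_def cinner_simps matrix_vector_right_distrib algebra_simps)

lemma hquad_smult: "hquad (c *s z) u = c * hquad z u" "hquad z (c *s u) = cnj c * hquad z u"
  by (simp_all add: hquad_def cinner_simps matrix_smult algebra_simps)

lemma hquad_add: "hquad (z + w) u = hquad z u + hquad w u" "hquad z (w + u) = hquad z w + hquad z u"
  by (simp_all add: hquad_def cinner_simps matrix_vector_right_distrib algebra_simps)

lemma herm_sphere: "norm z = 1 \<Longrightarrow> z \<in> E \<Longrightarrow> herm z z = 0"
  using norm_num_eq_sphere[of z]
  by (simp add: herm_def cinner_self complex_norm_square flip: of_real_power)

text \<open>Along the circle of multiples \<open>c *s z\<close> the vanishing of \<open>herm\<close>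
  is a trigonometric identity of degree one in \<open>c\<close>, so its coefficients vanish
  separately.\<close>

lemma sphere_hlin_hquad:
  assumes z: "norm z = 1" "z \<in> E"
  shows "hlin z = 0" "hquad z z = - of_real kap"
proof -
  have *: "of_real kap + c * hlin z + cnj (c * hlin z) + hquad z z = 0" if "cmod c = 1" for c
  proof -
    have "herm (c *s z) (c *s z) = 0"
      using z that by (intro herm_sphere) (auto intro: subspE_smult)
    moreover have "c * cnj c = 1" "cnj c * c = 1" using that mult_cnj_self[of c] by (simp_all add: mult.commute)
    ultimately show ?thesis
      by (simp add: herm_eq hlin_smult hquad_smult mult.assoc[symmetric])
  qed
  have "Re (hlin z) = 0" "Im (hlin z) = 0"
    using *[of 1] *[of "-1"] *[of \<i>] *[of "-\<i>"] by (auto simp: complex_eq_iff)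
  thus "hlin z = 0" by (simp add: complex_eq_iff)
  thus "hquad z z = - of_real kap" using *[of 1] by (simp add: eq_neg_iff_add_eq_0 add.commute)
qed

lemma hlin_zero:
  assumes "z \<in> E"
  shows "hlin z = 0"
proof (cases "z = 0")
  case True thus ?thesis by (simp add: hlin_def)
next
  case False
  have "hlin (of_real (1 / norm z) *s z) = 0"
    using assms False by (intro sphere_hlin_hquad) (auto intro: subspE_smult simp: norm_divide)
  thus ?thesis using False by (simp add: hlin_smult)
qed

lemma hquad_self:
  assumes "z \<in> E"
  shows "hquad z z = - of_real kap * cinner z z"
proof (cases "z = 0")
  case True thus ?thesis by (simp add: hquad_def)
next
  case False
  have "hquad (of_real (1 / norm z) *s z) (of_real (1 / norm z) *s z) = - of_real kap"
    using assms False by (intro sphere_hlin_hquad) (auto intro: subspE_smult simp: norm_divide)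
  thus ?thesis using False by (simp add: hquad_smult cinner_self power2_eq_square field_simps)
qed

text \<open>Complex polarization: a sesquilinear form that vanishes on the diagonal of
  \<open>E\<close> vanishes on \<open>E\<close>.\<close>

lemma herm_E:
  assumes "z \<in> E" "u \<in> E"
  shows "herm z u = of_real kap * (1 - cinner z u)"
proof -
  define G where "G = (\<lambda>x y. hquad x y + of_real kap * cinner x y)"
  have G0: "G x x = 0" if "x \<in> E" for x using hquad_self[OF that] by (simp add: G_def)
  have Gadd: "G (x + y) (x + y) = G x x + G x y + G y x + G y y" for x y
    by (simp add: G_def hquad_add cinner_simps algebra_simps)
  have Gsm: "G (c *s x) y = c * G x y" "G x (c *s y) = cnj c * G x y" for c x y
    by (simp_all add: G_def hquad_smult cinner_simps algebra_simps)
  have "G z u + G u z = 0"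
    using G0[of "z + u"] G0[of z] G0[of u] assms Gadd[of z u] by (simp add: subspE_add)
  moreover have "cnj \<i> * G z u + \<i> * G u z = 0"
    using G0[of "z + \<i> *s u"] G0[of z] G0[of "\<i> *s u"] assms Gadd[of z "\<i> *s u"]
    by (simp add: subspE_intros Gsm)
  ultimately have "G z u = 0" by (auto simp: complex_eq_iff)
  thus ?thesis using assms
    by (simp add: herm_eq hlin_zero G_def algebra_simps eq_neg_iff_add_eq_0)
qed

text \<open>A zero of \<open>den\<close> in the closed ball would be a zero of \<open>num\<close> as
  well, and then \<open>herm 0 u\<close> would vanish, against its value \<open>kap\<close>.\<close>

lemma den_nonzero:
  assumes "norm u \<le> 1" "u \<in> E"
  shows "den u \<noteq> 0"
proof
  assume "den u = 0"
  hence "num u = 0" using num_le_den[OF assms(1)] by simp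
  hence "herm 0 u = 0" using \<open>den u = 0\<close> by (simp add: herm_def)
  thus False using herm_E[OF subspE_zero assms(2)] kap_pos by simp
qed

text \<open>The norms of \<open>num\<close> and \<open>den\<close> agree at \<open>u\<close> but not
  at the interior point \<open>z\<close>, so Cauchy-Schwarz is strict.\<close>

lemma herm_nonzero:
  assumes "z \<in> ballN" "norm u = 1" "u \<in> E"
  shows "herm z u \<noteq> 0"
proof
  assume "herm z u = 0"
  hence "cmod (den z) * cmod (den u) = cmod (cinner (num z) (num u))"
    by (metis complex_mod_cnj eq_iff_diff_eq_0 herm_def norm_mult)
  also have "\<dots> \<le> norm (num z) * norm (num u)" by (rule cinner_Cauchy_Schwarz)
  also have "\<dots> < cmod (den z) * cmod (den u)"
    using num_less_den[OF assms(1)] norm_num_eq_sphere[OF assms(2,3)] den_nonzero[of u] assms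
    by simp
  finally show False by simp
qed

definition proj :: "(complex,'n) vec \<Rightarrow> (complex,'n) vec" where
  "proj z = (\<chi> i. if i \<in> first_idx k then z$i else 0)"

lemma proj_E: "proj z \<in> E"
  by (simp add: proj_def subspE_def)

lemma cinner_proj_diff: "u \<in> E \<Longrightarrow> cinner (z - proj z) u = 0"
  unfolding cinner_def proj_def subspE_def by (auto intro!: sum.neutral)

text \<open>A linear perturbation of the affine function \<open>1 - \<langle>z,u\<rangle>\<close> in a direction orthogonal to
  \<open>u\<close> would produce a zero inside the ball.\<close>

lemma herm_orthogonal:
  assumes u: "norm u = 1" "u \<in> E" and v: "cinner v u = 0"
  shows "hlin v + hquad v u = 0"
proof (rule ccontr)
  define g where "g = hlin v + hquad v u"
  assume "hlin v + hquad v u \<noteq> 0"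
  hence g: "g \<noteq> 0" by (simp add: g_def)
  \<comment> \<open>Below, \<open>b\<close> is chosen so that \<open>herm z u = 0\<close> for every
    \<open>t\<close>. Then |z|^2 = (1 - t)^2 + t^2 Q, which \<open>t = 1 / (1 + Q)\<close> turns
    into 1 - t.\<close>
  define Q where "Q = (kap * norm v / cmod g)\<^sup>2"
  define t where "t = 1 / (1 + Q)"
  have Q: "Q \<ge> 0" by (simp add: Q_def)
  define b where "b = - of_real (kap * t) / g"
  define a where "a = complex_of_real (1 - t)"
  have a: "cnj a = a" by (simp add: a_def)
  define z where "z = a *s u + b *s v"
  have "of_real ((norm z)\<^sup>2) = cinner z z" by (simp add: cinner_self)
  also have "\<dots> = a * a + b * cnj b * cinner v v"
    using v cinner_commute[of u v]
    by (simp add: z_def cinner_simps a) (simp add: cinner_self u mult_ac)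
  also have "b * cnj b * cinner v v = of_real ((cmod b * norm v)\<^sup>2)"
    by (simp add: cinner_self mult_cnj_self power_mult_distrib)
  also have "(cmod b * norm v)\<^sup>2 = t\<^sup>2 * Q"
    by (simp add: b_def Q_def norm_divide norm_mult power_mult_distrib power_divide abs_mult)
  also have "a * a = of_real ((1 - t)\<^sup>2)"
    by (simp add: a_def power2_eq_square)
  finally have nz: "(norm z)\<^sup>2 = (1 - t)\<^sup>2 + t\<^sup>2 * Q"
    unfolding of_real_add[symmetric] of_real_eq_iff .
  have t0: "t > 0" using Q by (simp add: t_def)
  have "t\<^sup>2 * (1 + Q) = t" using Q by (simp add: t_def power2_eq_square)
  hence "(norm z)\<^sup>2 = 1 - t" using nz by (simp add: power2_eq_square algebra_simps)
  hence "(norm z)\<^sup>2 < 1" using t0 by simp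
  hence "z \<in> ballN" by (simp add: ballN_def power2_less_1_iff abs_square_less_1)
  moreover have "herm z u = of_real kap + a * hquad u u + b * g"
    using u hlin_zero[of u]
    by (simp add: herm_eq z_def hlin_add hlin_smult hquad_add hquad_smult g_def algebra_simps)
  hence "herm z u = 0"
    using sphere_hlin_hquad[OF u] g by (simp add: a_def b_def algebra_simps)
  ultimately show False using herm_nonzero u by blast
qed

text \<open>By the formula on \<open>E\<close> only the component of \<open>z\<close> orthogonal to
  \<open>E\<close> is in question. Its contribution vanishes at the unit vectors \<open>x\<close>
  and \<open>-x\<close>, and the change of sign separates \<open>hlin\<close> from
  \<open>hquad\<close>; a nonzero \<open>u\<close> supplies \<open>x\<close>.\<close>

lemma herm_formula:
  assumes u: "u \<in> E" "u \<noteq> 0"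
  shows "herm z u = of_real kap * (1 - cinner z u)"
proof -
  define v where "v = z - proj z"
  define x where "x = of_real (1 / norm u) *s u"
  have x: "norm x = 1" "x \<in> E"
    using u by (auto simp: x_def norm_divide intro: subspE_smult)
  have orth: "hlin v + hquad v y = 0" if "norm y = 1" "y \<in> E" for y
    using herm_orthogonal[OF that] cinner_proj_diff[OF that(2)] by (simp add: v_def)
  have "hlin v + hquad v x = 0" "hlin v + hquad v ((-1) *s x) = 0"
    using x by (auto intro!: orth intro: subspE_smult subspE_minus simp del: vector_sneg_minus1)
  moreover have "hquad v ((-1) *s x) = - hquad v x"
    using hquad_smult(2)[of v "-1" x] by simp
  ultimately have "hlin v = 0" "hquad v x = 0"
    by (auto simp: complex_eq_iff simp del: vector_sneg_minus1)
  hence v: "hlin v = 0" "hquad v u = 0"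
    using u by (auto simp: hquad_smult x_def)
  have "herm z u = herm (proj z + v) u" by (simp add: v_def)
  also have "\<dots> = herm (proj z) u"
    using v by (simp add: herm_eq hlin_add hquad_add)
  also have "\<dots> = of_real kap * (1 - cinner z u)"
    using cinner_proj_diff[OF u(1), of z] u by (simp add: herm_E proj_E cinner_simps)
  finally show ?thesis .
qed

text \<open>The classical identity for ball automorphisms, with \<open>z\<close> anywhere in
  \<open>B_N\<close> and only \<open>u\<close> confined to \<open>E\<close>. It relates the kernel
  at \<open>\<phi> u\<close> to the kernel at \<open>u\<close>.\<close>

lemma one_minus_cinner_lf_map:
  assumes "z \<in> ballN" "u \<in> E" "u \<in> ballN" "u \<noteq> 0"
  shows "1 - cinner (\<phi> z) (\<phi> u) = of_real kap * (1 - cinner z u) / (den z * cnj (den u))"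
  using herm_formula[of u z] assms den_nonzero_ball[of z] den_nonzero_ball[of u]
  by (simp add: herm_def lf_map_eq cinner_simps field_simps)

lemma one_minus_norm_lf_map:
  assumes "u \<in> E" "norm u < 1"
  shows "1 - (norm (\<phi> u))\<^sup>2 = kap * (1 - (norm u)\<^sup>2) / (cmod (den u))\<^sup>2"
proof -
  have nz: "den u \<noteq> 0" using den_nonzero_ball assms by (simp add: ballN_def)
  have "complex_of_real ((cmod (den u))\<^sup>2 - (cmod (den u) * norm (\<phi> u))\<^sup>2)
      = of_real (kap * (1 - (norm u)\<^sup>2))"
    using herm_E[OF assms(1,1)] num_eq[OF nz]
    by (simp add: herm_def cinner_self mult_cnj_self)
  hence "(cmod (den u))\<^sup>2 - (cmod (den u) * norm (\<phi> u))\<^sup>2 = kap * (1 - (norm u)\<^sup>2)"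
    using of_real_eq_iff by blast
  thus ?thesis using nz by (simp add: field_simps)
qed

lemma norm_lf_map_sphere:
  assumes "norm z = 1" "z \<in> E"
  shows "norm (\<phi> z) = 1" "\<phi> z \<in> E"
  using norm_num_eq_sphere[OF assms] den_nonzero[of z] num_in_E[of z] assms
  by (auto simp: lf_map_eq norm_divide intro: subspE_smult)

text \<open>If \<open>|den|\<close> is invariant on the sphere then, on each circle \<open>\<lambda> e\<close>, a trigonometric
  polynomial of degree one equals the square of another one; so \<open>den\<close> is constant.\<close>

lemma den_constant_if_invariant:
  assumes inv: "\<And>z. norm z = 1 \<Longrightarrow> z \<in> E \<Longrightarrow> cmod (den (\<phi> z)) = cmod (den z)"
    and z: "norm z = 1" "z \<in> E"
  shows "cinner z C = 0"
proof -
  have main: "Re (cnj d * cinner e C) ^ 2 = Im (cnj d * cinner e C) ^ 2"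
    if e: "norm e = 1" "e \<in> E" for e
  proof -
    \<comment> \<open>Multiplying out gives \<open>den (\<phi> x) * den x = al + l * be\<close> for
      \<open>x = l *s e\<close>.\<close>
    define al where "al = cinner B C + d * d"
    define be where "be = cinner (A *v e) C + d * cinner e C"
    have eq: "(cmod (al + l * be))\<^sup>2 = ((cmod (d + l * cinner e C))\<^sup>2)\<^sup>2" if l: "cmod l = 1" for l
    proof -
      have le: "norm (l *s e) = 1" "l *s e \<in> E" using e l by (auto intro: subspE_smult)
      have nz: "den (l *s e) \<noteq> 0" using den_nonzero[of "l *s e"] le by simp
      define x where "x = l *s e"
      have "den (\<phi> x) = cinner (num x) C / den x + d"
        by (simp add: den_def[of "(1 / den x) *s num x"] lf_map_eq cinner_simps)
      hence "den (\<phi> x) * den x = cinner (num x) C + d * den x"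
        using nz by (simp add: x_def field_simps)
      also have "\<dots> = al + l * be"
        by (simp add: x_def al_def be_def num_def den_def matrix_smult cinner_simps algebra_simps)
      finally have "den (\<phi> (l *s e)) * den (l *s e) = al + l * be"
        by (simp add: x_def)
      hence "cmod (al + l * be) = (cmod (den (l *s e)))\<^sup>2"
        using inv[OF le] by (metis norm_mult power2_eq_square)
      thus ?thesis by (simp add: den_def cinner_simps add.commute)
    qed
    have sq: "(cmod (p + q))\<^sup>2 = (cmod p)\<^sup>2 + (cmod q)\<^sup>2 + 2 * Re (cnj p * q)" for p q
      by (simp add: cmod_power2) (simp add: power2_eq_square algebra_simps)
    define m where "m = cnj d * cinner e C"
    define P where "P = (cmod d)\<^sup>2 + (cmod (cinner e C))\<^sup>2"
    define S where "S = (cmod al)\<^sup>2 + (cmod be)\<^sup>2"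
    have "S + 2 * Re (l * (cnj al * be)) = (P + 2 * Re (l * m))\<^sup>2" if l: "cmod l = 1" for l
      using eq[OF l] by (simp only: sq) (simp add: norm_mult l S_def P_def m_def algebra_simps)
    \<comment> \<open>Opposite points cancel the linear term on the left, so for both pairs the
      squares on the right add up to \<open>2 * S\<close>.\<close>
    from this[of 1] this[of "-1"] this[of \<i>] this[of "-\<i>"]
    have "(P + 2 * Re m)\<^sup>2 + (P - 2 * Re m)\<^sup>2 = (P - 2 * Im m)\<^sup>2 + (P + 2 * Im m)\<^sup>2"
      by simp
    thus ?thesis by (simp add: power2_eq_square algebra_simps m_def)
  qed
  define m where "m = cnj d * cinner z C"
  have m1: "(Re m)\<^sup>2 = (Im m)\<^sup>2" using main[OF z] by (simp add: m_def)
  \<comment> \<open>So far Re (m^2) = 0. If \<open>c\<close> is unimodular and c^2 is not real, then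
    Re ((c m)^2) = 0 forces m = 0 as well; (3 + 4i)/5 is such a point with rational
    coordinates.\<close>
  have "norm (Complex (3/5) (4/5) *s z) = 1"
    using z by (simp add: cmod_def power2_eq_square)
  from main[OF this subspE_smult[OF z(2)]]
  have m2: "(Re (Complex (3/5) (4/5) * m))\<^sup>2 = (Im (Complex (3/5) (4/5) * m))\<^sup>2"
    by (simp add: m_def cinner_simps mult_ac)
  have "(3/5 * Re m - 4/5 * Im m)\<^sup>2 = (4/5 * Re m + 3/5 * Im m)\<^sup>2"
    using m2 by (simp add: algebra_simps)
  hence "48 * (Re m * Im m) = 7 * ((Im m)\<^sup>2 - (Re m)\<^sup>2)"
    by (simp add: power2_eq_square field_simps)
  hence "Re m * Im m = 0" using m1 by simp
  hence "m = 0" using m1 by (auto simp: complex_eq_iff)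
  moreover have "d \<noteq> 0" using den_nonzero_ball[of 0] by (simp add: den_def ballN_def)
  ultimately show ?thesis by (simp add: m_def)
qed

text \<open>With \<open>den\<close> constant on \<open>E\<close>, the vanishing of
  \<open>hlin\<close> makes \<open>A *v z\<close> orthogonal to \<open>B\<close> for
  \<open>z\<close> in \<open>E\<close>, while the preimage of 0 exhibits \<open>B\<close> as such an
  image up to sign. Hence \<open>B = 0\<close>, and \<open>herm_E\<close> says that A / d is
  isometric on \<open>E\<close>.\<close>

lemma rotation_if_invariant:
  assumes inv: "\<And>z. norm z = 1 \<Longrightarrow> z \<in> E \<Longrightarrow> cmod (den (\<phi> z)) = cmod (den z)"
  shows "rotation_on_Bk k \<phi>"
proof -
  have C0: "cinner z C = 0" if "z \<in> E" for z
  proof (cases "z = 0")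
    case False
    have "cinner (of_real (1 / norm z) *s z) C = 0"
      using that False by (intro den_constant_if_invariant inv) (auto intro: subspE_smult simp: norm_divide)
    thus ?thesis using False by (simp add: cinner_simps)
  qed simp
  have d: "d \<noteq> 0" using den_nonzero_ball[of 0] by (simp add: den_def ballN_def)
  have phi: "\<phi> z = (1 / d) *s (A *v z + B)" if "z \<in> E" for z
    using C0[OF that] by (simp add: lf_map_def)
  have AB: "cinner (A *v z) B = 0" if "z \<in> E" for z
    using hlin_zero[OF that] C0[OF that] by (simp add: hlin_def)
  obtain y where y: "y \<in> ballK k" "\<phi> y = 0"
    using bij subspE_zero by (metis ballK_iff bij_betw_def imageE norm_zero zero_less_one)
  have yE: "y \<in> E" using y by (simp add: ballK_iff)
  have "A *v y + B = d *s \<phi> y"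
    using d by (simp add: phi[OF yE] vector_smult_assoc)
  hence "A *v y + B = 0" by (simp add: y(2))
  hence "B = - (A *v y)" by (simp add: eq_neg_iff_add_eq_0 add.commute)
  hence "cinner B B = 0" using AB[OF yE] by (metis cinner_minus_left neg_equal_0_iff_equal)
  hence B: "B = 0" by (simp add: cinner_self)
  hence kap: "kap = (cmod d)\<^sup>2" unfolding kap_def by simp
  define U where "U = (\<chi> i j. (1 / d) * (A$i$j))"
  have U: "U *v z = (1 / d) *s (A *v z)" for z
    by (simp add: U_def matrix_vector_mult_def vec_eq_iff sum_distrib_left mult_ac sum_divide_distrib)
  have "cinner (U *v z) (U *v w) = cinner z w" if "z \<in> E" "w \<in> E" for z w
  proof -
    have "cinner (A *v z) (A *v w) = of_real kap * cinner z w"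
      using herm_E[OF that] hlin_zero[OF that(1)] hlin_zero[OF that(2)] C0[OF that(1)]
      by (simp add: herm_eq hquad_def algebra_simps)
    thus ?thesis using d
      by (simp add: U cinner_simps kap complex_norm_square field_simps flip: of_real_power)
  qed
  moreover have "\<phi> z = U *v z" if "z \<in> ballK k" for z
    using phi[of z] that B by (simp add: U ballK_iff)
  ultimately show ?thesis unfolding rotation_on_Bk_def by blast
qed

end

section \<open>Reproducing kernel spaces on the ball\<close>

text \<open>For \<open>w\<close> in the ball, \<open>1 - cinner z w\<close> has positive real part,
  so the principal power is holomorphic in \<open>z\<close>. The value 0 outside the ball follows
  the convention of \<open>H2\<close> and \<open>A2\<close>.\<close>

definition ker :: "real \<Rightarrow> complex^'n \<Rightarrow> complex^'n \<Rightarrow> complex" where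
  "ker \<gamma> w z = (if z \<in> ballN then (1 - cinner z w) powr (- of_real \<gamma>) else 0)"

lemma norm_ker: "z \<in> ballN \<Longrightarrow> cmod (ker \<gamma> w z) = cmod (1 - cinner z w) powr (- \<gamma>)"
  by (simp add: ker_def norm_powr_real_powr')

lemma ker_self: "w \<in> ballN \<Longrightarrow> ker \<gamma> w w = of_real ((1 - (norm w)\<^sup>2) powr (- \<gamma>))"
proof -
  assume "w \<in> ballN"
  moreover have "(1 - cinner w w) = of_real (1 - (norm w)\<^sup>2)"
    by (simp add: cinner_self)
  moreover have "0 \<le> 1 - (norm w)\<^sup>2"
    using \<open>w \<in> ballN\<close> by (simp add: ballN_def abs_square_le_1)
  ultimately show ?thesis
    by (simp add: ker_def powr_of_real del: of_real_diff of_real_minus flip: of_real_minus)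
qed

text \<open>What the Hardy and Bergman spaces share. Positivity of \<open>ip\<close> is asked only
  in the semidefinite form, and the measure is visible only through \<open>dominated\<close>, where
  \<open>mass\<close> stands for its total mass.\<close>

locale kernel_space =
  fixes S :: "(complex^'n \<Rightarrow> complex) set"
    and ip :: "(complex^'n \<Rightarrow> complex) \<Rightarrow> (complex^'n \<Rightarrow> complex) \<Rightarrow> complex"
    and \<gamma> :: real and mass :: real
  assumes gamma_pos: "\<gamma> > 0"
    and add: "f \<in> S \<Longrightarrow> g \<in> S \<Longrightarrow> (\<lambda>x. f x + g x) \<in> S"
    and scale: "f \<in> S \<Longrightarrow> (\<lambda>x. c * f x) \<in> S"
    and ip_add_left: "f \<in> S \<Longrightarrow> g \<in> S \<Longrightarrow> h \<in> S \<Longrightarrow> ip (\<lambda>x. f x + g x) h = ip f h + ip g h"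
    and ip_scale_left: "f \<in> S \<Longrightarrow> g \<in> S \<Longrightarrow> ip (\<lambda>x. c * f x) g = c * ip f g"
    and ip_commute: "f \<in> S \<Longrightarrow> g \<in> S \<Longrightarrow> ip g f = cnj (ip f g)"
    and ip_nonneg: "f \<in> S \<Longrightarrow> 0 \<le> Re (ip f f)"
    and ker_in: "w \<in> ballN \<Longrightarrow> ker \<gamma> w \<in> S"
    and reproducing: "f \<in> S \<Longrightarrow> w \<in> ballN \<Longrightarrow> ip f (ker \<gamma> w) = f w"
    and dominated: "f \<in> S \<Longrightarrow> g \<in> S \<Longrightarrow> 0 \<le> c1 \<Longrightarrow> 0 \<le> c2 \<Longrightarrow>
      (\<And>z. z \<in> ballN \<Longrightarrow> (cmod (f z))\<^sup>2 \<le> c1 * (cmod (g z))\<^sup>2 + c2) \<Longrightarrow>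
      Re (ip f f) \<le> c1 * Re (ip g g) + c2 * mass"
begin

definition nsq :: "(complex^'n \<Rightarrow> complex) \<Rightarrow> real" where "nsq f = Re (ip f f)"

lemma ip_self: "f \<in> S \<Longrightarrow> ip f f = of_real (nsq f)"
  using ip_commute[of f f] by (simp add: nsq_def complex_eq_iff)

lemma nsq_nonneg: "f \<in> S \<Longrightarrow> 0 \<le> nsq f"
  using ip_nonneg by (simp add: nsq_def)

lemma ip_add_right: "f \<in> S \<Longrightarrow> g \<in> S \<Longrightarrow> h \<in> S \<Longrightarrow> ip h (\<lambda>x. f x + g x) = ip h f + ip h g"
  by (subst (1 2 3) ip_commute) (simp_all add: add ip_add_left)

lemma ip_scale_right: "f \<in> S \<Longrightarrow> g \<in> S \<Longrightarrow> ip g (\<lambda>x. c * f x) = cnj c * ip g f"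
  by (subst (1 2) ip_commute) (simp_all add: scale ip_scale_left)

lemma diff: "f \<in> S \<Longrightarrow> g \<in> S \<Longrightarrow> (\<lambda>x. f x - g x) \<in> S"
  using add[of f "\<lambda>x. (-1) * g x"] scale[of g "-1"] by simp

lemma ip_diff_left: "f \<in> S \<Longrightarrow> g \<in> S \<Longrightarrow> h \<in> S \<Longrightarrow> ip (\<lambda>x. f x - g x) h = ip f h - ip g h"
  using ip_add_left[of f "\<lambda>x. (-1) * g x" h] scale[of g "-1"] ip_scale_left[of g h "-1"] by simp

lemma nsq_scale: "f \<in> S \<Longrightarrow> nsq (\<lambda>x. c * f x) = (cmod c)\<^sup>2 * nsq f"
  by (simp add: nsq_def ip_scale_left ip_scale_right scale cmod_power2)
    (simp add: power2_eq_square algebra_simps)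

lemma nsq_add:
  assumes "f \<in> S" "g \<in> S"
  shows "nsq (\<lambda>x. f x + g x) = nsq f + nsq g + 2 * Re (ip f g)"
proof -
  have "ip (\<lambda>x. f x + g x) (\<lambda>x. f x + g x) = ip f f + ip f g + (ip g f + ip g g)"
    using assms by (simp add: ip_add_left ip_add_right add)
  thus ?thesis using ip_commute[OF assms] by (simp add: nsq_def)
qed

lemma nsq_diff_scaled:
  assumes "f \<in> S" "g \<in> S"
  shows "nsq (\<lambda>x. f x + (- of_real t * ip f g) * g x)
    = nsq f - 2 * t * (cmod (ip f g))\<^sup>2 + t\<^sup>2 * (cmod (ip f g))\<^sup>2 * nsq g"
proof -
  define c where "c = - of_real t * ip f g"
  have "Re (ip f (\<lambda>x. c * g x)) = Re (cnj c * ip f g)"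
    using assms by (simp add: ip_scale_right)
  also have "\<dots> = - t * (cmod (ip f g))\<^sup>2"
    by (simp add: c_def cmod_power2 algebra_simps) (simp add: power2_eq_square algebra_simps)
  finally have "Re (ip f (\<lambda>x. c * g x)) = - t * (cmod (ip f g))\<^sup>2" .
  moreover have "(cmod c)\<^sup>2 = t\<^sup>2 * (cmod (ip f g))\<^sup>2"
    by (simp add: c_def norm_mult power_mult_distrib)
  ultimately have "nsq (\<lambda>x. f x + c * g x)
      = nsq f - 2 * t * (cmod (ip f g))\<^sup>2 + t\<^sup>2 * (cmod (ip f g))\<^sup>2 * nsq g"
    using assms nsq_add[OF assms(1) scale[OF assms(2)], of c] by (simp add: nsq_scale)
  thus ?thesis by (simp only: c_def)
qed

text \<open>The usual quadratic inequality in a real parameter \<open>t\<close>; as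
  \<open>ip\<close> is only semidefinite, \<open>nsq g = 0\<close> is a separate case.\<close>

lemma Cauchy_Schwarz:
  assumes "f \<in> S" "g \<in> S"
  shows "(cmod (ip f g))\<^sup>2 \<le> nsq f * nsq g"
proof -
  define b where "b = (cmod (ip f g))\<^sup>2"
  have *: "2 * t * b \<le> nsq f + t\<^sup>2 * b * nsq g" for t
    using nsq_nonneg[OF add[OF assms(1) scale[OF assms(2)]], of "- of_real t * ip f g"]
    unfolding nsq_diff_scaled[OF assms] b_def by simp
  have "b \<ge> 0" by (simp add: b_def)
  show ?thesis
  proof (cases "nsq g = 0")
    case True
    have "b = 0"
    proof (rule ccontr)
      assume "b \<noteq> 0"
      thus False using *[of "(nsq f + 1) / (2 * b)"] True by simp
    qed
    thus ?thesis using True by (simp add: b_def)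
  next
    case False
    hence "nsq g > 0" using nsq_nonneg[OF assms(2)] by simp
    hence "b \<le> nsq f * nsq g" using *[of "1 / nsq g"] by (simp add: power2_eq_square field_simps)
    thus ?thesis by (simp add: b_def)
  qed
qed

section \<open>Finite sums, weakly null sequences and compactness\<close>

lemma zero_in: "(\<lambda>x. 0) \<in> S"
  using scale[OF ker_in[of 0], of 0] by (simp add: ballN_def)

lemma sum_in: "finite F \<Longrightarrow> (\<And>i. i \<in> F \<Longrightarrow> f i \<in> S) \<Longrightarrow> (\<lambda>x. \<Sum>i\<in>F. f i x) \<in> S"
  by (induction F rule: finite_induct) (auto intro: zero_in add)

lemma ip_zero_left: "f \<in> S \<Longrightarrow> ip (\<lambda>x. 0) f = 0"
  using ip_scale_left[OF zero_in, of f 0] by simp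

lemma ip_sum_left:
  "finite F \<Longrightarrow> (\<And>i. i \<in> F \<Longrightarrow> f i \<in> S) \<Longrightarrow> g \<in> S \<Longrightarrow>
    ip (\<lambda>x. \<Sum>i\<in>F. f i x) g = (\<Sum>i\<in>F. ip (f i) g)"
  by (induction F rule: finite_induct) (auto simp: ip_zero_left ip_add_left sum_in)

lemma ip_sum_right:
  "finite F \<Longrightarrow> (\<And>i. i \<in> F \<Longrightarrow> f i \<in> S) \<Longrightarrow> g \<in> S \<Longrightarrow>
    ip g (\<lambda>x. \<Sum>i\<in>F. f i x) = (\<Sum>i\<in>F. ip g (f i))"
  by (subst ip_commute) (auto simp: sum_in ip_sum_left ip_commute[of _ g] intro!: sum.cong)

text \<open>Greedy selection: each vector already chosen is almost orthogonal to all late members of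
  the sequence, and infinitely many of these satisfy \<open>P\<close>.\<close>

lemma ex_almost_orthogonal_subset:
  assumes lim: "\<And>m. (\<lambda>n. ip (e m) (e n)) \<longlonglongrightarrow> 0" and e: "\<And>n. e n \<in> S"
    and inf: "\<exists>\<^sub>\<infinity>n. P n" and \<epsilon>: "\<epsilon> > 0"
  shows "\<exists>F. finite F \<and> card F = J \<and> (\<forall>n\<in>F. P n) \<and>
    (\<forall>m\<in>F. \<forall>n\<in>F. m \<noteq> n \<longrightarrow> cmod (ip (e m) (e n)) < \<epsilon>)"
proof (induction J)
  case 0 show ?case by (intro exI[of _ "{}"]) simp
next
  case (Suc J)
  then obtain F where F: "finite F" "card F = J" "\<forall>n\<in>F. P n"
    "\<forall>m\<in>F. \<forall>n\<in>F. m \<noteq> n \<longrightarrow> cmod (ip (e m) (e n)) < \<epsilon>" by blast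
  have "\<forall>\<^sub>F n in sequentially. cmod (ip (e m) (e n)) < \<epsilon>" for m
    using tendstoD[OF lim \<epsilon>, of m] by (simp add: dist_norm)
  hence "\<forall>\<^sub>F n in sequentially. \<forall>m\<in>F. cmod (ip (e m) (e n)) < \<epsilon>"
    using F(1) by (simp add: eventually_ball_finite)
  moreover have "\<forall>\<^sub>F n in sequentially. \<forall>m\<in>F. m < n"
    using F(1) by (simp add: eventually_ball_finite eventually_gt_at_top)
  ultimately have "\<forall>\<^sub>F n in sequentially. \<forall>m\<in>F. m < n \<and> cmod (ip (e m) (e n)) < \<epsilon>"
    by eventually_elim auto
  hence "\<exists>\<^sub>\<infinity>n. P n \<and> (\<forall>m\<in>F. m < n \<and> cmod (ip (e m) (e n)) < \<epsilon>)"
    using frequently_eventually_conj[of P sequentially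
        "\<lambda>n. \<forall>m\<in>F. m < n \<and> cmod (ip (e m) (e n)) < \<epsilon>"] inf
    by (simp add: cofinite_eq_sequentially conj_commute)
  then obtain n where n: "P n" "\<And>m. m \<in> F \<Longrightarrow> m < n \<and> cmod (ip (e m) (e n)) < \<epsilon>"
    by (auto dest: INFM_EX)
  have "n \<notin> F" using n(2) by blast
  moreover have "cmod (ip (e n) (e m)) < \<epsilon>" if "m \<in> F" for m
    using n(2)[OF that] ip_commute[OF e e, of m n] by simp
  ultimately show ?case
    using F n by (intro exI[of _ "insert n F"]) auto
qed

text \<open>A Bessel-type argument. If \<open>cmod (ip a (e n)) \<ge> \<delta>\<close> infinitely
  often, take \<open>J\<close> almost orthogonal such vectors and add them with suitable phases. The
  sum pairs with \<open>a\<close> to at least \<open>J * \<delta>\<close>, yet its squared norm is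
  at most \<open>2 * J\<close>; for large \<open>J\<close> this contradicts Cauchy-Schwarz.\<close>

lemma weakly_null:
  assumes lim: "\<And>m. (\<lambda>n. ip (e m) (e n)) \<longlonglongrightarrow> 0" and e: "\<And>n. e n \<in> S"
    and unit: "\<And>n. nsq (e n) \<le> 1" and a: "a \<in> S"
  shows "(\<lambda>n. ip a (e n)) \<longlonglongrightarrow> 0"
proof (rule ccontr)
  assume "\<not> ?thesis"
  then obtain \<delta> where \<delta>: "\<delta> > 0" "\<not> (\<forall>\<^sub>F n in sequentially. cmod (ip a (e n)) < \<delta>)"
    by (auto simp: tendsto_iff dist_norm)
  hence inf: "\<exists>\<^sub>\<infinity>n. \<delta> \<le> cmod (ip a (e n))"
    by (simp add: frequently_def cofinite_eq_sequentially not_le)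
  obtain J :: nat where J: "real J > 2 * nsq a / \<delta>\<^sup>2" "J > 0"
    using reals_Archimedean2[of "max 0 (2 * nsq a / \<delta>\<^sup>2)"] by auto
  obtain F where F: "finite F" "card F = J" "\<forall>n\<in>F. \<delta> \<le> cmod (ip a (e n))"
    "\<forall>m\<in>F. \<forall>n\<in>F. m \<noteq> n \<longrightarrow> cmod (ip (e m) (e n)) < 1 / real J"
    using ex_almost_orthogonal_subset[OF lim e inf, of "1 / real J" J] J by auto
  define c where "c = (\<lambda>n. sgn (ip a (e n)))"
  define f where "f = (\<lambda>n x. c n * e n x)"
  have c: "cmod (c n) = 1" if "n \<in> F" for n
    using F(3) that \<delta>(1) by (force simp: c_def norm_sgn)
  have f: "f n \<in> S" for n by (simp add: f_def scale e)
  define s where "s = (\<lambda>x. \<Sum>n\<in>F. f n x)"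
  have s: "s \<in> S" unfolding s_def by (intro sum_in F f)
  have "ip a s = (\<Sum>n\<in>F. ip a (f n))" unfolding s_def by (intro ip_sum_right F f a)
  also have "\<dots> = (\<Sum>n\<in>F. of_real (cmod (ip a (e n))))"
  proof (intro sum.cong refl)
    fix n
    have "cnj (sgn z) * z = of_real (cmod z)" for z :: complex
      by (cases "z = 0") (simp_all add: sgn_eq mult.commute[of "cnj _"] mult_cnj_self power2_eq_square)
    thus "ip a (f n) = of_real (cmod (ip a (e n)))"
      by (simp add: f_def ip_scale_right e a c_def)
  qed
  finally have "cmod (ip a s) = (\<Sum>n\<in>F. cmod (ip a (e n)))"
    by (simp add: sum_nonneg flip: of_real_sum)
  also have "\<dots> \<ge> (\<Sum>n\<in>F. \<delta>)" by (intro sum_mono) (use F in auto)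
  finally have lower: "cmod (ip a s) \<ge> real J * \<delta>" using F by simp
  have "ip s s = (\<Sum>m\<in>F. \<Sum>n\<in>F. ip (f m) (f n))"
    unfolding s_def by (simp add: ip_sum_left ip_sum_right sum_in F f cong: sum.cong)
  moreover have "nsq s \<le> cmod (ip s s)"
    unfolding nsq_def by (rule complex_Re_le_cmod)
  ultimately have "nsq s \<le> cmod (\<Sum>m\<in>F. \<Sum>n\<in>F. ip (f m) (f n))"
    by simp
  also have "\<dots> \<le> (\<Sum>m\<in>F. \<Sum>n\<in>F. cmod (ip (f m) (f n)))"
    by (intro sum_norm_le norm_sum)
  \<comment> \<open>The diagonal contributes \<open>J\<close>, and the tolerance 1/J makes the J^2
    error terms contribute another \<open>J\<close>.\<close>
  also have "\<dots> \<le> (\<Sum>m\<in>F. \<Sum>n\<in>F. (if m = n then 1 else 0) + 1 / real J)"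
  proof (intro sum_mono)
    fix m n assume mn: "m \<in> F" "n \<in> F"
    have "cmod (ip (f m) (f n)) = cmod (ip (e m) (e n))"
      using c[OF mn(1)] c[OF mn(2)]
      by (simp add: f_def ip_scale_left ip_scale_right scale e norm_mult)
    also have "\<dots> \<le> (if m = n then 1 else 0) + 1 / real J"
    proof (cases "m = n")
      case True
      have "cmod (ip (e m) (e m)) \<le> 1" using unit[of m] nsq_nonneg[OF e, of m]
        by (simp add: ip_self e)
      thus ?thesis using True by (simp add: add_increasing2)
    next
      case False thus ?thesis using F(4) mn by fastforce
    qed
    finally show "cmod (ip (f m) (f n)) \<le> (if m = n then 1 else 0) + 1 / real J" .
  qed
  also have "\<dots> = 2 * real J"
    using F J by (simp add: sum.distrib)
  finally have upper: "nsq s \<le> 2 * real J" .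
  have "(real J * \<delta>)\<^sup>2 \<le> (cmod (ip a s))\<^sup>2" using lower \<delta>(1) by (intro power_mono) auto
  also have "\<dots> \<le> nsq a * nsq s" by (rule Cauchy_Schwarz[OF a s])
  also have "\<dots> \<le> nsq a * (2 * real J)"
    using upper nsq_nonneg[OF a] by (intro mult_left_mono)
  finally have "real J * \<delta>\<^sup>2 \<le> 2 * nsq a"
    using J by (simp add: power2_eq_square algebra_simps)
  thus False using J(1) \<delta>(1) by (simp add: field_simps)
qed

text \<open>Compactness yields only a Cauchy sequence of images, so these are compared with a fixed
  late one, \<open>D (e (r M))\<close>, an element of \<open>S\<close> to which
  \<open>weakly_null\<close> applies.\<close>

lemma compact_diagonal_null:
  assumes compact: "compact_op S ip D" and D: "\<And>f. f \<in> S \<Longrightarrow> D f \<in> S"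
    and lim: "\<And>m. (\<lambda>n. ip (e m) (e n)) \<longlonglongrightarrow> 0" and e: "\<And>n. e n \<in> S"
    and unit: "\<And>n. nsq (e n) \<le> 1"
  obtains r :: "nat \<Rightarrow> nat" where "strict_mono r" "(\<lambda>n. ip (D (e (r n))) (e (r n))) \<longlonglongrightarrow> 0"
proof -
  have "\<forall>n. ipnorm ip (e n) \<le> 1"
    using unit by (simp add: ipnorm_def nsq_def)
  then obtain r :: "nat \<Rightarrow> nat" where r: "strict_mono r"
    and cauchy: "\<And>\<epsilon>. \<epsilon> > 0 \<Longrightarrow> \<exists>M. \<forall>m\<ge>M. \<forall>n\<ge>M.
      ipnorm ip (\<lambda>x. D (e (r m)) x - D (e (r n)) x) < \<epsilon>"
    using compact e unfolding compact_op_def by blast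
  have "(\<lambda>n. ip (D (e (r n))) (e (r n))) \<longlonglongrightarrow> 0"
  proof (rule tendstoI)
    fix \<epsilon> :: real assume "\<epsilon> > 0"
    then obtain M where M: "\<And>m n. m \<ge> M \<Longrightarrow> n \<ge> M \<Longrightarrow>
        ipnorm ip (\<lambda>x. D (e (r m)) x - D (e (r n)) x) < \<epsilon> / 2"
      using cauchy[of "\<epsilon> / 2"] by auto
    have "(\<lambda>n. ip (D (e (r M))) (e (r n))) \<longlonglongrightarrow> 0"
      using weakly_null[OF lim e unit D[OF e]] r
      by (rule LIMSEQ_subseq_LIMSEQ[unfolded o_def])
    from tendstoD[OF this, of "\<epsilon> / 2"]
    have "\<forall>\<^sub>F n in sequentially. cmod (ip (D (e (r M))) (e (r n))) < \<epsilon> / 2"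
      using \<open>\<epsilon> > 0\<close> by (simp only: dist_norm diff_zero half_gt_zero)
    thus "\<forall>\<^sub>F n in sequentially. dist (ip (D (e (r n))) (e (r n))) 0 < \<epsilon>"
      using eventually_ge_at_top[of M]
    proof eventually_elim
      case (elim n)
      let ?g = "\<lambda>x. D (e (r n)) x - D (e (r M)) x"
      have g: "?g \<in> S" by (intro diff D e)
      have "(cmod (ip ?g (e (r n))))\<^sup>2 \<le> nsq ?g * nsq (e (r n))"
        by (rule Cauchy_Schwarz[OF g e])
      also have "\<dots> \<le> nsq ?g * 1"
        using unit nsq_nonneg[OF g] by (intro mult_left_mono)
      also have "\<dots> = (ipnorm ip ?g)\<^sup>2"
        using nsq_nonneg[OF g] by (simp add: ipnorm_def nsq_def)
      finally have "cmod (ip ?g (e (r n))) \<le> ipnorm ip ?g"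
        by (rule power2_le_imp_le) (simp add: ipnorm_def ip_nonneg g)
      also have "\<dots> < \<epsilon> / 2" using M[OF elim(2) order_refl] .
      finally have "cmod (ip (D (e (r n))) (e (r n)) - ip (D (e (r M))) (e (r n))) < \<epsilon> / 2"
        by (simp add: ip_diff_left D e)
      hence "cmod (ip (D (e (r n))) (e (r n))) < \<epsilon>"
        using elim(1) norm_triangle_sub[of "ip (D (e (r n))) (e (r n))" "ip (D (e (r M))) (e (r n))"]
        by linarith
      thus ?case by simp
    qed
  qed
  with r show ?thesis by (rule that)
qed

end

section \<open>Failure of essential normality\<close>

lemma powr_two_mult: "0 < x \<Longrightarrow> x powr (2 * a) = (x\<^sup>2) powr a" for x :: real
proof -
  assume "0 < x"
  have "x powr (2 * a) = (x powr 2) powr a" by (rule powr_powr[symmetric])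
  thus ?thesis using \<open>0 < x\<close> by simp
qed

lemma one_minus_norm_sq_pos: "w \<in> ballN \<Longrightarrow> 0 < 1 - (norm w)\<^sup>2"
  by (simp add: ballN_def abs_square_less_1)

text \<open>For \<open>z\<close> in the closed ball and \<open>\<zeta>\<close> on the sphere, |z -
  \<zeta>|^2 \<le> 2 Re (1 - <z, \<zeta>>); replacing \<open>\<zeta>\<close> by its multiple by
  \<open>t\<close> costs at most the factor \<open>t\<close>.\<close>

lemma Re_one_minus_cinner_ge:
  assumes "norm z \<le> 1" "norm \<zeta> = 1" "\<delta> \<le> norm (z - \<zeta>)" "0 \<le> \<delta>" "0 \<le> t" "t \<le> 1"
  shows "t * \<delta>\<^sup>2 / 2 \<le> Re (1 - cinner z (of_real t *s \<zeta>))"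
proof -
  have "(complex_of_real (norm (z - \<zeta>)))\<^sup>2 = cinner (z - \<zeta>) (z - \<zeta>)"
    by (simp add: cinner_self)
  also have "\<dots> = (complex_of_real (norm z))\<^sup>2 + 1 - (cinner z \<zeta> + cnj (cinner z \<zeta>))"
    unfolding cinner_diff_left cinner_diff_right cinner_commute[of \<zeta> z]
    using assms(2) by (simp add: cinner_self)
  finally have "Re ((complex_of_real (norm (z - \<zeta>)))\<^sup>2)
      = Re ((complex_of_real (norm z))\<^sup>2 + 1 - (cinner z \<zeta> + cnj (cinner z \<zeta>)))" by simp
  hence "(norm (z - \<zeta>))\<^sup>2 = (norm z)\<^sup>2 + 1 - 2 * Re (cinner z \<zeta>)"
    by (simp flip: of_real_power)
  moreover have "\<delta>\<^sup>2 \<le> (norm (z - \<zeta>))\<^sup>2" using assms by (intro power_mono) auto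
  moreover have "(norm z)\<^sup>2 \<le> 1" using assms(1) by (simp add: abs_square_le_1)
  ultimately have "\<delta>\<^sup>2 / 2 \<le> 1 - Re (cinner z \<zeta>)" by simp
  hence "t * (\<delta>\<^sup>2 / 2) \<le> t * (1 - Re (cinner z \<zeta>))" using assms(5) by (rule mult_left_mono)
  also have "\<dots> \<le> Re (1 - cinner z (of_real t *s \<zeta>))"
    using assms(6) by (simp add: cinner_simps algebra_simps)
  finally show ?thesis by simp
qed

locale kernel_space_automorphism = kernel_space S ip \<gamma> mass + lf_automorphism A B C d k
  for S :: "((complex,'n::{finite,linorder}) vec \<Rightarrow> complex) set" and ip \<gamma> mass
    and A :: "complex^('n::{finite,linorder})^('n::{finite,linorder})" and B C d k
begin

abbreviation "T \<equiv> Cop \<phi>"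

definition nker :: "(complex,'n) vec \<Rightarrow> (complex,'n) vec \<Rightarrow> complex" where
  "nker w = (\<lambda>z. of_real ((1 - (norm w)\<^sup>2) powr (\<gamma> / 2)) * ker \<gamma> w z)"

lemma nker_in: "w \<in> ballN \<Longrightarrow> nker w \<in> S"
  unfolding nker_def by (intro scale ker_in)

lemma nsq_ker: "w \<in> ballN \<Longrightarrow> nsq (ker \<gamma> w) = (1 - (norm w)\<^sup>2) powr (- \<gamma>)"
  by (simp add: nsq_def reproducing ker_in ker_self)

lemma powr_half_sq: "0 \<le> x \<Longrightarrow> (x powr (\<gamma> / 2))\<^sup>2 = x powr \<gamma>" for x :: real
  by (simp add: power2_eq_square flip: powr_add)

lemma nsq_nker: "w \<in> ballN \<Longrightarrow> nsq (nker w) = 1"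
  using one_minus_norm_sq_pos[of w]
  by (simp add: nker_def nsq_scale ker_in nsq_ker powr_half_sq flip: powr_add)

lemma nker_self: "w \<in> ballN \<Longrightarrow> nker w w = of_real ((1 - (norm w)\<^sup>2) powr (- \<gamma> / 2))"
  by (simp add: nker_def ker_self flip: powr_add of_real_mult)

lemma ratio_norm_lf_map:
  assumes u: "u \<in> ballK k"
  shows "(1 - (norm u)\<^sup>2) / (1 - (norm (\<phi> u))\<^sup>2) = (cmod (den u))\<^sup>2 / kap"
proof -
  define x where "x = 1 - (norm u)\<^sup>2"
  have ub: "u \<in> ballN" "u \<in> E" "norm u < 1" using u by (auto simp: ballK_def ballN_def)
  have "x > 0" unfolding x_def using one_minus_norm_sq_pos[OF ub(1)] .
  thus ?thesis
    unfolding one_minus_norm_lf_map[OF ub(2,3)] x_def[symmetric]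
    using kap_pos den_nonzero_ball[OF ub(1)] by simp
qed

text \<open>\<open>Ts\<close> is known only through its pairings. Against every \<open>f\<close> in
  \<open>S\<close>, \<open>Ts (nker w)\<close> pairs like the multiple \<open>g\<close> of the
  kernel at \<open>\<phi> w\<close>, and this determines its norm.\<close>

lemma nsq_adjoint_nker:
  assumes adj: "\<And>f g. f \<in> S \<Longrightarrow> g \<in> S \<Longrightarrow> ip (T f) g = ip f (Ts g)"
    and TS: "\<And>f. f \<in> S \<Longrightarrow> T f \<in> S" and TsS: "\<And>f. f \<in> S \<Longrightarrow> Ts f \<in> S"
    and w: "w \<in> ballK k"
  shows "nsq (Ts (nker w)) = ((cmod (den w))\<^sup>2 / kap) powr \<gamma>"
proof -
  have wb: "w \<in> ballN" "\<phi> w \<in> ballN" using w lf_map_ballK by (auto simp: ballK_def)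
  define c where "c = complex_of_real ((1 - (norm w)\<^sup>2) powr (\<gamma> / 2))"
  define g where "g = (\<lambda>z. c * ker \<gamma> (\<phi> w) z)"
  have g: "g \<in> S" unfolding g_def by (intro scale ker_in wb)
  have *: "ip f (Ts (nker w)) = ip f g" if f: "f \<in> S" for f
  proof -
    have "ip f (Ts (nker w)) = ip (T f) (nker w)" by (simp add: adj f nker_in wb)
    also have "\<dots> = cnj c * T f w"
      unfolding nker_def c_def by (simp add: ip_scale_right ker_in wb TS f reproducing)
    also have "\<dots> = ip f g"
      unfolding g_def by (simp add: ip_scale_right ker_in wb f reproducing Cop_def)
    finally show ?thesis .
  qed
  have "ip (Ts (nker w)) (Ts (nker w)) = ip (Ts (nker w)) g"
    by (rule *) (intro TsS nker_in wb)
  also have "\<dots> = cnj (ip g g)"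
    using ip_commute[OF g TsS[OF nker_in[OF wb(1)]]] *[OF g] by simp
  finally have "nsq (Ts (nker w)) = nsq g" by (simp add: nsq_def)
  also have "\<dots> = (1 - (norm w)\<^sup>2) powr \<gamma> * (1 - (norm (\<phi> w))\<^sup>2) powr (- \<gamma>)"
    using one_minus_norm_sq_pos[OF wb(1)]
    by (simp add: g_def c_def nsq_scale ker_in wb nsq_ker powr_half_sq)
  also have "\<dots> = ((1 - (norm w)\<^sup>2) / (1 - (norm (\<phi> w))\<^sup>2)) powr \<gamma>"
    using one_minus_norm_sq_pos[OF wb(1)] one_minus_norm_sq_pos[OF wb(2)]
    by (simp add: powr_divide powr_minus) (simp add: divide_inverse)
  also have "(1 - (norm w)\<^sup>2) / (1 - (norm (\<phi> w))\<^sup>2) = (cmod (den w))\<^sup>2 / kap"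
    by (rule ratio_norm_lf_map[OF w])
  finally show ?thesis .
qed

text \<open>Cauchy-Schwarz against \<open>ker \<gamma> u\<close>: the value at \<open>u\<close>
  alone accounts for the expected limit, at every \<open>u\<close> and without an integral
  estimate.\<close>

lemma nsq_T_nker_ge:
  assumes TS: "\<And>f. f \<in> S \<Longrightarrow> T f \<in> S" and u: "u \<in> ballK k"
  shows "((cmod (den u))\<^sup>2 / kap) powr \<gamma> \<le> nsq (T (nker (\<phi> u)))"
proof -
  have ub: "u \<in> ballN" "\<phi> u \<in> ballN" using u lf_map_ballK by (auto simp: ballK_def)
  let ?x = "1 - (norm u)\<^sup>2" and ?y = "1 - (norm (\<phi> u))\<^sup>2"
  have pos: "?x > 0" "?y > 0" using one_minus_norm_sq_pos ub by blast+
  have "ip (T (nker (\<phi> u))) (ker \<gamma> u) = T (nker (\<phi> u)) u"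
    using ub by (intro reproducing TS nker_in)
  also have "\<dots> = of_real (?y powr (- \<gamma> / 2))"
    using ub nker_self[of "\<phi> u"] by (simp add: Cop_def)
  finally have "ip (T (nker (\<phi> u))) (ker \<gamma> u) = of_real (?y powr (- \<gamma> / 2))" .
  hence "(?y powr (- \<gamma> / 2))\<^sup>2 \<le> nsq (T (nker (\<phi> u))) * nsq (ker \<gamma> u)"
    using Cauchy_Schwarz[OF TS[OF nker_in[OF ub(2)]] ker_in[OF ub(1)]] by simp
  moreover have "(?y powr (- \<gamma> / 2))\<^sup>2 = ?y powr (- \<gamma>)"
    by (simp add: power2_eq_square flip: powr_add)
  ultimately have "?y powr (- \<gamma>) * ?x powr \<gamma> \<le> nsq (T (nker (\<phi> u))) * ?x powr (- \<gamma>) * ?x powr \<gamma>"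
    using ub by (intro mult_right_mono) (simp_all add: nsq_ker)
  also have "\<dots> = nsq (T (nker (\<phi> u)))"
    using pos by (simp add: mult.assoc flip: powr_add)
  finally show ?thesis
    using pos unfolding ratio_norm_lf_map[OF u, symmetric]
    by (simp add: powr_divide powr_minus) (simp add: divide_inverse mult.commute)
qed

text \<open>Stated for moduli only, since the principal power of a product of complex numbers need
  not be the product of their powers.\<close>

lemma cmod_T_nker_sq:
  assumes u: "u \<in> ballK k" "u \<noteq> 0" and z: "z \<in> ballN"
  shows "(cmod (T (nker (\<phi> u)) z))\<^sup>2 = (1 - (norm (\<phi> u))\<^sup>2) powr \<gamma> *
    (cmod (den z) * cmod (den u) / kap) powr (2 * \<gamma>) * (cmod (ker \<gamma> u z))\<^sup>2"
proof -
  have ub: "u \<in> ballN" "\<phi> u \<in> ballN" "u \<in> E" using u lf_map_ballK by (auto simp: ballK_def)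
  have y: "0 \<le> 1 - (norm (\<phi> u))\<^sup>2" using one_minus_norm_sq_pos[OF ub(2)] by simp
  have nz: "den z \<noteq> 0" "den u \<noteq> 0" using den_nonzero_ball z ub by auto
  define q where "q = cmod (1 - cinner z u)"
  define b where "b = cmod (den z) * cmod (den u) / kap"
  have b: "b > 0" using nz kap_pos by (simp add: b_def)
  have "cmod (1 - cinner (\<phi> z) (\<phi> u)) = q / b"
    unfolding one_minus_cinner_lf_map[OF z ub(3,1) u(2)] using kap_pos nz
    by (simp add: q_def b_def norm_divide norm_mult)
  hence "cmod (ker \<gamma> (\<phi> u) (\<phi> z)) = (q / b) powr (- \<gamma>)"
    using lf_map_ball[OF z] by (simp add: norm_ker)
  also have "\<dots> = b powr \<gamma> * q powr (- \<gamma>)"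
    using b by (simp add: powr_divide q_def powr_minus) (simp add: divide_inverse)
  finally have "(cmod (T (nker (\<phi> u)) z))\<^sup>2
      = (1 - (norm (\<phi> u))\<^sup>2) powr \<gamma> * (b powr \<gamma> * q powr (- \<gamma>))\<^sup>2"
    using z powr_half_sq[OF y] by (simp add: Cop_def nker_def norm_mult power_mult_distrib)
  also have "(b powr \<gamma> * q powr (- \<gamma>))\<^sup>2 = b powr (2 * \<gamma>) * (q powr (- \<gamma>))\<^sup>2"
    by (simp add: power2_eq_square mult_ac powr_add[symmetric] flip: mult_2)
  also have "q powr (- \<gamma>) = cmod (ker \<gamma> u z)" using z by (simp add: q_def norm_ker)
  finally show ?thesis by (simp add: b_def mult.assoc)
qed

text \<open>Near \<open>\<zeta>\<close> the factor \<open>|den|\<close> is close to its value at \<open>\<zeta>\<close>; away from \<open>\<zeta>\<close> the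
  kernel functions at points of the radius through \<open>\<zeta>\<close> are uniformly bounded.\<close>

lemma nsq_T_nker_le:
  assumes TS: "\<And>f. f \<in> S \<Longrightarrow> T f \<in> S"
    and \<zeta>: "norm \<zeta> = 1" "\<zeta> \<in> E" and \<epsilon>: "\<epsilon> > 0"
  shows "\<exists>c. \<forall>t. 1/2 \<le> t \<longrightarrow> t < 1 \<longrightarrow>
      nsq (T (nker (\<phi> (of_real t *s \<zeta>)))) \<le> (cmod (den \<zeta>) powr (2 * \<gamma>) + \<epsilon>) / kap powr \<gamma>
        + c * (1 - (norm (\<phi> (of_real t *s \<zeta>)))\<^sup>2) powr \<gamma>"
proof -
  have "isCont (\<lambda>z. cmod (den z) powr (2 * \<gamma>)) \<zeta>"
    unfolding den_def using den_nonzero[of \<zeta>] \<zeta>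
    by (intro continuous_intros) (auto simp: den_def)
  then obtain \<delta> where \<delta>: "\<delta> > 0"
    "\<And>z. dist z \<zeta> < \<delta> \<Longrightarrow> dist (cmod (den z) powr (2 * \<gamma>)) (cmod (den \<zeta>) powr (2 * \<gamma>)) < \<epsilon>"
    using \<epsilon> unfolding continuous_at_eps_delta dist_norm by blast
  define H where "H = norm C + cmod d"
  have H: "cmod (den z) \<le> H" if "norm z \<le> 1" for z
  proof -
    have "cmod (den z) \<le> norm z * norm C + cmod d"
      unfolding den_def using norm_triangle_ineq[of "cinner z C" d] cinner_Cauchy_Schwarz[of z C] by linarith
    also have "\<dots> \<le> H" using that mult_right_mono[of "norm z" 1 "norm C"] by (simp add: H_def)
    finally show ?thesis .
  qed
  have H0: "H > 0" using H[of \<zeta>] den_nonzero[of \<zeta>] \<zeta> by (smt (verit) zero_less_norm_iff)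
  \<comment> \<open>\<open>H\<close> bounds |den| on the closed ball. For \<open>t \<ge> 1/2\<close>
    and \<open>z\<close> at distance at least \<open>\<delta>\<close> from \<open>\<zeta>\<close>,
    |1 - <z, u>| is at least \<delta>^2 / 4.\<close>
  define c0 where "c0 = (H * H / kap) powr (2 * \<gamma>) * ((\<delta>\<^sup>2 / 4) powr (- \<gamma>))\<^sup>2"
  define c where "c = c0 * \<bar>mass\<bar>"
  show ?thesis
  proof (intro exI[of _ c] allI impI)
    fix t :: real assume t: "1/2 \<le> t" "t < 1"
    define u where "u = of_real t *s \<zeta>"
    have u: "u \<in> ballK k" "u \<noteq> 0" "u \<in> ballN" "norm u = t"
      using t \<zeta> by (auto simp: u_def ballK_iff ballN_def intro: subspE_smult)
    have pu: "\<phi> u \<in> ballN" using lf_map_ball u by blast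
    define y where "y = (1 - (norm (\<phi> u))\<^sup>2) powr \<gamma>"
    have y: "y \<ge> 0" by (simp add: y_def)
    define R where "R = cmod (den \<zeta>) powr (2 * \<gamma>) + \<epsilon>"
    have R: "R \<ge> 0" using \<epsilon> by (simp add: R_def)
    define c1 where "c1 = y * (R * (cmod (den u) / kap) powr (2 * \<gamma>))"
    have c1: "c1 \<ge> 0" using y R by (simp add: c1_def)
    have bound: "(cmod (T (nker (\<phi> u)) z))\<^sup>2 \<le> c1 * (cmod (ker \<gamma> u z))\<^sup>2 + y * c0" if z: "z \<in> ballN" for z
    proof (cases "dist z \<zeta> < \<delta>")
      case True
      have "cmod (den z) powr (2 * \<gamma>) \<le> R"
        using \<delta>(2)[OF True] by (simp add: R_def dist_real_def)
      hence "cmod (den z) powr (2 * \<gamma>) * (cmod (den u) / kap) powr (2 * \<gamma>) \<le> R * (cmod (den u) / kap) powr (2 * \<gamma>)"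
        by (intro mult_right_mono) auto
      moreover have "cmod (den z) powr (2 * \<gamma>) * (cmod (den u) / kap) powr (2 * \<gamma>)
          = (cmod (den z) * cmod (den u) / kap) powr (2 * \<gamma>)"
        using kap_pos by (simp add: powr_mult flip: times_divide_eq_right)
      ultimately have "(cmod (den z) * cmod (den u) / kap) powr (2 * \<gamma>) \<le> R * (cmod (den u) / kap) powr (2 * \<gamma>)"
        by simp
      hence "(cmod (T (nker (\<phi> u)) z))\<^sup>2 \<le> c1 * (cmod (ker \<gamma> u z))\<^sup>2"
        unfolding cmod_T_nker_sq[OF u(1,2) z] c1_def y_def[symmetric]
        using y by (intro mult_right_mono mult_left_mono) auto
      thus ?thesis using y by (simp add: add_increasing2 c0_def)
    next
      case False
      have z1: "norm z \<le> 1" using z by (simp add: ballN_def)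
      have "\<delta>\<^sup>2 / 4 \<le> t * \<delta>\<^sup>2 / 2" using t mult_right_mono[of "1/2" t "\<delta>\<^sup>2"] by simp
      also have "\<dots> \<le> Re (1 - cinner z u)"
        unfolding u_def using z1 \<zeta> False \<delta>(1) t
        by (intro Re_one_minus_cinner_ge) (auto simp: dist_norm)
      also have "\<dots> \<le> cmod (1 - cinner z u)" by (rule complex_Re_le_cmod)
      finally have "cmod (ker \<gamma> u z) \<le> (\<delta>\<^sup>2 / 4) powr (- \<gamma>)"
        using \<delta>(1) gamma_pos z by (simp add: norm_ker powr_mono2')
      hence k: "(cmod (ker \<gamma> u z))\<^sup>2 \<le> ((\<delta>\<^sup>2 / 4) powr (- \<gamma>))\<^sup>2"
        by (intro power_mono) auto
      have "cmod (den z) * cmod (den u) / kap \<le> H * H / kap"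
        using H[OF z1] H[of u] u(4) t H0 kap_pos by (intro divide_right_mono mult_mono) auto
      hence "(cmod (den z) * cmod (den u) / kap) powr (2 * \<gamma>) \<le> (H * H / kap) powr (2 * \<gamma>)"
        using gamma_pos kap_pos by (intro powr_mono2) auto
      hence "(cmod (T (nker (\<phi> u)) z))\<^sup>2 \<le> y * (H * H / kap) powr (2 * \<gamma>) * ((\<delta>\<^sup>2 / 4) powr (- \<gamma>))\<^sup>2"
        unfolding cmod_T_nker_sq[OF u(1,2) z] y_def[symmetric]
        using y k by (intro mult_mono mult_left_mono) auto
      also have "\<dots> = y * c0" by (simp add: c0_def)
      finally show ?thesis using c1 by (simp add: add_increasing)
    qed
    have "nsq (T (nker (\<phi> u))) \<le> c1 * nsq (ker \<gamma> u) + (y * c0) * mass"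
      unfolding nsq_def
      by (rule dominated[OF TS[OF nker_in[OF pu]] ker_in[OF u(3)] c1 _ bound])
        (use y in \<open>simp_all add: c0_def\<close>)
    also have "(y * c0) * mass \<le> c * y"
      using mult_left_mono[of mass "\<bar>mass\<bar>" "y * c0"] y
      by (simp add: c_def c0_def mult_ac)
    \<comment> \<open>By \<open>ratio_norm_lf_map\<close> all factors that depend on
      \<open>u\<close> cancel exactly, so the main term involves no limit.\<close>
    also have "c1 * nsq (ker \<gamma> u) = R / kap powr \<gamma>"
    proof -
      have pos: "1 - (norm u)\<^sup>2 > 0" "1 - (norm (\<phi> u))\<^sup>2 > 0" using one_minus_norm_sq_pos u pu by blast+
      have dp: "cmod (den u) > 0" using den_nonzero_ball[OF u(3)] by simp
      have "((1 - (norm u)\<^sup>2) / (1 - (norm (\<phi> u))\<^sup>2)) powr \<gamma> = ((cmod (den u))\<^sup>2 / kap) powr \<gamma>"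
        by (simp add: ratio_norm_lf_map[OF u(1)])
      hence "(1 - (norm u)\<^sup>2) powr \<gamma> = y * ((cmod (den u))\<^sup>2 / kap) powr \<gamma>"
        using pos by (simp add: y_def powr_divide field_simps)
      moreover have "(cmod (den u) / kap) powr (2 * \<gamma>) * kap powr \<gamma>
          = ((cmod (den u) / kap)\<^sup>2 * kap) powr \<gamma>"
        using dp kap_pos by (simp only: powr_mult powr_two_mult divide_pos_pos)
      moreover have "(cmod (den u) / kap)\<^sup>2 * kap = (cmod (den u))\<^sup>2 / kap"
        using kap_pos by (simp add: power2_eq_square)
      ultimately have "y * (cmod (den u) / kap) powr (2 * \<gamma>) * kap powr \<gamma> = (1 - (norm u)\<^sup>2) powr \<gamma>"
        by simp
      thus ?thesis using pos kap_pos u(3)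
        by (simp add: c1_def nsq_ker powr_minus field_simps)
    qed
    finally show "nsq (T (nker (\<phi> (of_real t *s \<zeta>)))) \<le> (cmod (den \<zeta>) powr (2 * \<gamma>) + \<epsilon>) / kap powr \<gamma>
        + c * (1 - (norm (\<phi> (of_real t *s \<zeta>)))\<^sup>2) powr \<gamma>"
      by (simp add: u_def R_def y_def)
  qed
qed

lemma isCont_lf_map:
  assumes "norm \<zeta> = 1" "\<zeta> \<in> E"
  shows "isCont \<phi> \<zeta>"
proof -
  have "(den \<longlongrightarrow> den \<zeta>) (at \<zeta>)"
    unfolding den_def by (intro tendsto_intros bounded_linear.tendsto[OF bounded_linear_cinner_left])
  moreover have "(num \<longlongrightarrow> num \<zeta>) (at \<zeta>)"
    unfolding num_def matrix_vector_mult_def by (intro tendsto_intros)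
  ultimately show ?thesis
    using den_nonzero[of \<zeta>] assms
    unfolding isCont_def lf_map_eq vector_scalar_mult_def by (intro tendsto_intros) auto
qed

theorem not_ess_normal:
  assumes "\<not> rotation_on_Bk k \<phi>"
  shows "\<not> ess_normal S ip T"
proof
  assume "ess_normal S ip T"
  then obtain Ts where TS: "\<And>f. f \<in> S \<Longrightarrow> T f \<in> S"
    and TsS: "\<And>f. f \<in> S \<Longrightarrow> Ts f \<in> S"
    and adj: "\<And>f g. f \<in> S \<Longrightarrow> g \<in> S \<Longrightarrow> ip (T f) g = ip f (Ts g)"
    and compact: "compact_op S ip (\<lambda>f x. Ts (T f) x - T (Ts f) x)"
    unfolding ess_normal_def by blast
  obtain \<zeta> where \<zeta>: "norm \<zeta> = 1" "\<zeta> \<in> E" and ne: "cmod (den (\<phi> \<zeta>)) \<noteq> cmod (den \<zeta>)"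
    using rotation_if_invariant assms by blast
  \<comment> \<open>Starting at 1/2 keeps every \<open>u n\<close> away from 0 and within the range
    of \<open>nsq_T_nker_le\<close>.\<close>
  define t where "t = (\<lambda>n::nat. 1 - 1 / (real n + 2))"
  define u where "u = (\<lambda>n. complex_of_real (t n) *s \<zeta>)"
  define w where "w = (\<lambda>n. \<phi> (u n))"
  have t: "1/2 \<le> t n" "t n < 1" for n by (auto simp: t_def field_simps)
  have tlim: "t \<longlonglongrightarrow> 1" unfolding t_def by real_asymp
  have uK: "u n \<in> ballK k" for n
    using t[of n] \<zeta> by (auto simp: u_def ballK_iff intro: subspE_smult)
  have wK: "w n \<in> ballK k" for n unfolding w_def by (rule lf_map_ballK[OF uK])
  have wB: "w n \<in> ballN" for n using wK by (auto simp: ballK_def)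
  have "(\<lambda>n. t n *\<^sub>R \<zeta>) \<longlonglongrightarrow> 1 *\<^sub>R \<zeta>" by (intro tendsto_intros tlim)
  hence ulim: "u \<longlonglongrightarrow> \<zeta>" by (simp add: u_def scaleR_eq_smult)
  have wlim: "w \<longlonglongrightarrow> \<phi> \<zeta>"
    unfolding w_def by (rule isCont_tendsto_compose[OF isCont_lf_map[OF \<zeta>] ulim])
  have p\<zeta>: "norm (\<phi> \<zeta>) = 1" "\<phi> \<zeta> \<in> E" using norm_lf_map_sphere[OF \<zeta>] by auto
  have denlim: "(\<lambda>n. den (x n)) \<longlonglongrightarrow> den x0" if "x \<longlonglongrightarrow> x0" for x x0
    unfolding den_def by (intro tendsto_intros bounded_linear.tendsto[OF bounded_linear_cinner_left] that)
  define y where "y = (\<lambda>n. 1 - (norm (w n))\<^sup>2)"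
  have ypos: "y n > 0" for n unfolding y_def using one_minus_norm_sq_pos[OF wB] .
  have ylim: "y \<longlonglongrightarrow> 0" unfolding y_def using p\<zeta>(1) wlim by (auto intro!: tendsto_eq_intros)
  have ypow: "(\<lambda>n. y n powr a) \<longlonglongrightarrow> 0" if "a > 0" for a
    using tendsto_zero_powrI[OF ylim tendsto_const[of a] _ that] ypos by (simp add: less_imp_le)
  define e where "e = (\<lambda>n. nker (w n))"
  have eS: "e n \<in> S" for n unfolding e_def by (rule nker_in[OF wB])
  have e1: "nsq (e n) \<le> 1" for n unfolding e_def by (simp add: nsq_nker wB)
  \<comment> \<open>The kernel at the fixed point \<open>w m\<close> stays bounded on the ball,
    while the normalizing factor of \<open>e n\<close> tends to zero as \<open>w n\<close>
    approaches the sphere.\<close>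
  have elim: "(\<lambda>n. ip (e m) (e n)) \<longlonglongrightarrow> 0" for m
  proof (rule Lim_null_comparison)
    define M where "M = (1 - norm (w m)) powr (- \<gamma>)"
    have wm: "norm (w m) < 1" using wB[of m] by (simp add: ballN_def)
    show "(\<lambda>n. y m powr (\<gamma> / 2) * M * y n powr (\<gamma> / 2)) \<longlonglongrightarrow> 0"
      using gamma_pos by (intro tendsto_mult_right_zero ypow) simp
    show "\<forall>\<^sub>F n in sequentially. cmod (ip (e m) (e n)) \<le> y m powr (\<gamma> / 2) * M * y n powr (\<gamma> / 2)"
    proof (rule always_eventually, rule allI)
      fix n
      have "ip (e m) (e n) = of_real (y n powr (\<gamma> / 2)) * (of_real (y m powr (\<gamma> / 2)) * ker \<gamma> (w m) (w n))"
        unfolding e_def nker_def[of "w n"] y_def[symmetric]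
        by (simp add: ip_scale_right nker_in ker_in wB reproducing) (simp add: nker_def y_def)
      hence "cmod (ip (e m) (e n)) = y n powr (\<gamma> / 2) * y m powr (\<gamma> / 2) * cmod (ker \<gamma> (w m) (w n))"
        by (simp add: norm_mult)
      moreover have "cmod (ker \<gamma> (w m) (w n)) \<le> M"
      proof -
        have "cmod (cinner (w n) (w m)) \<le> 1 * norm (w m)"
          using cinner_Cauchy_Schwarz[of "w n" "w m"] wB[of n]
            mult_right_mono[of "norm (w n)" 1 "norm (w m)"] by (simp add: ballN_def)
        hence "1 - norm (w m) \<le> cmod (1 - cinner (w n) (w m))"
          using norm_triangle_ineq2[of 1 "cinner (w n) (w m)"] by simp
        thus ?thesis using wm gamma_pos by (simp add: norm_ker wB M_def powr_mono2')
      qed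
      ultimately show "cmod (ip (e m) (e n)) \<le> y m powr (\<gamma> / 2) * M * y n powr (\<gamma> / 2)"
        using mult_left_mono[of "cmod (ker \<gamma> (w m) (w n))" M "y m powr (\<gamma> / 2) * y n powr (\<gamma> / 2)"]
        by (simp add: mult_ac)
    qed
  qed
  let ?D = "\<lambda>f x. Ts (T f) x - T (Ts f) x"
  have DS: "?D f \<in> S" if "f \<in> S" for f by (intro diff TS TsS that)
  obtain r :: "nat \<Rightarrow> nat" where r: "strict_mono r"
    and lim0: "(\<lambda>n. ip (?D (e (r n))) (e (r n))) \<longlonglongrightarrow> 0"
    using compact_diagonal_null[OF compact DS elim eS e1] by blast
  have Dip: "ip (?D f) f = of_real (nsq (T f) - nsq (Ts f))" if f: "f \<in> S" for f
  proof -
    have "ip (Ts (T f)) f = cnj (ip (T f) (T f))"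
      using f by (simp add: adj TS TsS ip_commute[of f "Ts (T f)"])
    moreover have "ip (T (Ts f)) f = ip (Ts f) (Ts f)"
      using f by (simp add: adj TsS)
    ultimately show ?thesis
      using f by (simp add: ip_diff_left TS TsS ip_self)
  qed
  have "(\<lambda>n. Re (ip (?D (e (r n))) (e (r n)))) \<longlonglongrightarrow> Re 0" by (intro tendsto_intros lim0)
  hence lim1: "(\<lambda>n. nsq (T (e (r n))) - nsq (Ts (e (r n)))) \<longlonglongrightarrow> 0"
    by (simp add: Dip eS)
  define L where "L = (\<lambda>z. ((cmod (den z))\<^sup>2 / kap) powr \<gamma>)"
  have Llim: "(\<lambda>n. L (x n)) \<longlonglongrightarrow> L x0" if "x \<longlonglongrightarrow> x0" "norm x0 = 1" "x0 \<in> E" for x x0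
    unfolding L_def using den_nonzero[of x0] that kap_pos gamma_pos
    by (intro tendsto_intros denlim) auto
  have TsL: "nsq (Ts (e n)) = L (w n)" for n
    unfolding e_def L_def by (rule nsq_adjoint_nker[OF adj TS TsS wK])
  have "(\<lambda>n. L (w (r n))) \<longlonglongrightarrow> L (\<phi> \<zeta>)"
    using LIMSEQ_subseq_LIMSEQ[OF Llim[OF wlim p\<zeta>] r] by (simp add: o_def)
  from tendsto_add[OF lim1[unfolded TsL] this]
  have lim2: "(\<lambda>n. nsq (T (e (r n)))) \<longlonglongrightarrow> L (\<phi> \<zeta>)" by simp
  have "L \<zeta> \<le> L (\<phi> \<zeta>)"
  proof (rule LIMSEQ_le[OF _ lim2])
    show "(\<lambda>n. L (u (r n))) \<longlonglongrightarrow> L \<zeta>"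
      using LIMSEQ_subseq_LIMSEQ[OF Llim[OF ulim \<zeta>] r] by (simp add: o_def)
    show "\<exists>N. \<forall>n\<ge>N. L (u (r n)) \<le> nsq (T (e (r n)))"
      using nsq_T_nker_ge[OF TS uK] by (simp add: L_def e_def w_def)
  qed
  \<comment> \<open>The constant \<open>c\<close> obtained below depends on
    \<open>\<epsilon>\<close>, so \<open>n\<close> tends to infinity before
    \<open>\<epsilon>\<close> tends to zero.\<close>
  moreover have "L (\<phi> \<zeta>) \<le> L \<zeta>"
  proof (rule field_le_epsilon)
    fix \<epsilon> :: real assume \<epsilon>: "\<epsilon> > 0"
    hence "\<epsilon> * kap powr \<gamma> > 0" using kap_pos by simp
    from nsq_T_nker_le[OF TS \<zeta> this] obtain c where
      c: "\<And>t. 1/2 \<le> t \<Longrightarrow> t < 1 \<Longrightarrow>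
        nsq (T (nker (\<phi> (of_real t *s \<zeta>)))) \<le> (cmod (den \<zeta>) powr (2 * \<gamma>) + \<epsilon> * kap powr \<gamma>) / kap powr \<gamma>
        + c * (1 - (norm (\<phi> (of_real t *s \<zeta>)))\<^sup>2) powr \<gamma>"
      by blast
    have L\<zeta>: "L \<zeta> = cmod (den \<zeta>) powr (2 * \<gamma>) / kap powr \<gamma>"
      using kap_pos den_nonzero[of \<zeta>] \<zeta>
      by (simp only: L_def powr_divide powr_two_mult zero_less_norm_iff order_refl simp_thms)
    show "L (\<phi> \<zeta>) \<le> L \<zeta> + \<epsilon>"
    proof (rule LIMSEQ_le[OF lim2])
      have "(\<lambda>n. (L \<zeta> + \<epsilon>) + c * y (r n) powr \<gamma>) \<longlonglongrightarrow> (L \<zeta> + \<epsilon>) + c * 0"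
        using LIMSEQ_subseq_LIMSEQ[OF ypow[OF gamma_pos] r]
        by (intro tendsto_intros) (simp add: o_def)
      thus "(\<lambda>n. (L \<zeta> + \<epsilon>) + c * y (r n) powr \<gamma>) \<longlonglongrightarrow> L \<zeta> + \<epsilon>" by simp
      have "nsq (T (e n)) \<le> (L \<zeta> + \<epsilon>) + c * y n powr \<gamma>" for n
        using c[OF t(1)[of n] t(2)[of n]] kap_pos
        by (simp add: e_def w_def u_def y_def L\<zeta> add_divide_distrib)
      thus "\<exists>N. \<forall>n\<ge>N. nsq (T (e (r n))) \<le> (L \<zeta> + \<epsilon>) + c * y (r n) powr \<gamma>" by blast
    qed
  qed
  ultimately have eq: "L (\<phi> \<zeta>) = L \<zeta>" by simp
  have inj: "a = b" if "a powr \<gamma> = b powr \<gamma>" "0 \<le> a" "0 \<le> b" for a b :: real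
    using that gamma_pos powr_less_mono2[of \<gamma> a b] powr_less_mono2[of \<gamma> b a]
    by (cases a b rule: linorder_cases) auto
  have "(cmod (den (\<phi> \<zeta>)))\<^sup>2 / kap = (cmod (den \<zeta>))\<^sup>2 / kap"
    by (rule inj[OF eq[unfolded L_def]]) (simp_all add: kap_pos less_imp_le)
  thus False using ne kap_pos by (simp add: power2_eq_iff_nonneg)
qed

end

section \<open>Measures invariant under linear isometries\<close>

lemma borel_measurable_linear:
  fixes T :: "'a::euclidean_space \<Rightarrow> 'b::real_normed_vector"
  assumes "linear T"
  shows "T \<in> borel_measurable borel"
  by (intro borel_measurable_continuous_onI linear_continuous_on)
     (use assms in \<open>simp add: linear_conv_bounded_linear\<close>)

text \<open>Uniqueness of Haar measure: compare \<open>\<nu>(A) \<lambda>(ball)\<close> with \<open>\<lambda>(A) \<nu>(ball)\<close> by Fubini,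
  where \<open>\<nu>\<close> is the image of \<open>\<lambda>\<close> under the isometry.\<close>

lemma lborel_distr_orthogonal_transformation:
  fixes T :: "'a::euclidean_space \<Rightarrow> 'a"
  assumes orth: "orthogonal_transformation T"
  shows "distr lborel borel T = lborel"
proof (rule measure_eqI)
  have lin: "linear T" and iso: "\<And>x. norm (T x) = norm x"
    using orth by (auto simp: orthogonal_transformation)
  have T[measurable]: "T \<in> borel_measurable borel" by (rule borel_measurable_linear[OF lin])
  have "surj T" by (rule orthogonal_transformation_surj[OF orth])
  have shift: "(\<integral>\<^sup>+x. f (x + c) \<partial>lborel) = (\<integral>\<^sup>+x. f x \<partial>lborel)"
    if [measurable]: "f \<in> borel_measurable borel" for f :: "'a \<Rightarrow> ennreal" and c
    by (subst lborel_distr_plus[symmetric, of c]) (simp add: nn_integral_distr add.commute)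
  fix A assume "A \<in> sets (distr lborel borel T)"
  hence A[measurable]: "A \<in> sets borel" by simp
  define B where "B = ball (0::'a) 1"
  have B[measurable]: "B \<in> sets borel" by (simp add: B_def)
  define V where "V = emeasure lborel B"
  have V: "V \<noteq> 0" "V \<noteq> \<infinity>"
    using emeasure_lborel_ball_finite[of "0::'a" 1] content_ball_pos[of 1 "0::'a"]
    by (auto simp: V_def B_def measure_def)
  let ?f = "indicator A :: 'a \<Rightarrow> ennreal" and ?g = "indicator B :: 'a \<Rightarrow> ennreal"
  have nu: "emeasure (distr lborel borel T) A = (\<integral>\<^sup>+x. ?f (T x) \<partial>lborel)"
    using nn_integral_distr[of T lborel borel ?f] by simp
  have "emeasure (distr lborel borel T) A * V = (\<integral>\<^sup>+x. ?f (T x) * (\<integral>\<^sup>+y. ?g y \<partial>lborel) \<partial>lborel)"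
    unfolding nu by (simp add: nn_integral_multc V_def)
  also have "\<dots> = (\<integral>\<^sup>+x. ?f (T x) * (\<integral>\<^sup>+y. ?g (y - T x) \<partial>lborel) \<partial>lborel)"
    unfolding diff_conv_add_uminus by (intro nn_integral_cong arg_cong2[where f = times] refl shift[symmetric]) simp
  also have "\<dots> = (\<integral>\<^sup>+x. \<integral>\<^sup>+y. ?f (T x) * ?g (y - T x) \<partial>lborel \<partial>lborel)"
    by (intro nn_integral_cong nn_integral_cmult[symmetric]) measurable
  also have "\<dots> = (\<integral>\<^sup>+y. \<integral>\<^sup>+x. ?f (T x) * ?g (y - T x) \<partial>lborel \<partial>lborel)"
    by (rule lborel_pair.Fubini'[symmetric]) measurable
  also have "\<dots> = (\<integral>\<^sup>+y. \<integral>\<^sup>+x. ?f (T x + y) * ?g x \<partial>lborel \<partial>lborel)"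
  proof (rule nn_integral_cong)
    fix y
    \<comment> \<open>Translating by a preimage of \<open>y\<close> turns \<open>y - T x\<close>
      into \<open>- T x\<close>, whose norm is that of \<open>x\<close>; the factor
      \<open>?g\<close> thus becomes free of \<open>T\<close>.\<close>
    obtain b where b: "T b = y" using \<open>surj T\<close> by (metis surjD)
    have "(\<integral>\<^sup>+x. ?f (T x) * ?g (y - T x) \<partial>lborel) = (\<integral>\<^sup>+x. ?f (T (x + b)) * ?g (y - T (x + b)) \<partial>lborel)"
      by (rule shift[symmetric]) measurable
    also have "\<dots> = (\<integral>\<^sup>+x. ?f (T x + y) * ?g x \<partial>lborel)"
      using iso by (intro nn_integral_cong) (simp add: linear_add[OF lin] b B_def indicator_def)
    finally show "(\<integral>\<^sup>+x. ?f (T x) * ?g (y - T x) \<partial>lborel) = (\<integral>\<^sup>+x. ?f (T x + y) * ?g x \<partial>lborel)" .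
  qed
  also have "\<dots> = (\<integral>\<^sup>+x. \<integral>\<^sup>+y. ?f (T x + y) * ?g x \<partial>lborel \<partial>lborel)"
    by (rule lborel_pair.Fubini') measurable
  also have "\<dots> = (\<integral>\<^sup>+x. emeasure lborel A * ?g x \<partial>lborel)"
  proof (rule nn_integral_cong)
    fix x
    have "(\<integral>\<^sup>+y. ?f (T x + y) * ?g x \<partial>lborel) = (\<integral>\<^sup>+y. ?f (y + T x) \<partial>lborel) * ?g x"
      by (subst nn_integral_multc) (simp_all add: add.commute)
    thus "(\<integral>\<^sup>+y. ?f (T x + y) * ?g x \<partial>lborel) = emeasure lborel A * ?g x"
      by (subst (asm) shift) simp_all
  qed
  also have "\<dots> = emeasure lborel A * V"
    by (simp add: nn_integral_cmult V_def)
  finally show "emeasure (distr lborel borel T) A = emeasure lborel A"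
    using V by (metis mult_divide_eq_ennreal infinity_ennreal_def)
qed simp

section \<open>Integration over the unit circle and Taylor coefficients\<close>

lemma borel_measurable_cnj [measurable]: "cnj \<in> borel_measurable borel"
  by (intro borel_measurable_continuous_onI continuous_intros)

definition circ :: "complex measure" where
  "circ = distr (uniform_measure lborel {0..1::real}) borel (\<lambda>t. cis (2 * pi * t))"

lemma measurable_cis_circ [measurable]: "(\<lambda>t. cis (2 * pi * t)) \<in> borel_measurable borel"
  by (intro borel_measurable_continuous_onI continuous_intros)

lemma sets_circ [measurable_cong, simp]: "sets circ = sets borel"
  by (simp add: circ_def)

lemma space_circ [simp]: "space circ = UNIV"
  by (simp add: circ_def)

lemma emeasure_circ [simp]: "emeasure circ UNIV = 1"
  unfolding circ_def by (subst emeasure_distr) (simp_all add: emeasure_uniform_measure)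

lemma measure_circ [simp]: "measure circ UNIV = 1"
  by (simp add: measure_def)

interpretation circ: finite_measure circ
  by standard simp

lemma AE_circ: "AE l in circ. cmod l = 1"
  unfolding circ_def by (subst AE_distr_iff) simp_all

lemma integrable_circ:
  fixes F :: "complex \<Rightarrow> complex"
  assumes "continuous_on (sphere 0 1) F" "F \<in> borel_measurable borel"
  shows "integrable circ F"
proof -
  have "compact (F ` sphere 0 1)" by (intro compact_continuous_image assms) simp
  then obtain K where "\<forall>x\<in>sphere 0 1. cmod (F x) \<le> K"
    by (auto dest!: compact_imp_bounded simp: bounded_iff)
  hence K: "cmod (F x) \<le> K" if "cmod x = 1" for x
    using that by simp
  show ?thesis
    by (rule circ.integrable_const_bound[of _ K]) (use AE_circ K assms in \<open>auto\<close>)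
qed

definition coef :: "nat \<Rightarrow> (complex \<Rightarrow> complex) \<Rightarrow> complex" where
  "coef m F = (deriv ^^ m) F 0 / fact m"

text \<open>Cauchy's formula for the derivative of order \<open>m\<close>, since
  \<open>cnj l = 1 / l\<close> on the circle.\<close>

lemma integral_circ_coef:
  assumes cont: "continuous_on (cball 0 1) F" and hol: "F holomorphic_on ball 0 1"
    and meas: "F \<in> borel_measurable borel"
  shows "(\<integral>l. F l * cnj l ^ m \<partial>circ) = coef m F"
proof -
  define f where "f = (\<lambda>t::real. F (cis (2 * pi * t)) * cnj (cis (2 * pi * t)) ^ m)"
  have contf: "continuous_on {0..1} f"
    unfolding f_def
    by (intro continuous_intros continuous_on_compose2[OF cont]) auto
  have "((\<lambda>u. F u / (u - 0) ^ Suc m) has_contour_integral (2 * pi * \<i> / fact m * (deriv ^^ m) F 0)) (circlepath 0 1)"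
    by (rule Cauchy_has_contour_integral_higher_derivative_circlepath[OF cont hol]) simp
  hence "((\<lambda>x. F (circlepath 0 1 x) / circlepath 0 1 x ^ Suc m * vector_derivative (circlepath 0 1) (at x))
      has_integral (2 * pi * \<i> * coef m F)) {0..1}"
    by (simp add: has_contour_integral coef_def)
  moreover have "F (circlepath 0 1 x) / circlepath 0 1 x ^ Suc m * vector_derivative (circlepath 0 1) (at x)
      = 2 * pi * \<i> * f x" for x
  proof -
    have c: "circlepath 0 1 x = cis (2 * pi * x)"
      by (simp add: circlepath cis_conv_exp mult_ac)
    have "exp (2 * of_real pi * \<i> * of_real x) = cis (2 * pi * x)"
      by (simp add: cis_conv_exp mult_ac)
    hence d: "vector_derivative (circlepath 0 1) (at x) = 2 * pi * \<i> * cis (2 * pi * x)"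
      by (simp add: vector_derivative_circlepath)
    have "cis (2 * pi * x) ^ m * cnj (cis (2 * pi * x)) ^ m = 1"
      by (simp add: mult_cnj_self flip: power_mult_distrib)
    thus ?thesis unfolding c d f_def by (simp add: field_simps)
  qed
  ultimately have "((\<lambda>x. 2 * pi * \<i> * f x) has_integral (2 * pi * \<i> * coef m F)) {0..1}"
    by simp
  from has_integral_mult_right[OF this, of "1 / (2 * pi * \<i>)"]
  have "(f has_integral coef m F) {0..1}" by simp
  hence "integral {0..1} f = coef m F" by (rule integral_unique)
  moreover have "set_integrable lborel {0..1} f"
    using contf by (intro borel_integrable_atLeastAtMost')
  ultimately have *: "(LINT t:{0..1}|lborel. f t) = coef m F"
    using set_borel_integral_eq_integral(2) by metis
  have "(\<integral>l. F l * cnj l ^ m \<partial>circ) = (\<integral>t. f t \<partial>uniform_measure lborel {0..1})"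
    unfolding circ_def f_def using meas by (subst integral_distr) (simp_all, measurable)
  also have "\<dots> = (LINT t:{0..1}|lborel. f t)"
  proof -
    have f: "f \<in> borel_measurable borel" unfolding f_def using meas by measurable
    have "uniform_measure lborel {0..1::real} = density lborel (\<lambda>x. ennreal (indicator {0..1} x))"
      by (simp add: uniform_measure_def ennreal_indicator divide_ennreal_def)
    thus ?thesis
      unfolding set_lebesgue_integral_def using f by (simp add: integral_density)
  qed
  finally show ?thesis using * by simp
qed

section \<open>Holomorphic functions on the ball\<close>

text \<open>Complex homogeneity of the real derivative \<open>L\<close> makes restrictions to
  complex lines complex differentiable, which opens the way to one-variable theory.\<close>

lemma holo_ball_line:
  assumes f: "holo_ball f" and ball: "a + l *s b \<in> ballN"
  shows "(\<lambda>l. f (a + l *s b)) field_differentiable (at l)"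
proof -
  obtain L where L: "(f has_derivative L) (at (a + l *s b))" "\<And>c v. L (c *s v) = c * L v"
    using f ball by (auto simp: holo_ball_def)
  have "bounded_linear (\<lambda>l. l *s b)"
    by (rule bounded_linear_intro[where K = "norm b"])
      (simp_all add: vector_sadd_rdistrib scaleR_eq_smult scaleR_conv_of_real[where 'a=complex] vector_smult_assoc)
  hence "((\<lambda>l. a + l *s b) has_derivative (\<lambda>l. l *s b)) (at l)"
    by (auto intro!: derivative_eq_intros bounded_linear_imp_has_derivative)
  from has_derivative_compose[OF this L(1)]
  have "((\<lambda>l. f (a + l *s b)) has_derivative (\<lambda>l. l * L b)) (at l)" by (simp add: L(2))
  hence "((\<lambda>l. f (a + l *s b)) has_field_derivative L b) (at l)"
    by (simp add: has_field_derivative_def mult_commute_abs)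
  thus ?thesis by (auto simp: field_differentiable_def)
qed

lemma holo_ball_continuous: "holo_ball f \<Longrightarrow> continuous_on ballN f"
  unfolding holo_ball_def
  by (meson continuous_at_imp_continuous_on has_derivative_continuous)

lemma holo_ball_measurable:
  assumes "holo_ball f" "\<And>z. z \<notin> ballN \<Longrightarrow> f z = 0"
  shows "f \<in> borel_measurable borel"
proof -
  have "(\<lambda>z. if z \<in> ballN then f z else 0) \<in> borel_measurable borel"
    by (rule borel_measurable_continuous_on_if)
      (auto simp: ballN_eq_ball intro!: holo_ball_continuous[unfolded ballN_eq_ball] assms)
  moreover have "(\<lambda>z. if z \<in> ballN then f z else 0) = f" using assms(2) by auto
  ultimately show ?thesis by simp
qed

lemma holo_ball_line_holomorphic:
  assumes "holo_ball f" "\<And>l. l \<in> S \<Longrightarrow> a + l *s b \<in> ballN"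
  shows "(\<lambda>l. f (a + l *s b)) holomorphic_on S"
  using holo_ball_line[OF assms(1)] assms(2)
  by (auto simp: holomorphic_on_def intro: field_differentiable_at_within)

section \<open>Complex rotations and averages\<close>

text \<open>For unit \<open>e\<close>: multiplication by \<open>a\<close> along \<open>e\<close> and
  by \<open>b\<close> on its orthogonal complement. Besides unimodular \<open>a\<close> and
  \<open>b\<close>, moduli up to 1 are of use: the map is then a contraction, which keeps the discs
  of the mean value argument inside the ball.\<close>

definition rot :: "complex^'n \<Rightarrow> complex \<Rightarrow> complex \<Rightarrow> complex^'n \<Rightarrow> complex^'n" where
  "rot e a b z = (a * cinner z e) *s e + b *s (z - cinner z e *s e)"

lemma cinner_unit: "norm e = 1 \<Longrightarrow> cinner e e = 1"
  by (simp add: cinner_self)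

lemma cinner_rot_self: "norm e = 1 \<Longrightarrow> cinner (rot e a b z) e = a * cinner z e"
  by (simp add: rot_def cinner_add_left cinner_diff_left cinner_scale_left cinner_unit)

lemma cinner_rot_orthogonal: "cinner e f = 0 \<Longrightarrow> cinner (rot e a b z) f = b * cinner z f"
  by (simp add: rot_def cinner_add_left cinner_diff_left cinner_scale_left)

lemma rot_same: "rot e a a z = a *s z"
  by (simp add: rot_def vec_eq_iff algebra_simps)

lemma norm_rot_sq:
  assumes "norm e = 1"
  shows "(norm (rot e a b z))\<^sup>2
    = (cmod a * cmod (cinner z e))\<^sup>2 + (cmod b * norm (z - cinner z e *s e))\<^sup>2"
proof -
  define v where "v = z - cinner z e *s e"
  have v: "cinner v e = 0" "cinner e v = 0"
    using assms cinner_commute[of e v]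
    by (simp_all add: v_def cinner_diff_left cinner_scale_left cinner_unit)
  have "(complex_of_real (norm (rot e a b z)))\<^sup>2 = cinner (rot e a b z) (rot e a b z)"
    by (simp add: cinner_self)
  also have "\<dots> = (a * cinner z e) * cnj (a * cinner z e) + (b * cnj b) * cinner v v"
    using assms v unfolding rot_def v_def[symmetric]
    by (simp add: cinner_add_left cinner_add_right cinner_scale_left cinner_scale_right cinner_unit)
  also have "\<dots> = of_real ((cmod a * cmod (cinner z e))\<^sup>2 + (cmod b * norm v)\<^sup>2)"
    by (simp only: mult_cnj_self cinner_self) (simp add: norm_mult power_mult_distrib)
  finally show ?thesis unfolding v_def of_real_power[symmetric] of_real_eq_iff .
qed

lemma rot_one: "rot e 1 1 z = z"
  by (simp add: rot_def vec_eq_iff)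

lemma norm_rot_le:
  assumes "norm e = 1" "cmod a \<le> 1" "cmod b \<le> 1"
  shows "norm (rot e a b z) \<le> norm z"
proof -
  have "(norm (rot e a b z))\<^sup>2 \<le> (norm (rot e 1 1 z))\<^sup>2"
    unfolding norm_rot_sq[OF assms(1)]
    using assms by (intro add_mono power_mono mult_right_mono) auto
  thus ?thesis by (simp add: rot_one)
qed

lemma norm_rot:
  assumes "norm e = 1" "cmod a = 1" "cmod b = 1"
  shows "norm (rot e a b z) = norm z"
proof -
  have "(norm (rot e a b z))\<^sup>2 = (norm (rot e 1 1 z))\<^sup>2"
    unfolding norm_rot_sq[OF assms(1)] using assms by simp
  thus ?thesis by (simp add: rot_one)
qed

lemma orthogonal_transformation_rot:
  assumes "norm e = 1" "cmod a = 1" "cmod b = 1"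
  shows "orthogonal_transformation (rot e a b)"
  unfolding orthogonal_transformation
proof (intro conjI allI linearI)
  show "rot e a b (x + y) = rot e a b x + rot e a b y" for x y
    by (simp add: rot_def cinner_add_left vec_eq_iff algebra_simps)
  show "rot e a b (r *\<^sub>R x) = r *\<^sub>R rot e a b x" for r x
    by (simp add: rot_def cinner_scale_left scaleR_eq_smult vec_eq_iff algebra_simps)
qed (rule norm_rot[OF assms])

lemma measurable_cinner_left [measurable]: "(\<lambda>z. cinner z w) \<in> borel_measurable borel"
  by (intro borel_measurable_continuous_onI continuous_intros)

lemma measurable_smult [measurable (raw)]:
  assumes "f \<in> borel_measurable M" "g \<in> borel_measurable M"
  shows "(\<lambda>x. f x *s (g x :: complex^'n)) \<in> borel_measurable M"
  by (rule borel_measurable_continuous_Pair[OF assms])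
    (unfold vector_scalar_mult_def, intro continuous_intros continuous_on_vec_lambda)

lemma measurable_rot [measurable (raw)]:
  assumes [measurable]: "a \<in> borel_measurable M" "b \<in> borel_measurable M" "z \<in> borel_measurable M"
  shows "(\<lambda>x. rot e (a x) (b x) (z x)) \<in> borel_measurable M"
  unfolding rot_def by measurable

lemma coef_0 [simp]: "coef 0 F = F 0"
  by (simp add: coef_def)

lemma coef_scale:
  assumes "G holomorphic_on ball 0 1" "cmod x \<le> 1"
  shows "coef m (\<lambda>l. G (x * l)) = x ^ m * coef m G"
proof -
  have "(deriv ^^ m) (\<lambda>w. G (x * w)) 0 = x ^ m * (deriv ^^ m) G (x * 0)"
  proof (rule higher_deriv_compose_linear[where S = "ball 0 1" and T = "ball 0 1"])
    fix z :: complex assume "z \<in> ball 0 1"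
    thus "x * z \<in> ball 0 1"
      using assms(2) mult_right_mono[of "cmod x" 1 "cmod z"] by (simp add: norm_mult)
  qed (use assms in auto)
  thus ?thesis by (simp add: coef_def)
qed

lemma coef_monom: "coef m (\<lambda>l. c * l ^ m) = c"
proof -
  have "coef m (\<lambda>l. c * l ^ m) = (\<integral>l. c * l ^ m * cnj l ^ m \<partial>circ)"
    by (intro integral_circ_coef[symmetric] continuous_intros holomorphic_intros) measurable
  also have "\<dots> = (\<integral>l. c \<partial>circ)"
  proof (intro integral_cong_AE)
    show "AE l in circ. c * l ^ m * cnj l ^ m = c"
      using AE_circ by eventually_elim (simp add: mult.assoc mult_cnj_self flip: power_mult_distrib)
  qed measurable
  finally show ?thesis by simp
qed

section \<open>Averaging against an isometry-invariant measure\<close>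

locale isometry_invariant = finite_measure \<mu> for \<mu> :: "(complex^'n) measure" +
  assumes sets_mu [measurable_cong, simp]: "sets \<mu> = sets borel"
    and AE_ball: "AE z in \<mu>. z \<in> ballN"
    and inv: "orthogonal_transformation T \<Longrightarrow> distr \<mu> borel T = \<mu>"
begin

lemma space_mu [simp]: "space \<mu> = UNIV"
  using sets_eq_imp_space_eq[OF sets_mu] by simp

text \<open>Each unimodular \<open>l\<close> gives a measure-preserving substitution, and Fubini
  averages these over the circle. Off the circle \<open>R l\<close> need not preserve the measure,
  so the inner statements hold for almost every \<open>l\<close>.\<close>

lemma isometry_average:
  fixes g :: "complex^'n \<Rightarrow> complex"
  assumes g: "integrable \<mu> g"
    and R[measurable]: "(\<lambda>(l, z). R l z) \<in> borel_measurable (borel \<Otimes>\<^sub>M borel)"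
    and orth: "\<And>l. cmod l = 1 \<Longrightarrow> orthogonal_transformation (R l)"
  shows "integrable \<mu> (\<lambda>z. \<integral>l. g (R l z) \<partial>circ)"
    and "(\<integral>z. g z \<partial>\<mu>) = (\<integral>z. (\<integral>l. g (R l z) \<partial>circ) \<partial>\<mu>)"
proof -
  interpret P: pair_sigma_finite circ \<mu> ..
  have g'[measurable]: "g \<in> borel_measurable borel" using g by simp
  have Rl[measurable]: "R l \<in> borel_measurable borel" for l
    using measurable_compose[OF measurable_Pair1'[of l borel borel] R] by simp
  have int: "integrable \<mu> (\<lambda>z. h (R l z)) \<and> (\<integral>z. h (R l z) \<partial>\<mu>) = (\<integral>z. h z \<partial>\<mu>)"
    if "cmod l = 1" "integrable \<mu> h" for l and h :: "complex^'n \<Rightarrow> 'b::{banach,second_countable_topology}"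
  proof -
    have h: "h \<in> borel_measurable borel" using that(2) by simp
    have "integrable (distr \<mu> borel (R l)) h" using that inv[OF orth] by simp
    moreover have "(\<integral>z. h z \<partial>distr \<mu> borel (R l)) = (\<integral>z. h z \<partial>\<mu>)"
      using that inv[OF orth] by simp
    ultimately show ?thesis
      using h by (simp add: integrable_distr_eq integral_distr)
  qed
  have AEc: "AE l in circ. (\<integral>z. norm (g (R l z)) \<partial>\<mu>) = (\<integral>z. norm (g z) \<partial>\<mu>)"
    using AE_circ int[of _ "\<lambda>z. norm (g z)"] g by auto
  have "integrable (circ \<Otimes>\<^sub>M \<mu>) (\<lambda>(l, z). g (R l z))"
  proof (rule P.Fubini_integrable)
    show "(\<lambda>(l, z). g (R l z)) \<in> borel_measurable (circ \<Otimes>\<^sub>M \<mu>)" by measurable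
    have "integrable circ (\<lambda>l. \<integral>z. norm (g z) \<partial>\<mu>)" by simp
    thus "integrable circ (\<lambda>l. \<integral>z. norm (case (l, z) of (l, z) \<Rightarrow> g (R l z)) \<partial>\<mu>)"
      by (rule integrable_cong_AE_imp) (use AEc in \<open>auto\<close>)
    show "AE l in circ. integrable \<mu> (\<lambda>z. case (l, z) of (l, z) \<Rightarrow> g (R l z))"
      using AE_circ int[of _ g] g by auto
  qed
  note F = this
  show "integrable \<mu> (\<lambda>z. \<integral>l. g (R l z) \<partial>circ)"
    using P.integrable_snd[OF F] by simp
  have "(\<integral>z. (\<integral>l. g (R l z) \<partial>circ) \<partial>\<mu>) = (\<integral>l. (\<integral>z. g (R l z) \<partial>\<mu>) \<partial>circ)"
    by (rule P.Fubini_integral[OF F])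
  also have "\<dots> = (\<integral>l. (\<integral>z. g z \<partial>\<mu>) \<partial>circ)"
    by (rule integral_cong_AE) (use AE_circ int[of _ g] g in \<open>auto\<close>)
  finally show "(\<integral>z. g z \<partial>\<mu>) = (\<integral>z. (\<integral>l. g (R l z) \<partial>circ) \<partial>\<mu>)" by simp
qed

definition moment :: "nat \<Rightarrow> complex^'n \<Rightarrow> real" where
  "moment m e = (\<integral>z. cmod (cinner z e) ^ (2 * m) \<partial>\<mu>)"

lemma integrable_mult_bounded:
  fixes f g :: "complex^'n \<Rightarrow> complex"
  assumes "integrable \<mu> f" "g \<in> borel_measurable borel" "\<And>z. z \<in> ballN \<Longrightarrow> cmod (g z) \<le> K"
  shows "integrable \<mu> (\<lambda>z. f z * g z)"
proof (rule Bochner_Integration.integrable_bound)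
  show "integrable \<mu> (\<lambda>z. of_real K * f z)" using assms(1) by simp
  show "(\<lambda>z. f z * g z) \<in> borel_measurable \<mu>" using assms(1,2) by measurable
  show "AE z in \<mu>. norm (f z * g z) \<le> norm (of_real K * f z)"
    using AE_ball
  proof eventually_elim
    case (elim z)
    have "cmod (g z) \<le> \<bar>K\<bar>" using assms(3)[OF elim] by simp
    thus ?case by (simp add: norm_mult mult.commute[of _ "cmod (g z)"] mult_right_mono)
  qed
qed

lemma cmod_cinner_le:
  assumes "z \<in> ballN" "norm e = 1"
  shows "cmod (cinner z e) < 1"
  using cinner_Cauchy_Schwarz[of z e] assms by (simp add: ballN_def)

lemma integrable_mult_cinner:
  assumes "integrable \<mu> f" "norm e = 1"
  shows "integrable \<mu> (\<lambda>z. f z * cnj (cinner z e) ^ m)"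
proof (rule integrable_mult_bounded[OF assms(1)])
  show "cmod (cnj (cinner z e) ^ m) \<le> 1" if "z \<in> ballN" for z
    using cmod_cinner_le[OF that assms(2)] by (simp add: norm_power power_le_one)
qed measurable

text \<open>Averaging over the rotations that fix \<open>e\<close> replaces \<open>f\<close> by its restriction to the line
  through \<open>e\<close> (mean value property); averaging over scalar rotations then extracts one Taylor
  coefficient.\<close>

lemma integral_mult_cinner_power:
  assumes f: "holo_ball f" "integrable \<mu> f" and e: "norm e = 1"
  shows "(\<integral>z. f z * cnj (cinner z e) ^ m \<partial>\<mu>) = coef m (\<lambda>l. f (l *s e)) * of_real (moment m e)"
proof -
  have fm[measurable]: "f \<in> borel_measurable borel" using f(2) by simp
  define g where "g = (\<lambda>z. f z * cnj (cinner z e) ^ m)"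
  define g2 where "g2 = (\<lambda>z. f (cinner z e *s e) * cnj (cinner z e) ^ m)"
  have g2m[measurable]: "g2 \<in> borel_measurable borel" unfolding g2_def by measurable
  have g: "integrable \<mu> g" unfolding g_def by (rule integrable_mult_cinner[OF f(2) e])
  have avg1: "(\<integral>l. g (rot e 1 l z) \<partial>circ) = g2 z" if z: "z \<in> ballN" for z
  proof -
    \<comment> \<open>The rotation fixes \<open>cinner z e\<close>, so the antiholomorphic factor is
      constant in \<open>l\<close> and the average is that of the holomorphic \<open>F\<close>,
      namely \<open>F 0\<close>.\<close>
    define F where "F = (\<lambda>l. f (cinner z e *s e + l *s (z - cinner z e *s e)))"
    have hol: "F holomorphic_on cball 0 1"
      unfolding F_def
    proof (rule holo_ball_line_holomorphic[OF f(1)])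
      fix l :: complex assume "l \<in> cball 0 1"
      hence "norm (rot e 1 l z) \<le> norm z" using e by (intro norm_rot_le) auto
      thus "cinner z e *s e + l *s (z - cinner z e *s e) \<in> ballN"
        using z by (simp add: rot_def ballN_def)
    qed
    have "(\<integral>l. F l * cnj l ^ 0 \<partial>circ) = coef 0 F"
    proof (rule integral_circ_coef)
      show "F \<in> borel_measurable borel" unfolding F_def by measurable
    qed (use hol in \<open>auto intro: holomorphic_on_imp_continuous_on elim: holomorphic_on_subset\<close>)
    hence "(\<integral>l. F l \<partial>circ) = f (cinner z e *s e)" by (simp add: F_def)
    moreover have "g (rot e 1 l z) = F l * cnj (cinner z e) ^ m" for l
      by (simp add: g_def F_def cinner_rot_self[OF e]) (simp add: rot_def)
    ultimately show ?thesis by (simp add: g2_def)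
  qed
  have R1: "(\<lambda>(l, z). rot e 1 l z) \<in> borel_measurable (borel \<Otimes>\<^sub>M borel)" by measurable
  have O1: "\<And>l. cmod l = 1 \<Longrightarrow> orthogonal_transformation (rot e 1 l)"
    by (intro orthogonal_transformation_rot e) auto
  note i1 = isometry_average[OF g R1 O1]
  have AE1: "AE z in \<mu>. (\<integral>l. g (rot e 1 l z) \<partial>circ) = g2 z"
    using AE_ball by eventually_elim (rule avg1)
  have g2: "integrable \<mu> g2"
    by (rule integrable_cong_AE_imp[OF i1(1)]) (use AE1 in \<open>auto\<close>)
  have "(\<integral>z. g z \<partial>\<mu>) = (\<integral>z. (\<integral>l. g (rot e 1 l z) \<partial>circ) \<partial>\<mu>)"
    by (rule i1(2))
  also have "\<dots> = (\<integral>z. g2 z \<partial>\<mu>)"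
    by (rule integral_cong_AE) (use AE1 i1(1) in \<open>auto\<close>)
  finally have eq1: "(\<integral>z. g z \<partial>\<mu>) = (\<integral>z. g2 z \<partial>\<mu>)" .
  define G where "G = (\<lambda>l. f (l *s e))"
  have holG: "G holomorphic_on ball 0 1"
    unfolding G_def using holo_ball_line_holomorphic[OF f(1), of "ball 0 1" 0 e] e
    by (simp add: ballN_def)
  have Gm[measurable]: "G \<in> borel_measurable borel" unfolding G_def by measurable
  have avg2: "(\<integral>l. g2 (rot e l l z) \<partial>circ) = coef m G * of_real (cmod (cinner z e) ^ (2 * m))"
    if z: "z \<in> ballN" for z
  proof -
    define x where "x = cinner z e"
    have x: "cmod x < 1" using cmod_cinner_le[OF z e] by (simp add: x_def)
    have xl: "x * l \<in> ball 0 1" if "l \<in> cball 0 1" for l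
      using that x mult_left_le[of "cmod l" "cmod x"] by (simp add: norm_mult)
    have hol: "(\<lambda>l. G (x * l)) holomorphic_on cball 0 1"
      using holomorphic_on_compose_gen[OF _ holG, of "\<lambda>l. x * l" "cball 0 1"]
        image_subsetI[of "cball 0 1" "\<lambda>l. x * l" "ball 0 1", OF xl]
      by (auto simp: o_def intro!: holomorphic_intros)
    have "(\<integral>l. G (x * l) * cnj l ^ m \<partial>circ) = coef m (\<lambda>l. G (x * l))"
      by (rule integral_circ_coef)
        (use hol in \<open>auto intro: holomorphic_on_imp_continuous_on elim: holomorphic_on_subset\<close>)
    also have "\<dots> = x ^ m * coef m G" using x by (intro coef_scale holG) simp
    finally have "(\<integral>l. G (x * l) * cnj l ^ m * cnj x ^ m \<partial>circ) = x ^ m * coef m G * cnj x ^ m"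
      by simp
    moreover have "g2 (rot e l l z) = G (x * l) * cnj l ^ m * cnj x ^ m" for l
      using cinner_rot_self[OF e, of l l z]
      by (simp add: g2_def G_def x_def power_mult_distrib mult_ac)
    moreover have "x ^ m * cnj x ^ m = of_real (cmod x ^ (2 * m))"
      by (simp add: mult_cnj_self power_mult flip: power_mult_distrib)
    ultimately show ?thesis by (simp add: x_def mult_ac)
  qed
  have R2: "(\<lambda>(l, z). rot e l l z) \<in> borel_measurable (borel \<Otimes>\<^sub>M borel)" by measurable
  have O2: "\<And>l. cmod l = 1 \<Longrightarrow> orthogonal_transformation (rot e l l)"
    by (intro orthogonal_transformation_rot e) auto
  note i2 = isometry_average[OF g2 R2 O2]
  have "(\<integral>z. g2 z \<partial>\<mu>) = (\<integral>z. (\<integral>l. g2 (rot e l l z) \<partial>circ) \<partial>\<mu>)"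
    by (rule i2(2))
  also have "\<dots> = (\<integral>z. coef m G * of_real (cmod (cinner z e) ^ (2 * m)) \<partial>\<mu>)"
    by (rule integral_cong_AE)
      (use AE_ball i2(1) in \<open>auto elim!: eventually_mono simp: avg2 simp del: of_real_power\<close>)
  also have "\<dots> = coef m G * of_real (moment m e)"
    unfolding moment_def by (simp del: of_real_power)
  finally show ?thesis using eq1 by (simp add: g_def G_def)
qed

end

section \<open>Closure properties of holomorphic functions and the kernel series\<close>

lemma holo_ball_const: "holo_ball (\<lambda>z. c)"
  unfolding holo_ball_def by (auto intro!: exI[of _ "\<lambda>v. 0"])

lemma holo_ball_cinner: "holo_ball (\<lambda>z. cinner z a)"
  unfolding holo_ball_def
  by (auto intro!: exI[of _ "\<lambda>v. cinner v a"] bounded_linear_imp_has_derivative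
      bounded_linear_cinner_left simp: cinner_scale_left)

lemma holo_ballE:
  fixes f :: "complex^'n \<Rightarrow> complex"
  assumes "holo_ball f" "z \<in> ballN"
  obtains L where "(f has_derivative L) (at z)" "\<And>c v. L (c *s v) = c * L v"
  using assms unfolding holo_ball_def by blast

lemma holo_ball_add:
  fixes f g :: "complex^'n \<Rightarrow> complex"
  assumes "holo_ball f" "holo_ball g"
  shows "holo_ball (\<lambda>z. f z + g z)"
  unfolding holo_ball_def
proof
  fix z :: "complex^'n" assume z: "z \<in> ballN"
  obtain L where L: "(f has_derivative L) (at z)" "\<And>c v. L (c *s v) = c * L v"
    using holo_ballE[OF assms(1) z] by blast
  obtain M where M: "(g has_derivative M) (at z)" "\<And>c v. M (c *s v) = c * M v"
    using holo_ballE[OF assms(2) z] by blast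
  show "\<exists>L. ((\<lambda>z. f z + g z) has_derivative L) (at z) \<and> (\<forall>c v. L (c *s v) = c * L v)"
    by (intro exI conjI, rule has_derivative_add[OF L(1) M(1)]) (simp add: L(2) M(2) algebra_simps)
qed

lemma holo_ball_mult:
  fixes f g :: "complex^'n \<Rightarrow> complex"
  assumes "holo_ball f" "holo_ball g"
  shows "holo_ball (\<lambda>z. f z * g z)"
  unfolding holo_ball_def
proof
  fix z :: "complex^'n" assume z: "z \<in> ballN"
  obtain L where L: "(f has_derivative L) (at z)" "\<And>c v. L (c *s v) = c * L v"
    using holo_ballE[OF assms(1) z] by blast
  obtain M where M: "(g has_derivative M) (at z)" "\<And>c v. M (c *s v) = c * M v"
    using holo_ballE[OF assms(2) z] by blast
  show "\<exists>L. ((\<lambda>z. f z * g z) has_derivative L) (at z) \<and> (\<forall>c v. L (c *s v) = c * L v)"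
    by (intro exI conjI, rule has_derivative_mult[OF L(1) M(1)]) (simp add: L(2) M(2) algebra_simps)
qed

lemma holo_ball_power: "holo_ball f \<Longrightarrow> holo_ball (\<lambda>z. f z ^ m)"
  by (induction m) (auto intro: holo_ball_mult holo_ball_const)

text \<open>Picks out of the binomial expansion the term of degree one in \<open>cnj l\<close>;
  conjugation makes it a Taylor coefficient.\<close>

lemma integral_circ_binomial:
  "(\<integral>l. l * (p + cnj l * q) ^ Suc m \<partial>circ) = of_nat (Suc m) * p ^ m * q"
proof -
  define F where "F = (\<lambda>l. (cnj p + l * cnj q) ^ Suc m)"
  have "(F has_field_derivative (of_nat (Suc m) * cnj p ^ m * cnj q)) (at 0)"
    unfolding F_def
    by (rule DERIV_power_Suc[THEN DERIV_cong]) (auto intro!: derivative_eq_intros)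
  hence "deriv F 0 = of_nat (Suc m) * cnj p ^ m * cnj q"
    by (rule DERIV_imp_deriv)
  moreover have "(\<integral>l. F l * cnj l ^ 1 \<partial>circ) = coef 1 F"
  proof (rule integral_circ_coef)
    show "continuous_on (cball 0 1) F" "F holomorphic_on ball 0 1"
      unfolding F_def by (intro continuous_intros holomorphic_intros)+
    show "F \<in> borel_measurable borel" unfolding F_def by measurable
  qed
  ultimately have "cnj (\<integral>l. F l * cnj l \<partial>circ) = of_nat (Suc m) * p ^ m * q"
    by (simp add: coef_def)
  moreover have "(\<integral>l. l * (p + cnj l * q) ^ Suc m \<partial>circ) = (\<integral>l. cnj (F l * cnj l) \<partial>circ)"
    by (intro Bochner_Integration.integral_cong) (simp_all add: F_def mult_ac)
  moreover have "(\<integral>l. cnj (F l * cnj l) \<partial>circ) = cnj (\<integral>l. F l * cnj l \<partial>circ)"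
    by (rule Bochner_Integration.integral_cnj)
  ultimately show ?thesis by simp
qed

lemma binomial_series_coeff:
  "((- a) gchoose n) * (- x) ^ n = pochhammer a n / fact n * (x :: 'a :: field_char_0) ^ n"
proof -
  have "(- 1) ^ n * (- x) ^ n = x ^ n" by (simp flip: power_mult_distrib)
  thus ?thesis by (simp add: gbinomial_pochhammer mult_ac)
qed

lemma ker_sums:
  assumes "z \<in> ballN" "cmod (cinner z w) < 1"
  shows "(\<lambda>n. of_real (pochhammer \<gamma> n / fact n) * cinner z w ^ n) sums ker \<gamma> w z"
proof -
  have "(\<lambda>n. ((- complex_of_real \<gamma>) gchoose n) * (- cinner z w) ^ n) sums
      (1 + (- cinner z w)) powr (- complex_of_real \<gamma>)"
    using assms(2) by (intro gen_binomial_complex) simp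
  thus ?thesis using assms(1)
    by (simp add: binomial_series_coeff ker_def pochhammer_of_real)
qed

lemma binomial_series_summable:
  assumes "\<bar>x\<bar> < 1"
  shows "summable (\<lambda>n. pochhammer \<gamma> n / fact n * (x :: real) ^ n)"
  using gen_binomial_real[of "- x" "- \<gamma>"] assms
  by (simp add: binomial_series_coeff sums_iff)

lemma norm_axis_one [simp]: "norm (axis i (1::complex) :: complex^'n) = 1"
  by (simp add: norm_eq_sqrt_inner inner_axis_axis)

lemma cinner_axis [simp]: "cinner z (axis i 1) = z $ i"
  by (simp add: cinner_def axis_def if_distrib sum.delta cong: if_cong)

lemma holo_ball_compose:
  fixes f :: "complex^'n \<Rightarrow> complex"
  assumes "holo_ball f" "\<And>z. z \<in> ballN \<Longrightarrow> g field_differentiable (at (f z))"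
  shows "holo_ball (\<lambda>z. g (f z))"
  unfolding holo_ball_def
proof
  fix z :: "complex^'n" assume z: "z \<in> ballN"
  obtain L where L: "(f has_derivative L) (at z)" "\<And>c v. L (c *s v) = c * L v"
    using holo_ballE[OF assms(1) z] by blast
  obtain D where "(g has_derivative (*) D) (at (f z))"
    using assms(2)[OF z] by (auto simp: field_differentiable_def has_field_derivative_def)
  from has_derivative_compose[OF L(1) this]
  show "\<exists>L. ((\<lambda>z. g (f z)) has_derivative L) (at z) \<and> (\<forall>c v. L (c *s v) = c * L v)"
    by (intro exI[of _ "\<lambda>v. D * L v"]) (auto simp: L(2))
qed

lemma holo_ball_cong:
  fixes f g :: "complex^'n \<Rightarrow> complex"
  assumes "holo_ball f" "\<And>z. z \<in> ballN \<Longrightarrow> f z = g z"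
  shows "holo_ball g"
  unfolding holo_ball_def
proof
  fix z :: "complex^'n" assume z: "z \<in> ballN"
  obtain L where L: "(f has_derivative L) (at z)" "\<And>c v. L (c *s v) = c * L v"
    using holo_ballE[OF assms(1) z] by blast
  have "(g has_derivative L) (at z)"
    by (rule has_derivative_transform_within_open[OF L(1), of ballN])
      (use z assms(2) in \<open>auto simp: ballN_eq_ball\<close>)
  thus "\<exists>L. (g has_derivative L) (at z) \<and> (\<forall>c v. L (c *s v) = c * L v)"
    using L(2) by blast
qed

lemma Re_one_minus_cinner_pos:
  fixes z w :: "complex^'n"
  assumes "z \<in> ballN" "w \<in> ballN"
  shows "0 < Re (1 - cinner z w)"
proof -
  have "norm z * norm w < 1"
    using assms mult_strict_mono'[of "norm z" 1 "norm w" 1] by (simp add: ballN_def)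
  thus ?thesis
    using complex_Re_le_cmod[of "cinner z w"] cinner_Cauchy_Schwarz[of z w] by simp
qed

lemma holo_ball_ker:
  fixes w :: "complex^'n"
  assumes "w \<in> ballN"
  shows "holo_ball (ker \<gamma> w)"
proof (rule holo_ball_cong)
  show "holo_ball (\<lambda>z. (1 - cinner z w) powr (- of_real \<gamma>))"
  proof (rule holo_ball_compose[where g = "\<lambda>x. (1 - x) powr (- of_real \<gamma>)"])
    fix z :: "complex^'n" assume "z \<in> ballN"
    hence "1 - cinner z w \<notin> \<real>\<^sub>\<le>\<^sub>0"
      using Re_one_minus_cinner_pos[OF \<open>z \<in> ballN\<close> assms] by (auto simp: complex_nonpos_Reals_iff)
    thus "(\<lambda>x. (1 - x) powr (- of_real \<gamma>)) field_differentiable (at (cinner z w))"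
      by (auto simp: field_differentiable_def intro!: exI derivative_eq_intros)
  qed (rule holo_ball_cinner)
qed (simp add: ker_def)

lemma ker_measurable: "w \<in> ballN \<Longrightarrow> ker \<gamma> w \<in> borel_measurable borel"
  by (rule holo_ball_measurable[OF holo_ball_ker]) (auto simp: ker_def)

section \<open>Moments of an invariant measure and the reproducing formula\<close>

context isometry_invariant
begin

lemma integrable_bounded:
  fixes g :: "complex^'n \<Rightarrow> 'b::{banach,second_countable_topology}"
  assumes "g \<in> borel_measurable borel" "\<And>z. z \<in> ballN \<Longrightarrow> norm (g z) \<le> K"
  shows "integrable \<mu> g"
  by (rule integrable_const_bound[of _ K]) (use assms AE_ball in \<open>auto elim!: eventually_mono\<close>)

lemma integrable_cinner_power: "norm a = 1 \<Longrightarrow> integrable \<mu> (\<lambda>z. cinner z a ^ m)"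
  by (rule integrable_bounded[of _ 1])
    (use less_imp_le[OF cmod_cinner_le] in \<open>auto simp: norm_power intro!: power_le_one\<close>)

text \<open>The integral of <z,a>^m times the conjugate of <z,b>^m is evaluated by
  \<open>integral_mult_cinner_power\<close> along \<open>b\<close> and, after conjugation, along
  \<open>a\<close>. This takes the place of transitivity of the unitary group on the sphere.\<close>

lemma moment_eq_nonorthogonal:
  assumes a: "norm a = 1" and b: "norm b = 1" and ab: "cinner a b \<noteq> 0"
  shows "moment m a = moment m b"
proof -
  have *: "(\<integral>z. cinner z x ^ m * cnj (cinner z y) ^ m \<partial>\<mu>) = cinner y x ^ m * of_real (moment m y)"
    if "norm x = 1" "norm y = 1" for x y
  proof -
    have "(\<integral>z. cinner z x ^ m * cnj (cinner z y) ^ m \<partial>\<mu>)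
        = coef m (\<lambda>l. cinner (l *s y) x ^ m) * of_real (moment m y)"
      by (intro integral_mult_cinner_power holo_ball_power holo_ball_cinner integrable_cinner_power that)
    also have "(\<lambda>l. cinner (l *s y) x ^ m) = (\<lambda>l. cinner y x ^ m * l ^ m)"
      by (simp add: cinner_scale_left power_mult_distrib mult.commute)
    finally show ?thesis by (simp only: coef_monom)
  qed
  have "cnj (\<integral>z. cinner z a ^ m * cnj (cinner z b) ^ m \<partial>\<mu>) = (\<integral>z. cinner z b ^ m * cnj (cinner z a) ^ m \<partial>\<mu>)"
    unfolding Bochner_Integration.integral_cnj[symmetric] by (simp add: mult.commute)
  hence "cinner a b ^ m * of_real (moment m b) = cinner a b ^ m * of_real (moment m a)"
    unfolding *[OF a b] *[OF b a] using cinner_commute[of a b] by simp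
  thus ?thesis using ab by simp
qed

text \<open>For orthonormal \<open>a\<close> and \<open>b\<close>, a unit vector orthogonal to
  neither.\<close>

definition mid :: "complex^'n \<Rightarrow> complex^'n \<Rightarrow> complex^'n" where
  "mid a b = of_real (1 / sqrt 2) *s (a + b)"

lemma mid:
  assumes "norm a = 1" "norm b = 1" "cinner a b = 0"
  shows "norm (mid a b) = 1" "cinner (mid a b) a = of_real (1 / sqrt 2)"
    "cinner (mid a b) b = of_real (1 / sqrt 2)"
    "cinner z (mid a b) = of_real (1 / sqrt 2) * (cinner z a + cinner z b)"
proof -
  have ba: "cinner b a = 0" using assms(3) cinner_commute[of b a] by simp
  have "(complex_of_real (norm (a + b)))\<^sup>2 = 2"
    unfolding cinner_self[symmetric]
    using assms ba by (simp add: cinner_add_left cinner_add_right cinner_unit)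
  hence "complex_of_real ((norm (a + b))\<^sup>2) = of_real 2" by simp
  hence "(norm (a + b))\<^sup>2 = 2" unfolding of_real_eq_iff .
  hence "norm (a + b) = sqrt 2" by (metis norm_ge_zero real_sqrt_unique)
  thus "norm (mid a b) = 1"
    unfolding mid_def norm_smult by (simp add: norm_divide)
  show "cinner (mid a b) a = of_real (1 / sqrt 2)" "cinner (mid a b) b = of_real (1 / sqrt 2)"
    "cinner z (mid a b) = of_real (1 / sqrt 2) * (cinner z a + cinner z b)"
    using assms ba
    by (simp_all add: mid_def cinner_scale_left cinner_scale_right cinner_add_left cinner_add_right cinner_unit add_divide_distrib)
qed

lemma moment_eq:
  assumes a: "norm a = 1" and b: "norm b = 1"
  shows "moment m a = moment m b"
proof (cases "cinner a b = 0")
  case True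
  have "cinner a (mid a b) \<noteq> 0" "cinner (mid a b) b \<noteq> 0"
    using True by (auto simp: mid[OF a b True] cinner_unit a)
  thus ?thesis
    using moment_eq_nonorthogonal[OF a mid(1)[OF a b True], of m]
      moment_eq_nonorthogonal[OF mid(1)[OF a b True] b, of m] by simp
qed (rule moment_eq_nonorthogonal[OF a b])

text \<open>With \<open>e\<close> the midpoint of \<open>a\<close> and \<open>b\<close>, the
  integral of <z,a>^m <z,b> conj(<z,e>)^(m+1) is computed twice: as a Taylor coefficient along
  \<open>e\<close>, which gives the moment of order m + 1, and by rotating the coordinate along
  \<open>b\<close>, which retains only the term of degree one in conj(<z,b>), with binomial
  coefficient m + 1.\<close>

lemma moment_orthogonal:
  assumes a: "norm a = 1" and b: "norm b = 1" and ab: "cinner a b = 0"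
  shows "(\<integral>z. cmod (cinner z a) ^ (2 * m) * (cmod (cinner z b))\<^sup>2 \<partial>\<mu>) = moment (Suc m) a / (m + 1)"
proof -
  define s where "s = complex_of_real (1 / sqrt 2)"
  have s: "s \<noteq> 0" "cnj s = s" by (simp_all add: s_def)
  define e where "e = mid a b"
  note e = mid[OF a b ab, folded e_def s_def]
  have ba: "cinner b a = 0" using ab cinner_commute[of b a] by simp
  define f where "f = (\<lambda>z. cinner z a ^ m * cinner z b)"
  have f: "holo_ball f" unfolding f_def
    by (intro holo_ball_mult holo_ball_power holo_ball_cinner)
  have fi: "integrable \<mu> f" unfolding f_def
    using integrable_mult_bounded[OF integrable_cinner_power[OF a], of "\<lambda>z. cinner z b" 1 m] cmod_cinner_le[OF _ b]
    by (simp add: less_imp_le)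
  define g where "g = (\<lambda>z. f z * cnj (cinner z e) ^ Suc m)"
  have g: "integrable \<mu> g" unfolding g_def by (rule integrable_mult_cinner[OF fi e(1)])
  have "(\<integral>z. g z \<partial>\<mu>) = coef (Suc m) (\<lambda>l. f (l *s e)) * of_real (moment (Suc m) e)"
    unfolding g_def by (rule integral_mult_cinner_power[OF f fi e(1)])
  also have "(\<lambda>l. f (l *s e)) = (\<lambda>l. s ^ Suc m * l ^ Suc m)"
    by (simp add: f_def cinner_scale_left e fun_eq_iff power_mult_distrib mult_ac)
  also have "coef (Suc m) \<dots> = s ^ Suc m" by (rule coef_monom)
  also have "moment (Suc m) e = moment (Suc m) a" by (rule moment_eq[OF e(1) a])
  finally have 1: "(\<integral>z. g z \<partial>\<mu>) = s ^ Suc m * of_real (moment (Suc m) a)" .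
  have R: "(\<lambda>(l, z). rot b l 1 z) \<in> borel_measurable (borel \<Otimes>\<^sub>M borel)" by measurable
  have O: "\<And>l. cmod l = 1 \<Longrightarrow> orthogonal_transformation (rot b l 1)"
    by (intro orthogonal_transformation_rot b) auto
  have avg: "(\<integral>l. g (rot b l 1 z) \<partial>circ)
      = s ^ Suc m * of_nat (Suc m) * of_real (cmod (cinner z a) ^ (2 * m) * (cmod (cinner z b))\<^sup>2)" for z
  proof -
    define x where "x = cinner z a"
    define y where "y = cinner z b"
    have "g (rot b l 1 z) = (x ^ m * y * s ^ Suc m) * (l * (cnj x + cnj l * cnj y) ^ Suc m)" for l
      using cinner_rot_self[OF b, of l 1 z] cinner_rot_orthogonal[OF ba, of l 1 z] s(2)
      by (simp add: g_def f_def e(4) x_def y_def power_mult_distrib mult_ac del: power_Suc)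
    hence "(\<integral>l. g (rot b l 1 z) \<partial>circ)
        = (x ^ m * y * s ^ Suc m) * (\<integral>l. l * (cnj x + cnj l * cnj y) ^ Suc m \<partial>circ)"
      by (simp del: power_Suc)
    also have "\<dots> = s ^ Suc m * of_nat (Suc m) * ((x * cnj x) ^ m * (y * cnj y))"
      unfolding integral_circ_binomial by (simp add: power_mult_distrib mult_ac)
    also have "(x * cnj x) ^ m * (y * cnj y) = of_real (cmod x ^ (2 * m) * (cmod y)\<^sup>2)"
      by (simp add: mult_cnj_self power_mult)
    finally show ?thesis by (simp only: x_def y_def)
  qed
  have "(\<integral>z. g z \<partial>\<mu>) = (\<integral>z. (\<integral>l. g (rot b l 1 z) \<partial>circ) \<partial>\<mu>)"
    by (rule isometry_average(2)[OF g R O])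
  also have "\<dots> = s ^ Suc m * of_nat (Suc m) *
      of_real (\<integral>z. cmod (cinner z a) ^ (2 * m) * (cmod (cinner z b))\<^sup>2 \<partial>\<mu>)"
    unfolding avg by (simp only: integral_mult_right_zero integral_complex_of_real)
  finally have "s ^ Suc m * of_real (moment (Suc m) a) = s ^ Suc m * (of_nat (Suc m) *
      of_real (\<integral>z. cmod (cinner z a) ^ (2 * m) * (cmod (cinner z b))\<^sup>2 \<partial>\<mu>))"
    unfolding 1 by (simp only: mult.assoc)
  hence "complex_of_real (moment (Suc m) a) = of_nat (Suc m) *
      of_real (\<integral>z. cmod (cinner z a) ^ (2 * m) * (cmod (cinner z b))\<^sup>2 \<partial>\<mu>)"
    using s(1) by (subst (asm) mult_cancel_left) simp
  hence "complex_of_real (moment (Suc m) a) = of_real (real (Suc m) *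
      (\<integral>z. cmod (cinner z a) ^ (2 * m) * (cmod (cinner z b))\<^sup>2 \<partial>\<mu>))"
    by (simp only: of_real_mult of_real_of_nat_eq)
  thus ?thesis unfolding of_real_eq_iff by (simp add: field_simps)
qed

text \<open>Coordinate \<open>i\<close> contributes a full moment of order m + 1, each of the other
  N - 1 coordinates the fraction 1/(m + 1) of it. The radial factor |z|^2 is thereby converted into
  a step from one moment to the next.\<close>

lemma moment_norm_sq:
  fixes i :: 'n
  shows "(\<integral>z. (norm z)\<^sup>2 * cmod (z $ i) ^ (2 * m) \<partial>\<mu>)
    = (real m + real CARD('n)) / (real m + 1) * moment (Suc m) (axis i 1)"
proof -
  let ?M = "moment (Suc m) (axis i 1)"
  have comp: "cmod (z $ j) \<le> 1" if "z \<in> ballN" for z :: "complex^'n" and j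
    using that Finite_Cartesian_Product.norm_nth_le[of z j] by (simp add: ballN_def)
  have int: "integrable \<mu> (\<lambda>z. cmod (z $ i) ^ (2 * m) * (cmod (z $ j))\<^sup>2)" for j
  proof (rule integrable_bounded[of _ 1])
    show "norm (cmod (z $ i) ^ (2 * m) * (cmod (z $ j))\<^sup>2) \<le> 1" if "z \<in> ballN" for z
      using comp[OF that] by (auto simp: norm_mult norm_power intro!: mult_le_one power_le_one)
    show "(\<lambda>z::complex^'n. cmod (z $ i) ^ (2 * m) * (cmod (z $ j))\<^sup>2) \<in> borel_measurable borel"
      unfolding cinner_axis[symmetric] by measurable
  qed
  have each: "(\<integral>z. cmod (z $ i) ^ (2 * m) * (cmod (z $ j))\<^sup>2 \<partial>\<mu>) = (if j = i then ?M else ?M / (m + 1))" for j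
  proof (cases "j = i")
    case True
    thus ?thesis by (simp add: moment_def power_mult power2_eq_square mult_ac)
  next
    case False
    hence "cinner (axis i 1) (axis j (1::complex)) = 0" by (simp only: cinner_axis) (simp add: axis_def)
    from moment_orthogonal[OF _ _ this, of m] False show ?thesis by simp
  qed
  have "(norm z)\<^sup>2 * cmod (z $ i) ^ (2 * m) = (\<Sum>j\<in>UNIV. cmod (z $ i) ^ (2 * m) * (cmod (z $ j))\<^sup>2)"
    for z :: "complex^'n"
    by (simp add: norm_vec_def L2_set_def sum_nonneg sum_distrib_left mult.commute)
  hence "(\<integral>z. (norm z)\<^sup>2 * cmod (z $ i) ^ (2 * m) \<partial>\<mu>)
      = (\<Sum>j\<in>UNIV. if j = i then ?M else ?M / (m + 1))"
    using int by (simp add: each)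
  also have "\<dots> = ?M + (\<Sum>j\<in>UNIV - {i}. ?M / (m + 1))"
    by (subst sum.remove[of _ i]) auto
  also have "\<dots> = ?M + (real CARD('n) - 1) * (?M / (m + 1))"
    using zero_less_card_finite[where 'a='n] by (simp add: card_Diff_singleton of_nat_diff Suc_leI)
  also have "\<dots> = (real m + real CARD('n)) / (real m + 1) * ?M"
    by (simp add: field_simps)
  finally show ?thesis .
qed

text \<open>Expanding the kernel in powers of <z,w>, the term of degree m produces the corresponding
  Taylor coefficient of \<open>f\<close> on the line through \<open>w\<close>, and the moment
  cancels the binomial coefficient up to \<open>\<rho> ^ m\<close>. The Bergman measures have
  \<open>\<rho> = 1\<close>, the sphere of radius r has \<rho> = r^2.\<close>

lemma integral_mult_ker:
  assumes f: "holo_ball f" "integrable \<mu> f" and w: "w \<in> ballN"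
    and \<gamma>: "\<gamma> > 0" and \<rho>: "0 \<le> \<rho>" "\<rho> \<le> 1"
    and mom: "\<And>m e. norm e = 1 \<Longrightarrow> moment m e = fact m / pochhammer \<gamma> m * \<rho> ^ m"
  shows "(\<integral>z. f z * cnj (ker \<gamma> w z) \<partial>\<mu>) = f (of_real \<rho> *s w)"
proof -
  define t where "t = norm w"
  have t: "0 \<le> t" "t < 1" using w by (auto simp: t_def ballN_def)
  obtain e where e: "norm e = 1" "w = of_real t *s e"
  proof (cases "w = 0")
    case True
    \<comment> \<open>At the centre every direction serves, so an arbitrary coordinate axis is
      taken.\<close>
    thus ?thesis using that[of "axis undefined 1"] by (simp add: t_def)
  next
    case False
    thus ?thesis using that[of "of_real (1 / t) *s w"] by (simp add: t_def norm_divide vector_smult_assoc)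
  qed
  define c where "c = (\<lambda>m. pochhammer \<gamma> m / fact m)"
  have c: "c m > 0" for m using \<gamma> by (simp add: c_def pochhammer_pos)
  have zw: "cinner z w = of_real t * cinner z e" for z by (simp add: e(2) cinner_scale_right)
  have zw1: "cmod (cinner z w) \<le> t" if "z \<in> ballN" for z
    using cmod_cinner_le[OF that e(1)] t mult_left_le[of "cmod (cinner z e)" t]
    by (simp add: zw norm_mult)
  define h where "h = (\<lambda>m z. f z * (of_real (c m) * cnj (cinner z w) ^ m))"
  have hi: "integrable \<mu> (h m)" for m
  proof -
    have "h m = (\<lambda>z. of_real (c m * t ^ m) * (f z * cnj (cinner z e) ^ m))"
      by (simp add: h_def zw power_mult_distrib mult_ac fun_eq_iff)
    thus ?thesis using integrable_mult_cinner[OF f(2) e(1), of m] by simp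
  qed
  have hbound: "norm (h m z) \<le> cmod (f z) * (c m * t ^ m)" if "z \<in> ballN" for m z
    using c[of m] zw1[OF that]
    by (auto simp: h_def norm_mult norm_power intro!: mult_left_mono power_mono)
  have sum_ct: "summable (\<lambda>m. c m * t ^ m)"
    unfolding c_def using t by (intro binomial_series_summable) simp
  have sums1: "(\<lambda>m. \<integral>z. h m z \<partial>\<mu>) sums (\<integral>z. (\<Sum>m. h m z) \<partial>\<mu>)"
  proof (rule sums_integral[OF hi])
    show "AE z in \<mu>. summable (\<lambda>m. norm (h m z))"
      using AE_ball
    proof eventually_elim
      case (elim z)
      show ?case
        by (rule summable_comparison_test'[OF summable_mult[OF sum_ct, of "cmod (f z)"]])
          (use hbound[OF elim] in simp)
    qed
    show "summable (\<lambda>m. \<integral>z. norm (h m z) \<partial>\<mu>)"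
    proof (rule summable_comparison_test')
      show "summable (\<lambda>m. (\<integral>z. cmod (f z) \<partial>\<mu>) * (c m * t ^ m))" by (rule summable_mult[OF sum_ct])
      fix m
      have "(\<integral>z. norm (h m z) \<partial>\<mu>) \<le> (\<integral>z. cmod (f z) * (c m * t ^ m) \<partial>\<mu>)"
        by (rule integral_mono_AE) (use hi f(2) AE_ball hbound in \<open>auto elim!: eventually_mono\<close>)
      thus "norm (\<integral>z. norm (h m z) \<partial>\<mu>) \<le> (\<integral>z. cmod (f z) \<partial>\<mu>) * (c m * t ^ m)" by simp
    qed
  qed
  have "(\<Sum>m. h m z) = f z * cnj (ker \<gamma> w z)" if z: "z \<in> ballN" for z
  proof -
    have "(\<lambda>n. of_real (c n) * cinner z w ^ n) sums ker \<gamma> w z"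
      unfolding c_def using zw1[OF z] t z by (intro ker_sums) auto
    hence "(\<lambda>n. cnj (of_real (c n) * cinner z w ^ n)) sums cnj (ker \<gamma> w z)"
      by (simp only: sums_cnj)
    from sums_mult[OF this, of "f z"] show ?thesis
      by (simp add: h_def sums_iff)
  qed
  hence AEs: "AE z in \<mu>. (\<Sum>m. h m z) = f z * cnj (ker \<gamma> w z)" using AE_ball by auto
  have "h m \<in> borel_measurable borel" for m using hi[of m] by simp
  hence [measurable]: "h m \<in> borel_measurable \<mu>" for m by simp
  have [measurable]: "f \<in> borel_measurable borel" using f(2) by simp
  have "(\<integral>z. (\<Sum>m. h m z) \<partial>\<mu>) = (\<integral>z. f z * cnj (ker \<gamma> w z) \<partial>\<mu>)"
    by (rule integral_cong_AE) (use AEs ker_measurable[OF w] in \<open>auto\<close>)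
  with sums1 have sums2: "(\<lambda>m. \<integral>z. h m z \<partial>\<mu>) sums (\<integral>z. f z * cnj (ker \<gamma> w z) \<partial>\<mu>)" by simp
  define G where "G = (\<lambda>l. f (l *s e))"
  have holG: "G holomorphic_on ball 0 1"
    unfolding G_def using holo_ball_line_holomorphic[OF f(1), of "ball 0 1" 0 e] e
    by (simp add: ballN_def)
  have "(\<integral>z. h m z \<partial>\<mu>) = coef m G * of_real (\<rho> * t) ^ m" for m
  proof -
    have "(\<integral>z. h m z \<partial>\<mu>) = (\<integral>z. of_real (c m * t ^ m) * (f z * cnj (cinner z e) ^ m) \<partial>\<mu>)"
      by (simp add: h_def zw power_mult_distrib mult_ac)
    also have "\<dots> = of_real (c m * t ^ m) * (coef m G * of_real (moment m e))"
      by (simp add: integral_mult_cinner_power[OF f e(1)] G_def)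
    also have "\<dots> = coef m G * of_real (c m * t ^ m * moment m e)" by simp
    also have "c m * t ^ m * moment m e = (\<rho> * t) ^ m"
      using c[of m] pochhammer_pos[OF \<gamma>, of m]
      by (simp add: mom[OF e(1)] c_def power_mult_distrib)
    finally show ?thesis by simp
  qed
  moreover have "(\<lambda>m. coef m G * of_real (\<rho> * t) ^ m) sums G (of_real (\<rho> * t))"
  proof -
    have "\<rho> * t < 1" using \<rho> t by (metis mult_left_le_one_le order_le_less_trans)
    hence "complex_of_real (\<rho> * t) \<in> ball 0 1" using \<rho> t by (simp add: abs_mult del: of_real_mult)
    from holomorphic_power_series[OF holG this] show ?thesis by (simp add: coef_def)
  qed
  ultimately have "(\<integral>z. f z * cnj (ker \<gamma> w z) \<partial>\<mu>) = G (of_real (\<rho> * t))"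
    using sums2 by (simp add: sums_iff)
  thus ?thesis by (simp add: G_def e(2) vector_smult_assoc)
qed

end

section \<open>Moments of the weighted volume measures\<close>

lemma sets_ballN [measurable]: "ballN \<in> sets borel"
  by (simp add: ballN_eq_ball)

lemma emeasure_ballN:
  "emeasure lborel (ballN :: (complex^'n) set) \<noteq> 0"
  "emeasure lborel (ballN :: (complex^'n) set) \<noteq> \<infinity>"
  using emeasure_lborel_ball_finite[of "0::complex^'n" 1] content_ball_pos[of 1 "0::complex^'n"]
  by (auto simp: ballN_eq_ball measure_def)

lemma sets_vol_ball [measurable_cong, simp]: "sets vol_ball = sets borel"
  by (simp add: vol_ball_def)

lemma space_vol_ball [simp]: "space vol_ball = UNIV"
  by (simp add: vol_ball_def)

lemma emeasure_vol_ball [simp]: "emeasure vol_ball (UNIV :: (complex^'n) set) = 1"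
proof -
  have "emeasure vol_ball (UNIV :: (complex^'n) set) = emeasure lborel (ballN :: (complex^'n) set) / emeasure lborel (ballN :: (complex^'n) set)"
    unfolding vol_ball_def by (subst emeasure_uniform_measure) simp_all
  thus ?thesis
    using mult_divide_eq_ennreal[of "emeasure lborel (ballN :: (complex^'n) set)" 1] emeasure_ballN[where 'n='n] by simp
qed

lemma AE_vol_ball: "AE z in vol_ball. z \<in> ballN"
  unfolding vol_ball_def by (rule AE_uniform_measureI) simp_all

lemma distr_density_invariant:
  fixes T :: "'a::topological_space \<Rightarrow> 'a"
  assumes [measurable_cong]: "sets M = sets borel" and T[measurable]: "T \<in> borel_measurable borel"
    and inv: "distr M borel T = M" and g[measurable]: "g \<in> borel_measurable borel"
    and eq: "\<And>x. g (T x) = g x"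
  shows "distr (density M g) borel T = density M g"
proof (rule measure_eqI)
  show "sets (distr (density M g) borel T) = sets (density M g)" using assms(1) by simp
  fix A assume "A \<in> sets (distr (density M g) borel T)"
  hence A[measurable]: "A \<in> sets borel" by simp
  have "emeasure (distr (density M g) borel T) A = (\<integral>\<^sup>+x. indicator A x \<partial>distr (density M g) borel T)"
    by simp
  also have "\<dots> = (\<integral>\<^sup>+x. indicator A (T x) \<partial>density M g)" by (rule nn_integral_distr) measurable
  also have "\<dots> = (\<integral>\<^sup>+x. g x * indicator A (T x) \<partial>M)" by (rule nn_integral_density) measurable
  also have "\<dots> = (\<integral>\<^sup>+x. g (T x) * indicator A (T x) \<partial>M)" by (simp add: eq)
  also have "\<dots> = (\<integral>\<^sup>+x. g x * indicator A x \<partial>distr M borel T)"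
    by (rule nn_integral_distr[symmetric]) measurable
  also have "\<dots> = emeasure (density M g) A"
    unfolding inv by (simp add: emeasure_density)
  finally show "emeasure (distr (density M g) borel T) A = emeasure (density M g) A" .
qed

lemma orthogonal_transformation_measurable:
  fixes T :: "'a::euclidean_space \<Rightarrow> 'a"
  shows "orthogonal_transformation T \<Longrightarrow> T \<in> borel_measurable borel"
  by (rule borel_measurable_linear) (simp add: orthogonal_transformation)

lemma distr_vol_ball:
  fixes T :: "complex^'n \<Rightarrow> complex^'n"
  assumes "orthogonal_transformation T"
  shows "distr vol_ball borel T = vol_ball"
  unfolding vol_ball_def uniform_measure_def
proof (rule distr_density_invariant)
  show "indicator ballN (T x) / emeasure lborel (ballN :: (complex^'n) set) = indicator ballN x / emeasure lborel (ballN :: (complex^'n) set)" for x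
    using assms by (simp add: indicator_def ballN_def orthogonal_transformation)
qed (use assms lborel_distr_orthogonal_transformation orthogonal_transformation_measurable in \<open>auto\<close>)

lemma nn_integral_lborel_scale:
  fixes f :: "'a::euclidean_space \<Rightarrow> ennreal"
  assumes [measurable]: "f \<in> borel_measurable borel" and c: "c > 0"
  shows "(\<integral>\<^sup>+x. f x \<partial>lborel) = ennreal (c ^ DIM('a)) * (\<integral>\<^sup>+x. f (c *\<^sub>R x) \<partial>lborel)"
proof -
  have "(\<integral>\<^sup>+x. f x \<partial>lborel)
      = (\<integral>\<^sup>+x. f x \<partial>density (distr lborel borel (\<lambda>x::'a. 0 + c *\<^sub>R x)) (\<lambda>_. ennreal (\<bar>c\<bar> ^ DIM('a))))"
    using c by (subst lborel_affine[of c 0]) simp_all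
  also have "\<dots> = (\<integral>\<^sup>+x. ennreal (c ^ DIM('a)) * f (c *\<^sub>R x) \<partial>lborel)"
    using c by (simp add: nn_integral_density nn_integral_distr)
  finally show ?thesis by (simp add: nn_integral_cmult)
qed

lemma nn_integral_vol_ball_scale:
  fixes f :: "complex^'n \<Rightarrow> ennreal"
  assumes [measurable]: "f \<in> borel_measurable borel" and c: "0 < c" "c \<le> 1"
  shows "(\<integral>\<^sup>+z. f z * indicator (ball 0 c) z \<partial>vol_ball)
    = ennreal (c ^ (2 * CARD('n))) * (\<integral>\<^sup>+z. f (c *\<^sub>R z) \<partial>vol_ball)"
proof -
  have [measurable]: "ball (0::complex^'n) c \<in> sets borel" by simp
  have "(\<integral>\<^sup>+z. f z * indicator (ball 0 c) z * indicator ballN z \<partial>lborel)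
      = (\<integral>\<^sup>+z. f z * indicator (ball 0 c) z \<partial>lborel)"
    using c by (intro nn_integral_cong) (auto simp: ballN_def indicator_def)
  also have "\<dots> = ennreal (c ^ DIM(complex^'n)) * (\<integral>\<^sup>+z. f (c *\<^sub>R z) * indicator (ball 0 c) (c *\<^sub>R z) \<partial>lborel)"
    by (rule nn_integral_lborel_scale[OF _ c(1)]) measurable
  also have "(\<integral>\<^sup>+z. f (c *\<^sub>R z) * indicator (ball 0 c) (c *\<^sub>R z) \<partial>lborel)
      = (\<integral>\<^sup>+z. f (c *\<^sub>R z) * indicator ballN z \<partial>lborel)"
    using c by (intro nn_integral_cong) (auto simp: ballN_def indicator_def)
  finally show ?thesis
    unfolding vol_ball_def
    by (subst (1 2) nn_integral_uniform_measure)
      (simp_all add: ennreal_times_divide mult.commute[of "CARD('n)" 2])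
qed

lemma nn_integral_power_Icc:
  assumes k: "0 < k" and y: "0 \<le> y" "y \<le> 1"
  shows "(\<integral>\<^sup>+u. ennreal (real k * (1 - u) ^ (k - 1)) * indicator {y..1} u \<partial>lborel) = ennreal ((1 - y) ^ k)"
proof -
  have "(\<integral>\<^sup>+u. ennreal (real k * (1 - u) ^ (k - 1)) * indicator {y..1} u \<partial>lborel)
      = ennreal (- ((1 - 1) ^ k) - (- ((1 - y) ^ k)))"
    using y k by (intro nn_integral_FTC_Icc)
      (auto intro!: derivative_eq_intros)
  thus ?thesis using k by (simp add: zero_power)
qed

lemma measurable_component [measurable]: "(\<lambda>z::complex^'n. z $ i) \<in> borel_measurable borel"
  unfolding cinner_axis[symmetric] by measurable

text \<open>Evaluated only for \<open>m = 0\<close>; otherwise it is a common factor of the two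
  integrals in the moment recursion.\<close>

definition cmass :: "nat \<Rightarrow> 'n::finite \<Rightarrow> ennreal" where
  "cmass m i = (\<integral>\<^sup>+z. ennreal (cmod ((z :: complex^'n) $ i) ^ (2 * m)) \<partial>vol_ball)"

lemma cmass_0: "cmass 0 i = 1"
  by (simp add: cmass_def)

lemma cmass_finite:
  fixes i :: "'n::finite"
  shows "cmass m i < \<infinity>"
proof -
  have "cmass m i \<le> (\<integral>\<^sup>+z. 1 \<partial>(vol_ball :: (complex^'n) measure))"
    unfolding cmass_def
  proof (rule nn_integral_mono_AE)
    show "AE z::complex^'n in vol_ball. ennreal (cmod (z $ i) ^ (2 * m)) \<le> 1"
      using AE_vol_ball
    proof eventually_elim
      case (elim z)
      hence "cmod (z $ i) \<le> 1"
        using Finite_Cartesian_Product.norm_nth_le[of z i] by (simp add: ballN_def)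
      thus ?case by (simp add: power_le_one)
    qed
  qed
  thus ?thesis by (simp add: order_le_less_trans)
qed

text \<open>By homogeneity, the image of \<open>|z_i|^(2m) dv\<close> under \<open>1 - |z|^2\<close> is a multiple of the
  measure with density \<open>(1 - u)^(m + N - 1)\<close> on the unit interval.\<close>

lemma distr_vol_ball_radial:
  fixes i :: "'n::finite" and m :: nat
  defines "k \<equiv> m + CARD('n)"
  shows "distr (density vol_ball (\<lambda>z::complex^'n. ennreal (cmod (z $ i) ^ (2 * m)))) borel (\<lambda>z. 1 - (norm z)\<^sup>2)
    = density lborel (\<lambda>u. cmass m i * (ennreal (real k * (1 - u) ^ (k - 1)) * indicator {0..1} u))"
    (is "?M = ?R")
proof (rule measure_eqI_lessThan)
  have k: "k > 0" by (simp add: k_def)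
  let ?q = "\<lambda>u. ennreal (real k * (1 - u) ^ (k - 1))"
  let ?p = "\<lambda>z::complex^'n. ennreal (cmod (z $ i) ^ (2 * m))"
  have em: "emeasure ?M {x<..} = (\<integral>\<^sup>+z. ?p z * indicator {z. (norm z)\<^sup>2 < 1 - x} z \<partial>vol_ball)" for x
  proof -
    have "emeasure ?M {x<..} = emeasure (density vol_ball ?p) {z. (norm z)\<^sup>2 < 1 - x}"
      by (subst emeasure_distr) (auto intro!: arg_cong2[where f = emeasure] simp: algebra_simps)
    thus ?thesis by (subst (asm) emeasure_density) simp_all
  qed
  have er: "emeasure ?R {x<..} = cmass m i * (\<integral>\<^sup>+u. ?q u * indicator {max x 0..1} u \<partial>lborel)" for x
  proof -
    have "emeasure ?R {x<..} = (\<integral>\<^sup>+u. cmass m i * (?q u * indicator {0..1} u) * indicator {x<..} u \<partial>lborel)"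
      by (rule emeasure_density) simp_all
    also have "\<dots> = (\<integral>\<^sup>+u. cmass m i * (?q u * indicator {max x 0..1} u) \<partial>lborel)"
      by (rule nn_integral_cong_AE) (use AE_lborel_singleton[of x] in \<open>auto elim!: eventually_mono split: split_indicator\<close>)
    finally show ?thesis by (simp add: nn_integral_cmult)
  qed
  show "emeasure ?M {x<..} = emeasure ?R {x<..}" for x
  proof (cases "x < 1")
    case False
    hence "{max x 0..1} \<subseteq> {1}" by auto
    hence "(\<integral>\<^sup>+u. ?q u * indicator {max x 0..1} u \<partial>lborel) = (\<integral>\<^sup>+u. 0 \<partial>(lborel :: real measure))"
      using AE_lborel_singleton[of "1::real"]
      by (intro nn_integral_cong_AE) (auto elim!: eventually_mono split: split_indicator)
    hence "emeasure ?R {x<..} = 0" unfolding er by simp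
    moreover have "emeasure ?M {x<..} = (\<integral>\<^sup>+z. 0 \<partial>(vol_ball :: (complex^'n) measure))"
      unfolding em using False
      by (intro nn_integral_cong) (auto split: split_indicator dest: less_le_trans[of _ "1 - x" 0] simp: not_less)
    ultimately show ?thesis by simp
  next
    case True
    \<comment> \<open>Within \<open>ballN\<close> the condition 1 - |z|^2 > x describes the ball of
      radius \<open>c\<close>; the cut at 0 covers negative \<open>x\<close>, where it is the whole
      ball. Scaling by \<open>c\<close> yields c^(2m) from the integrand and c^(2N) from the
      volume.\<close>
    define y where "y = max x 0"
    have y: "0 \<le> y" "y < 1" using True by (auto simp: y_def)
    define c where "c = sqrt (1 - y)"
    have c: "0 < c" "c \<le> 1" "c\<^sup>2 = 1 - y" using y by (auto simp: c_def)
    have "emeasure ?M {x<..} = (\<integral>\<^sup>+z. ?p z * indicator (ball 0 c) z \<partial>vol_ball)"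
      unfolding em
    proof (rule nn_integral_cong_AE)
      show "AE z in vol_ball. ?p z * indicator {z. (norm z)\<^sup>2 < 1 - x} z = ?p z * indicator (ball 0 c) z"
        using AE_vol_ball
      proof eventually_elim
        case (elim z)
        have "norm z < c \<longleftrightarrow> (norm z)\<^sup>2 < c\<^sup>2"
          using c(1) by (metis less_imp_le norm_ge_zero power2_less_imp_less power_strict_mono
              zero_less_numeral)
        also have "\<dots> \<longleftrightarrow> (norm z)\<^sup>2 < 1 - x"
          using one_minus_norm_sq_pos[OF elim] unfolding c(3) y_def by auto
        finally show ?case by (simp add: indicator_def)
      qed
    qed
    also have "\<dots> = ennreal (c ^ (2 * CARD('n))) * (\<integral>\<^sup>+z. ?p (c *\<^sub>R z) \<partial>vol_ball)"
      using c by (intro nn_integral_vol_ball_scale) auto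
    also have "(\<integral>\<^sup>+z. ?p (c *\<^sub>R z) \<partial>vol_ball) = (\<integral>\<^sup>+z. ennreal (c ^ (2 * m)) * ?p z \<partial>vol_ball)"
      using c by (intro nn_integral_cong) (simp add: power_mult_distrib ennreal_mult)
    also have "\<dots> = ennreal (c ^ (2 * m)) * cmass m i"
      unfolding cmass_def by (rule nn_integral_cmult) simp
    also have "ennreal (c ^ (2 * CARD('n))) * (ennreal (c ^ (2 * m)) * cmass m i) = cmass m i * ennreal ((c\<^sup>2) ^ k)"
    proof -
      have "(c\<^sup>2) ^ k = c ^ (2 * CARD('n)) * c ^ (2 * m)"
        unfolding power_mult[symmetric] power_add[symmetric] k_def by (simp add: distrib_left add.commute)
      thus ?thesis using c by (simp only: ennreal_mult zero_le_power less_imp_le mult_ac)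
    qed
    also have "\<dots> = emeasure ?R {x<..}"
      unfolding er y_def[symmetric] c(3) using y k by (subst nn_integral_power_Icc) auto
    finally show ?thesis .
  qed
  show "emeasure ?M {x<..} < \<infinity>" for x
  proof -
    have "emeasure ?M {x<..} \<le> cmass m i"
      unfolding em cmass_def by (intro nn_integral_mono) (auto split: split_indicator)
    thus ?thesis using cmass_finite order_le_less_trans by blast
  qed
qed simp_all

lemma nn_integral_vol_ball_radial:
  fixes i :: "'n::finite" and m :: nat
  assumes g[measurable]: "g \<in> borel_measurable borel"
  defines "k \<equiv> m + CARD('n)"
  shows "(\<integral>\<^sup>+z. ennreal (cmod ((z :: complex^'n) $ i) ^ (2 * m)) * g (1 - (norm z)\<^sup>2) \<partial>vol_ball)
    = cmass m i * (\<integral>\<^sup>+u. ennreal (real k * (1 - u) ^ (k - 1)) * indicator {0..1} u * g u \<partial>lborel)"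
proof -
  let ?p = "\<lambda>z::complex^'n. ennreal (cmod (z $ i) ^ (2 * m))"
  have "(\<integral>\<^sup>+z. ?p z * g (1 - (norm z)\<^sup>2) \<partial>vol_ball) = (\<integral>\<^sup>+z. g (1 - (norm z)\<^sup>2) \<partial>density vol_ball ?p)"
    by (subst nn_integral_density) simp_all
  also have "\<dots> = (\<integral>\<^sup>+u. g u \<partial>distr (density vol_ball ?p) borel (\<lambda>z. 1 - (norm z)\<^sup>2))"
    by (subst nn_integral_distr) simp_all
  also have "\<dots> = (\<integral>\<^sup>+u. cmass m i * (ennreal (real k * (1 - u) ^ (k - 1)) * indicator {0..1} u) * g u \<partial>lborel)"
    unfolding distr_vol_ball_radial k_def by (rule nn_integral_density) simp_all
  finally show ?thesis by (simp add: nn_integral_cmult mult.assoc)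
qed

lemma nn_integral_Beta:
  assumes "s > -1" "k > 0"
  shows "(\<integral>\<^sup>+u. ennreal (real k * (1 - u) ^ (k - 1)) * indicator {0..1} u * ennreal ((1 - u) ^ j * u powr s) \<partial>lborel)
    = ennreal (real k * Beta (s + 1) (real (k + j)))"
proof -
  have "((\<lambda>t. t powr (s + 1 - 1) * (1 - t) powr (real (k + j) - 1)) has_integral Beta (s + 1) (real (k + j))) {0..1}"
    using assms by (intro has_integral_Beta_real) auto
  from has_integral_mult_right[OF this, of "real k"]
  have *: "((\<lambda>t. real k * (t powr s * (1 - t) powr (real (k + j) - 1))) has_integral (real k * Beta (s + 1) (real (k + j)))) {0..1}"
    by simp
  have "(\<integral>\<^sup>+u. ennreal (real k * (1 - u) ^ (k - 1)) * indicator {0..1} u * ennreal ((1 - u) ^ j * u powr s) \<partial>lborel)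
      = (\<integral>\<^sup>+u. ennreal (real k * (u powr s * (1 - u) powr (real (k + j) - 1))) * indicator {0..1} u \<partial>lborel)"
  proof (rule nn_integral_cong_AE)
    show "AE u in lborel. ennreal (real k * (1 - u) ^ (k - 1)) * indicator {0..1} u * ennreal ((1 - u) ^ j * u powr s)
      = ennreal (real k * (u powr s * (1 - u) powr (real (k + j) - 1))) * indicator {0..1} u"
      \<comment> \<open>The point 1 is removed because of the case \<open>k = 1\<close>,
        \<open>j = 0\<close>: there \<open>0 ^ 0\<close> is 1 while \<open>0 powr 0\<close> is
        0.\<close>
      using AE_lborel_singleton[of "1::real"]
    proof eventually_elim
      case (elim u)
      show ?case
      proof (cases "u \<in> {0..1}")
        case True
        hence u: "0 \<le> u" "u < 1" using elim by auto
        have "(1 - u) powr (real (k + j) - 1) = (1 - u) powr real (k - 1 + j)"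
          using assms by (simp add: of_nat_diff algebra_simps)
        also have "\<dots> = (1 - u) ^ (k - 1) * (1 - u) ^ j" using u by (simp add: powr_realpow power_add del: of_nat_add)
        finally show ?thesis using u by (simp add: ennreal_mult[symmetric] mult_ac)
      qed simp
    qed
  qed
  also have "\<dots> = ennreal (real k * Beta (s + 1) (real (k + j)))"
    by (rule nn_integral_has_integral_lebesgue'[OF _ *]) simp
  finally show ?thesis .
qed

context isometry_invariant
begin

text \<open>\<open>moment_norm_sq\<close> and \<open>rec\<close> evaluate the same integral.
  Cancelling m + N leaves M(m + 1) = \<rho> (m + 1) / (m + \<gamma>) M(m), to be solved from M(0) =
  1.\<close>

lemma moment_eq_pochhammer:
  fixes i :: "'n::finite"
  assumes \<gamma>: "\<gamma> > 0" and zero: "measure \<mu> UNIV = 1"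
    and rec: "\<And>m. (\<integral>z. (norm z)\<^sup>2 * cmod (z $ i) ^ (2 * m) \<partial>\<mu>)
      = \<rho> * (real m + real CARD('n)) / (real m + \<gamma>) * moment m (axis i 1)"
    and e: "norm e = 1"
  shows "moment m e = fact m / pochhammer \<gamma> m * \<rho> ^ m"
proof -
  have "moment m (axis i 1) = fact m / pochhammer \<gamma> m * \<rho> ^ m"
  proof (induction m)
    case 0 show ?case using zero by (simp add: moment_def)
  next
    case (Suc m)
    have "real m + real CARD('n) > 0" by (simp add: add_nonneg_pos)
    moreover have "(real m + real CARD('n)) * (moment (Suc m) (axis i 1) / (real m + 1))
        = (real m + real CARD('n)) * (\<rho> / (real m + \<gamma>) * moment m (axis i 1))"
      using moment_norm_sq[of i m] rec[of m] by (simp add: mult.commute mult.assoc)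
    ultimately have "moment (Suc m) (axis i 1) / (real m + 1) = \<rho> / (real m + \<gamma>) * moment m (axis i 1)"
      by (subst (asm) mult_cancel_left) auto
    hence "moment (Suc m) (axis i 1) = \<rho> * (real m + 1) / (real m + \<gamma>) * moment m (axis i 1)"
      by (simp add: divide_eq_eq mult_ac)
    thus ?case using Suc \<gamma> pochhammer_pos[OF \<gamma>, of m]
      by (simp add: pochhammer_Suc field_simps)
  qed
  thus ?thesis using moment_eq[OF e, of "axis i 1" m] by simp
qed

end

definition wvol :: "real \<Rightarrow> (complex^'n) measure" where
  "wvol s = density vol_ball (\<lambda>z. ennreal (bergman_weight s z))"

definition wconst :: "'n::finite itself \<Rightarrow> real \<Rightarrow> real" where
  "wconst _ s = Gamma (real CARD('n) + s + 1) / (fact CARD('n) * Gamma (s + 1))"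

lemma wconst_pos: "s > -1 \<Longrightarrow> wconst TYPE('n::finite) s > 0"
  by (auto simp: wconst_def intro!: divide_pos_pos mult_pos_pos Gamma_real_pos)

lemma bergman_weight_eq:
  "bergman_weight s (z :: complex^'n) = wconst TYPE('n) s * (1 - (norm z)\<^sup>2) powr s"
  by (simp add: bergman_weight_def wconst_def)

lemma bergman_weight_nonneg: "s > -1 \<Longrightarrow> 0 \<le> bergman_weight s (z :: complex^'n)"
  using wconst_pos[of s, where 'n='n] by (simp add: bergman_weight_eq less_imp_le)

lemma measurable_bergman_weight [measurable]: "bergman_weight s \<in> borel_measurable borel"
  unfolding bergman_weight_def by measurable

text \<open>Taken at \<open>j = 0\<close> for the moments and at \<open>j = 1\<close> for the
  integral with the extra factor |z|^2; the two differ only by a unit shift in the Beta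
  function.\<close>

lemma nn_integral_wvol:
  fixes i :: "'n::finite" and m :: nat
  assumes s: "s > -1"
  defines "k \<equiv> m + CARD('n)"
  shows "(\<integral>\<^sup>+z. ennreal (((norm z)\<^sup>2) ^ j * cmod ((z :: complex^'n) $ i) ^ (2 * m)) \<partial>wvol s)
    = ennreal (wconst TYPE('n) s * enn2real (cmass m i) * (real k * Beta (s + 1) (real (k + j))))"
proof -
  have k: "k > 0" by (simp add: k_def)
  let ?K = "wconst TYPE('n) s"
  have K: "?K > 0" using wconst_pos[OF s] .
  have "(\<integral>\<^sup>+z. ennreal (((norm z)\<^sup>2) ^ j * cmod ((z :: complex^'n) $ i) ^ (2 * m)) \<partial>wvol s)
      = (\<integral>\<^sup>+z. ennreal (bergman_weight s z) * ennreal (((norm z)\<^sup>2) ^ j * cmod ((z :: complex^'n) $ i) ^ (2 * m)) \<partial>vol_ball)"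
    unfolding wvol_def by (rule nn_integral_density) simp_all
  also have "\<dots> = (\<integral>\<^sup>+z. ennreal ?K * (ennreal (cmod ((z :: complex^'n) $ i) ^ (2 * m)) *
      ennreal ((1 - (1 - (norm z)\<^sup>2)) ^ j * (1 - (norm z)\<^sup>2) powr s)) \<partial>vol_ball)"
    using K by (intro nn_integral_cong)
      (simp add: bergman_weight_eq ennreal_mult[symmetric] power_mult mult_ac)
  also have "\<dots> = ennreal ?K * (\<integral>\<^sup>+z. ennreal (cmod ((z :: complex^'n) $ i) ^ (2 * m)) *
      ennreal ((1 - (1 - (norm z)\<^sup>2)) ^ j * (1 - (norm z)\<^sup>2) powr s) \<partial>vol_ball)"
    by (rule nn_integral_cmult) simp
  also have "\<dots> = ennreal ?K * (cmass m i * ennreal (real k * Beta (s + 1) (real (k + j))))"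
    using nn_integral_vol_ball_radial[of "\<lambda>u. ennreal ((1 - u) ^ j * u powr s)" i m]
      nn_integral_Beta[OF s k, of j] by (simp add: k_def)
  also have "cmass m i = ennreal (enn2real (cmass m i))"
    using cmass_finite[of m i] by simp
  finally show ?thesis using K by (simp add: ennreal_mult' mult_ac)
qed

section \<open>Square integrable functions\<close>

definition sqint :: "'a measure \<Rightarrow> ('a \<Rightarrow> complex) \<Rightarrow> bool" where
  "sqint M f \<longleftrightarrow> f \<in> borel_measurable M \<and> integrable M (\<lambda>z. (cmod (f z))\<^sup>2)"

lemma sqint_measurable: "sqint M f \<Longrightarrow> f \<in> borel_measurable M"
  by (simp add: sqint_def)

lemma sqint_mult_cnj:
  assumes "sqint M f" "sqint M g"
  shows "integrable M (\<lambda>z. f z * cnj (g z))"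
proof (rule Bochner_Integration.integrable_bound)
  have [measurable]: "f \<in> borel_measurable M" "g \<in> borel_measurable M"
    using assms by (simp_all add: sqint_def)
  show "integrable M (\<lambda>z. (cmod (f z))\<^sup>2 + (cmod (g z))\<^sup>2)"
    using assms by (simp add: sqint_def)
  show "(\<lambda>z. f z * cnj (g z)) \<in> borel_measurable M" by measurable
  have "x * y \<le> x\<^sup>2 + y\<^sup>2" if "0 \<le> x" "0 \<le> y" for x y :: real
    using sum_squares_bound[of x y] mult_nonneg_nonneg[OF that] by linarith
  thus "AE z in M. norm (f z * cnj (g z)) \<le> norm ((cmod (f z))\<^sup>2 + (cmod (g z))\<^sup>2)"
    by (simp add: norm_mult)
qed

lemma cmod_add_sq_le: "(cmod (a + b))\<^sup>2 \<le> 2 * (cmod a)\<^sup>2 + 2 * (cmod b)\<^sup>2"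
proof -
  have "(cmod (a + b))\<^sup>2 \<le> (cmod a + cmod b)\<^sup>2" by (intro power_mono norm_triangle_ineq) simp
  also have "\<dots> \<le> 2 * (cmod a)\<^sup>2 + 2 * (cmod b)\<^sup>2"
    using sum_squares_bound[of "cmod a" "cmod b"] by (simp add: power2_sum)
  finally show ?thesis .
qed

lemma sqint_add:
  assumes "sqint M f" "sqint M g"
  shows "sqint M (\<lambda>z. f z + g z)"
  unfolding sqint_def
proof
  have [measurable]: "f \<in> borel_measurable M" "g \<in> borel_measurable M"
    using assms by (simp_all add: sqint_def)
  show "(\<lambda>z. f z + g z) \<in> borel_measurable M" by measurable
  show "integrable M (\<lambda>z. (cmod (f z + g z))\<^sup>2)"
  proof (rule Bochner_Integration.integrable_bound)
    show "integrable M (\<lambda>z. 2 * (cmod (f z))\<^sup>2 + 2 * (cmod (g z))\<^sup>2)"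
      using assms by (simp add: sqint_def)
    show "AE z in M. norm ((cmod (f z + g z))\<^sup>2) \<le> norm (2 * (cmod (f z))\<^sup>2 + 2 * (cmod (g z))\<^sup>2)"
      by (simp add: cmod_add_sq_le)
  qed measurable
qed

lemma sqint_scale: "sqint M f \<Longrightarrow> sqint M (\<lambda>z. c * f z)"
  by (auto simp: sqint_def norm_mult power_mult_distrib)

lemma (in finite_measure) sqint_integrable:
  assumes "sqint M f"
  shows "integrable M f"
proof (rule Bochner_Integration.integrable_bound)
  show "integrable M (\<lambda>z. 1 + (cmod (f z))\<^sup>2)" using assms by (simp add: sqint_def)
  have "x \<le> 1 + x\<^sup>2" for x :: real
    using sum_squares_bound[of x 1] zero_le_power2[of x] by (smt (verit) power_one)
  thus "AE z in M. norm (f z) \<le> norm (1 + (cmod (f z))\<^sup>2)" by simp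
qed (use assms in \<open>simp add: sqint_def\<close>)

lemma (in finite_measure) sqint_bounded:
  assumes "f \<in> borel_measurable M" "AE z in M. cmod (f z) \<le> K"
  shows "sqint M f"
  unfolding sqint_def
proof
  show "integrable M (\<lambda>z. (cmod (f z))\<^sup>2)"
  proof (rule integrable_const_bound)
    show "AE z in M. norm ((cmod (f z))\<^sup>2) \<le> K\<^sup>2"
      using assms(2) by eventually_elim (simp add: power_mono)
  qed (use assms(1) in measurable)
qed (rule assms(1))

definition L2ip :: "'a measure \<Rightarrow> ('a \<Rightarrow> complex) \<Rightarrow> ('a \<Rightarrow> complex) \<Rightarrow> complex" where
  "L2ip M f g = (\<integral>z. f z * cnj (g z) \<partial>M)"

lemma L2ip_add_left:
  "sqint M f \<Longrightarrow> sqint M g \<Longrightarrow> sqint M h \<Longrightarrow> L2ip M (\<lambda>z. f z + g z) h = L2ip M f h + L2ip M g h"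
  by (simp add: L2ip_def distrib_right sqint_mult_cnj)

lemma L2ip_scale_left: "L2ip M (\<lambda>z. c * f z) g = c * L2ip M f g"
  by (simp add: L2ip_def mult.assoc)

lemma L2ip_commute: "L2ip M g f = cnj (L2ip M f g)"
  unfolding L2ip_def Bochner_Integration.integral_cnj[symmetric] by (simp add: mult.commute)

lemma L2ip_self: "L2ip M f f = of_real (\<integral>z. (cmod (f z))\<^sup>2 \<partial>M)"
  unfolding L2ip_def by (simp add: mult_cnj_self flip: of_real_power)

lemma L2ip_dominated:
  assumes "finite_measure M" "sqint M f" "sqint M g"
    and "AE z in M. (cmod (f z))\<^sup>2 \<le> c1 * (cmod (g z))\<^sup>2 + c2"
  shows "Re (L2ip M f f) \<le> c1 * Re (L2ip M g g) + c2 * measure M (space M)"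
proof -
  interpret finite_measure M by fact
  have "(\<integral>z. (cmod (f z))\<^sup>2 \<partial>M) \<le> (\<integral>z. c1 * (cmod (g z))\<^sup>2 + c2 \<partial>M)"
    by (rule integral_mono_AE) (use assms in \<open>auto simp: sqint_def\<close>)
  also have "\<dots> = c1 * (\<integral>z. (cmod (g z))\<^sup>2 \<partial>M) + c2 * measure M (space M)"
    using assms(3) by (simp add: sqint_def)
  finally show ?thesis by (simp add: L2ip_self)
qed

lemma ker_bounded:
  assumes w: "w \<in> ballN" and \<gamma>: "\<gamma> > 0"
  shows "cmod (ker \<gamma> w z) \<le> (1 - norm w) powr (- \<gamma>)"
proof (cases "z \<in> ballN")
  case True
  have w1: "norm w < 1" using w by (simp add: ballN_def)
  have "cmod (cinner z w) \<le> 1 * norm w"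
    using cinner_Cauchy_Schwarz[of z w] True mult_right_mono[of "norm z" 1 "norm w"] by (simp add: ballN_def)
  hence "1 - norm w \<le> cmod (1 - cinner z w)"
    using norm_triangle_ineq2[of 1 "cinner z w"] by simp
  thus ?thesis using w1 \<gamma> True by (simp add: norm_ker powr_mono2')
qed (simp add: ker_def)

section \<open>The weighted Bergman spaces\<close>

lemma nn_integral_wvol_eq:
  assumes "f \<in> borel_measurable borel"
  shows "(\<integral>\<^sup>+z. f z \<partial>wvol s) = (\<integral>\<^sup>+z. ennreal (bergman_weight s z) * f z \<partial>vol_ball)"
  unfolding wvol_def by (rule nn_integral_density) (use assms in simp_all)

lemma sets_wvol [measurable_cong, simp]: "sets (wvol s) = sets borel"
  by (simp add: wvol_def)

lemma space_wvol [simp]: "space (wvol s) = UNIV"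
  by (simp add: wvol_def)

lemma emeasure_wvol:
  assumes s: "s > -1"
  shows "emeasure (wvol s) (UNIV :: (complex^'n) set) = 1"
proof -
  \<comment> \<open>Any coordinate will do: for \<open>m = 0\<close> the factor |z_i|^(2m) is
    1.\<close>
  obtain i :: 'n where True by simp
  have N: "real CARD('n) > 0" by simp
  have "emeasure (wvol s) (UNIV :: (complex^'n) set) = (\<integral>\<^sup>+z. 1 \<partial>(wvol s :: (complex^'n) measure))" by simp
  also have "\<dots> = ennreal (wconst TYPE('n) s * (real CARD('n) * Beta (s + 1) (real CARD('n))))"
    using nn_integral_wvol[OF s, where i = i and m = 0 and j = 0] by (simp add: cmass_0)
  also have "wconst TYPE('n) s * (real CARD('n) * Beta (s + 1) (real CARD('n))) = 1"
  proof -
    have "real CARD('n) * Gamma (real CARD('n)) = Gamma (real CARD('n) + 1)"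
      using N nonpos_Ints_nonpos[of "real CARD('n)"] by (subst Gamma_plus1) auto
    also have "\<dots> = fact CARD('n)" using Gamma_fact[of "CARD('n)", where 'a=real] by (simp add: add.commute)
    finally have G: "real CARD('n) * Gamma (real CARD('n)) = fact CARD('n)" .
    have "Gamma (s + 1) > 0" "Gamma (real CARD('n) + s + 1) > 0"
      using s N by (auto intro!: Gamma_real_pos)
    thus ?thesis using G unfolding wconst_def Beta_def by (simp add: field_simps)
  qed
  finally show ?thesis by simp
qed

lemma isometry_invariant_wvol:
  assumes s: "s > -1"
  shows "isometry_invariant (wvol s :: (complex^'n) measure)"
proof (intro isometry_invariant.intro isometry_invariant_axioms.intro finite_measureI)
  show "emeasure (wvol s :: (complex^'n) measure) (space (wvol s)) \<noteq> \<infinity>"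
    using emeasure_wvol[OF s, where 'n='n] by simp
  show "AE z in wvol s. z \<in> (ballN :: (complex^'n) set)"
    unfolding wvol_def using AE_vol_ball by (subst AE_density) (auto elim!: eventually_mono)
  show "distr (wvol s) borel T = (wvol s :: (complex^'n) measure)"
    if "orthogonal_transformation T" for T :: "complex^'n \<Rightarrow> complex^'n"
    unfolding wvol_def
  proof (rule distr_density_invariant)
    show "ennreal (bergman_weight s (T x)) = ennreal (bergman_weight s x)" for x
      using that by (simp add: bergman_weight_def orthogonal_transformation)
  qed (use that distr_vol_ball orthogonal_transformation_measurable in auto)
qed simp

text \<open>The recursion Beta(s + 1, k + 1) = k / (s + 1 + k) Beta(s + 1, k) with k = m + N is the
  source of the kernel exponent N + s + 1.\<close>

lemma moment_wvol:
  fixes e :: "complex^'n"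
  assumes s: "s > -1" and e: "norm e = 1"
  shows "isometry_invariant.moment (wvol s) m e = fact m / pochhammer (real CARD('n) + s + 1) m * 1 ^ m"
proof -
  interpret isometry_invariant "wvol s :: (complex^'n) measure"
    by (rule isometry_invariant_wvol[OF s])
  obtain i :: 'n where True by simp
  have int: "(\<integral>z. ((norm z)\<^sup>2) ^ j * cmod (z $ i) ^ (2 * m) \<partial>wvol s)
      = wconst TYPE('n) s * enn2real (cmass m i) * (real (m + CARD('n)) * Beta (s + 1) (real (m + CARD('n) + j)))"
    for j m
  proof -
    have "Beta (s + 1) (real (m + CARD('n) + j)) \<ge> 0"
      unfolding Beta_def using s
      by (intro divide_nonneg_pos mult_nonneg_nonneg less_imp_le[OF Gamma_real_pos] Gamma_real_pos) (auto simp: add_nonneg_pos add_pos_nonneg)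
    thus ?thesis
      using nn_integral_wvol[OF s, where i = i and m = m and j = j] wconst_pos[OF s, where 'n='n]
      by (subst integral_eq_nn_integral) (auto intro!: mult_nonneg_nonneg simp del: of_nat_add)
  qed
  show ?thesis
  proof (rule moment_eq_pochhammer[OF _ _ _ e])
    show "real CARD('n) + s + 1 > 0" using s by (simp add: add_nonneg_pos)
    show "measure (wvol s) (UNIV :: (complex^'n) set) = 1"
      by (simp add: measure_def emeasure_wvol[OF s])
    fix m
    define k where "k = real m + real CARD('n)"
    have k: "k > 0" by (simp add: k_def add_nonneg_pos)
    have "(s + 1 + k) * Beta (s + 1) (k + 1) = k * Beta (s + 1) k"
      using k nonpos_Ints_nonpos[of k] by (intro Beta_plus1_right) auto
    hence "Beta (s + 1) (k + 1) = k / (s + 1 + k) * Beta (s + 1) k"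
      using k s by (simp add: field_simps)
    moreover have "moment m (axis i 1) = wconst TYPE('n) s * enn2real (cmass m i) * (k * Beta (s + 1) k)"
      using int[of 0 m] by (simp add: moment_def k_def)
    moreover have "(\<integral>z. (norm z)\<^sup>2 * cmod (z $ i) ^ (2 * m) \<partial>wvol s)
        = wconst TYPE('n) s * enn2real (cmass m i) * (k * Beta (s + 1) (k + 1))"
      using int[of 1 m] by (simp add: k_def add_ac)
    ultimately show "(\<integral>z. (norm z)\<^sup>2 * cmod (z $ i) ^ (2 * m) \<partial>wvol s)
        = 1 * (real m + real CARD('n)) / (real m + (real CARD('n) + s + 1)) * moment m (axis i 1)"
      by (simp add: k_def mult_ac add_ac)
  qed
qed

lemma A2_iff:
  fixes f :: "complex^'n \<Rightarrow> complex"
  assumes s: "s > -1"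
  shows "f \<in> A2 s \<longleftrightarrow> holo_ball f \<and> (\<forall>z. z \<notin> ballN \<longrightarrow> f z = 0) \<and> sqint (wvol s) f"
proof -
  have "(\<integral>\<^sup>+ z. ennreal ((cmod (f z))\<^sup>2 * bergman_weight s z) \<partial>vol_ball) < \<infinity> \<longleftrightarrow> sqint (wvol s) f"
    if "holo_ball f" "\<forall>z. z \<notin> ballN \<longrightarrow> f z = 0"
  proof -
    have f[measurable]: "f \<in> borel_measurable borel" using that by (intro holo_ball_measurable) auto
    have "(\<integral>\<^sup>+ z. ennreal ((cmod (f z))\<^sup>2 * bergman_weight s z) \<partial>vol_ball) = (\<integral>\<^sup>+ z. ennreal ((cmod (f z))\<^sup>2) \<partial>wvol s)"
      using bergman_weight_nonneg[OF s, where 'n='n]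
      by (subst nn_integral_wvol_eq) (auto intro!: nn_integral_cong simp: ennreal_mult mult.commute)
    thus ?thesis
      by (simp add: sqint_def integrable_iff_bounded)
  qed
  thus ?thesis unfolding A2_def by blast
qed

lemma A2_ip_eq:
  fixes f g :: "complex^'n \<Rightarrow> complex"
  assumes s: "s > -1" and "sqint (wvol s) f" "sqint (wvol s) g"
  shows "A2_ip s f g = L2ip (wvol s) f g"
proof -
  have [measurable]: "f \<in> borel_measurable borel" "g \<in> borel_measurable borel"
    using sqint_measurable[OF assms(2)] sqint_measurable[OF assms(3)] by simp_all
  show ?thesis
    unfolding A2_ip_def L2ip_def wvol_def using bergman_weight_nonneg[OF s, where 'n='n]
    by (subst integral_density) (simp_all add: scaleR_conv_of_real mult.commute)
qed

lemma kernel_space_A2: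
  assumes s: "s > -1"
  shows "kernel_space (A2 s :: (complex^'n \<Rightarrow> complex) set) (A2_ip s) (real CARD('n) + s + 1) 1"
proof -
  interpret isometry_invariant "wvol s :: (complex^'n) measure"
    by (rule isometry_invariant_wvol[OF s])
  let ?S = "A2 s :: (complex^'n \<Rightarrow> complex) set"
  have S: "holo_ball f" "\<And>z. z \<notin> ballN \<Longrightarrow> f z = 0" "sqint (wvol s) f" if "f \<in> ?S" for f
    using that by (auto simp: A2_iff[OF s])
  have ip: "A2_ip s f g = L2ip (wvol s) f g" if "f \<in> ?S" "g \<in> ?S" for f g
    by (rule A2_ip_eq[OF s S(3)[OF that(1)] S(3)[OF that(2)]])
  have \<gamma>: "real CARD('n) + s + 1 > 0" using s by (simp add: add_nonneg_pos)
  show ?thesis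
  proof
    show add: "(\<lambda>x. f x + g x) \<in> ?S" if "f \<in> ?S" "g \<in> ?S" for f g
      using that by (auto simp: A2_iff[OF s] intro: holo_ball_add sqint_add)
    show scale: "(\<lambda>x. c * f x) \<in> ?S" if "f \<in> ?S" for c f
      using that by (auto simp: A2_iff[OF s] intro: holo_ball_mult holo_ball_const sqint_scale)
    show "A2_ip s (\<lambda>x. f x + g x) h = A2_ip s f h + A2_ip s g h" if "f \<in> ?S" "g \<in> ?S" "h \<in> ?S" for f g h
      using that by (simp add: ip add L2ip_add_left S)
    show "A2_ip s (\<lambda>x. c * f x) g = c * A2_ip s f g" if "f \<in> ?S" "g \<in> ?S" for c f g
      using that by (simp add: ip scale L2ip_scale_left)
    show "A2_ip s g f = cnj (A2_ip s f g)" if "f \<in> ?S" "g \<in> ?S" for f g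
      using that by (simp add: ip L2ip_commute[of _ g])
    show "0 \<le> Re (A2_ip s f f)" if "f \<in> ?S" for f
      using that by (simp add: ip L2ip_self)
    show ker: "ker (real CARD('n) + s + 1) w \<in> ?S" if "w \<in> ballN" for w
      unfolding A2_iff[OF s]
    proof (intro conjI allI impI)
      show "sqint (wvol s) (ker (real CARD('n) + s + 1) w)"
        using ker_measurable[OF that] ker_bounded[OF that \<gamma>]
        by (intro sqint_bounded[where K = "(1 - norm w) powr (- (real CARD('n) + s + 1))"]) auto
    qed (use that in \<open>auto simp: ker_def intro: holo_ball_ker\<close>)
    show "A2_ip s f (ker (real CARD('n) + s + 1) w) = f w" if "f \<in> ?S" "w \<in> ballN" for f w
      unfolding ip[OF that(1) ker[OF that(2)]] L2ip_def
      by (subst integral_mult_ker[where \<rho> = 1 and \<gamma> = "real CARD('n) + s + 1", OF _ _ _ \<gamma>])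
        (use that S[OF that(1)] moment_wvol[OF s] sqint_integrable in auto)
    show "Re (A2_ip s f f) \<le> c1 * Re (A2_ip s g g) + c2 * 1"
      if "f \<in> ?S" "g \<in> ?S" "0 \<le> c1" "0 \<le> c2"
        "\<And>z. z \<in> ballN \<Longrightarrow> (cmod (f z))\<^sup>2 \<le> c1 * (cmod (g z))\<^sup>2 + c2" for f g c1 c2
    proof -
      have "AE z in wvol s. (cmod (f z))\<^sup>2 \<le> c1 * (cmod (g z))\<^sup>2 + c2"
        using AE_ball by eventually_elim (rule that(5))
      from L2ip_dominated[OF finite_measure_axioms S(3)[OF that(1)] S(3)[OF that(2)] this]
      show ?thesis using that by (simp add: ip measure_def emeasure_wvol[OF s])
    qed
  qed (rule \<gamma>)
qed

section \<open>The Hardy space\<close>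

lemma coef_summable:
  assumes F: "F holomorphic_on ball 0 1" and r: "0 \<le> r" "r < 1"
  shows "summable (\<lambda>m. cmod (coef m F) * r ^ m)"
proof -
  \<comment> \<open>Convergence of the series at an intermediate radius gives absolute convergence
    at \<open>r\<close>.\<close>
  define x where "x = (r + 1) / 2"
  have x: "r < x" "x < 1" "0 \<le> x" using r by (auto simp: x_def)
  have "summable (\<lambda>m. coef m F * of_real x ^ m)"
    using holomorphic_power_series[OF F, of "of_real x"] x by (auto simp: coef_def sums_iff)
  from powser_insidea[OF this, of "of_real r"] show ?thesis
    using x r by (simp add: norm_mult norm_power)
qed

text \<open>Only one of the two factors of |G|^2 is expanded, so each term is a single coefficient
  integral and no double series occurs. The nonnegative coefficients make the means increase with
  \<open>r\<close>.\<close>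

lemma Parseval_circ:
  assumes F: "F holomorphic_on ball 0 1" and meas[measurable]: "F \<in> borel_measurable borel"
    and r: "0 \<le> r" "r < 1"
  shows "(\<lambda>m. (cmod (coef m F))\<^sup>2 * r ^ (2 * m)) sums (\<integral>l. (cmod (F (of_real r * l)))\<^sup>2 \<partial>circ)"
proof -
  define G where "G = (\<lambda>l. F (of_real r * l))"
  have Gm[measurable]: "G \<in> borel_measurable borel" unfolding G_def by measurable
  have rl: "of_real r * l \<in> ball 0 1" if "l \<in> cball 0 1" for l :: complex
    using that r mult_left_le[of "cmod l" r] by (simp add: norm_mult)
  have holG: "G holomorphic_on cball 0 1"
    unfolding G_def
    using holomorphic_on_compose_gen[OF _ F, of "\<lambda>l. of_real r * l" "cball 0 1"]
      image_subsetI[of "cball 0 1" "\<lambda>l. of_real r * l" "ball 0 1", OF rl]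
    by (auto simp: o_def intro!: holomorphic_intros)
  have contG: "continuous_on (cball 0 1) G" using holG by (rule holomorphic_on_imp_continuous_on)
  have "compact (G ` cball 0 1)" by (intro compact_continuous_image contG) simp
  then obtain K where "\<forall>x\<in>cball 0 1. cmod (G x) \<le> K"
    by (auto dest!: compact_imp_bounded simp: bounded_iff)
  hence K: "cmod (G l) \<le> K" if "cmod l = 1" for l using that by simp
  define c where "c = (\<lambda>m. coef m F * of_real r ^ m)"
  have sc: "summable (\<lambda>m. cmod (c m))"
    using coef_summable[OF F r] r by (simp add: c_def norm_mult norm_power)
  define h where "h = (\<lambda>m l. c m * l ^ m * cnj (G l))"
  have hb: "norm (h m l) \<le> cmod (c m) * K" if "cmod l = 1" for m l
    using K[OF that] that by (simp add: h_def norm_mult norm_power mult_left_mono)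
  have hi: "integrable circ (h m)" for m
    unfolding h_def using contG
    by (intro integrable_circ continuous_intros) (auto elim: continuous_on_subset)
  have int_h: "(\<integral>l. h m l \<partial>circ) = of_real ((cmod (coef m F))\<^sup>2 * r ^ (2 * m))" for m
  proof -
    have "(\<integral>l. h m l \<partial>circ) = c m * (\<integral>l. cnj (G l * cnj l ^ m) \<partial>circ)"
      by (simp add: h_def mult_ac del: Bochner_Integration.integral_cnj)
    also have "(\<integral>l. cnj (G l * cnj l ^ m) \<partial>circ) = cnj (\<integral>l. G l * cnj l ^ m \<partial>circ)"
      by (rule Bochner_Integration.integral_cnj)
    also have "(\<integral>l. G l * cnj l ^ m \<partial>circ) = coef m G"
      by (rule integral_circ_coef[OF contG])
        (use holG in \<open>auto elim: holomorphic_on_subset\<close>)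
    also have "coef m G = c m"
      unfolding G_def c_def using r by (subst coef_scale[OF F]) auto
    also have "c m * cnj (c m) = of_real ((cmod (coef m F))\<^sup>2 * r ^ (2 * m))"
    proof -
      have "cmod (c m) = cmod (coef m F) * r ^ m" using r by (simp add: c_def norm_mult norm_power)
      thus ?thesis by (simp add: mult_cnj_self power_mult_distrib power_even_eq)
    qed
    finally show ?thesis .
  qed
  have "(\<lambda>m. \<integral>l. h m l \<partial>circ) sums (\<integral>l. (\<Sum>m. h m l) \<partial>circ)"
  proof (rule sums_integral[OF hi])
    show "AE l in circ. summable (\<lambda>m. norm (h m l))"
      using AE_circ
    proof eventually_elim
      case (elim l)
      show ?case
        by (rule summable_comparison_test'[OF summable_mult2[OF sc, of K]]) (use hb[OF elim] in simp)
    qed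
    show "summable (\<lambda>m. \<integral>l. norm (h m l) \<partial>circ)"
    proof (rule summable_comparison_test'[OF summable_mult2[OF sc, of K]])
      fix m
      have "(\<integral>l. norm (h m l) \<partial>circ) \<le> (\<integral>l. cmod (c m) * K \<partial>circ)"
        by (rule integral_mono_AE) (use hi AE_circ hb in \<open>auto elim!: eventually_mono\<close>)
      thus "norm (\<integral>l. norm (h m l) \<partial>circ) \<le> cmod (c m) * K" by simp
    qed
  qed
  moreover have "(\<integral>l. (\<Sum>m. h m l) \<partial>circ) = (\<integral>l. of_real ((cmod (G l))\<^sup>2) \<partial>circ)"
  proof (rule integral_cong_AE)
    show "AE l in circ. (\<Sum>m. h m l) = of_real ((cmod (G l))\<^sup>2)"
      using AE_circ
    proof eventually_elim
      case (elim l)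
      have "(\<lambda>m. coef m F * (of_real r * l) ^ m) sums G l"
        using holomorphic_power_series[OF F rl[of l]] elim by (simp add: coef_def G_def)
      from sums_mult2[OF this, of "cnj (G l)"] show ?case
        by (simp add: h_def c_def power_mult_distrib mult_ac sums_iff mult_cnj_self)
    qed
    have "h m \<in> borel_measurable circ" for m using hi[of m] by simp
    thus "(\<lambda>l. \<Sum>m. h m l) \<in> borel_measurable circ" by measurable
  qed measurable
  ultimately have "(\<lambda>m. complex_of_real ((cmod (coef m F))\<^sup>2 * r ^ (2 * m))) sums
      of_real (\<integral>l. (cmod (G l))\<^sup>2 \<partial>circ)"
    unfolding int_h integral_complex_of_real by (simp only:)
  thus ?thesis unfolding sums_of_real_iff G_def .
qed

lemma circ_mean_mono:
  assumes F: "F holomorphic_on ball 0 1" "F \<in> borel_measurable borel"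
    and r: "0 \<le> r" "r \<le> r'" "r' < 1"
  shows "(\<integral>l. (cmod (F (of_real r * l)))\<^sup>2 \<partial>circ) \<le> (\<integral>l. (cmod (F (of_real r' * l)))\<^sup>2 \<partial>circ)"
  by (rule sums_le[OF _ Parseval_circ[OF F] Parseval_circ[OF F]])
    (use r in \<open>auto intro!: mult_left_mono power_mono\<close>)

section \<open>Surface measure and spheres of radius r\<close>

lemma sets_sph [measurable_cong, simp]: "sets sph = sets borel"
  by (simp add: sph_def)

lemma space_sph [simp]: "space sph = UNIV"
  by (simp add: sph_def)

lemma emeasure_sph [simp]: "emeasure sph (UNIV :: (complex^'n) set) = 1"
  unfolding sph_def by (subst emeasure_distr) simp_all

lemma AE_sph: "AE z in sph. norm (z :: complex^'n) = 1"
proof -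
  \<comment> \<open>The radial projection sends the origin to 0, off the sphere, but the origin is a
    null set.\<close>
  have "AE x in vol_ball. x \<noteq> (0 :: complex^'n)"
    unfolding vol_ball_def
    by (rule AE_uniform_measureI) (use AE_lborel_singleton[of "0::complex^'n"] in \<open>auto elim!: eventually_mono\<close>)
  thus ?thesis
    unfolding sph_def by (subst AE_distr_iff) (auto elim!: eventually_mono)
qed

lemma distr_distr_commute:
  assumes "distr M borel T = M" "sets M = sets borel"
    and "T \<in> borel_measurable borel" "h \<in> borel_measurable borel"
    and comm: "\<And>x. T (h x) = h (T x)"
  shows "distr (distr M borel h) borel T = distr M borel h"
proof -
  have M: "measurable M borel = borel_measurable borel"
    using assms(2) by (rule measurable_cong_sets) simp
  have "distr (distr M borel h) borel T = distr (distr M borel T) borel h"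
    using assms(3,4) by (simp add: distr_distr M o_def comm)
  thus ?thesis by (simp only: assms(1))
qed

lemma distr_sph:
  fixes T :: "complex^'n \<Rightarrow> complex^'n"
  assumes T: "orthogonal_transformation T"
  shows "distr sph borel T = sph"
  unfolding sph_def
  by (rule distr_distr_commute[OF distr_vol_ball[OF T] _ orthogonal_transformation_measurable[OF T]])
    (use T in \<open>simp_all add: orthogonal_transformation linear_cmul\<close>)

text \<open>Expresses the Hardy mean at radius \<open>r\<close> by a measure carried by the open
  ball for \<open>0 < r < 1\<close>, so that \<open>isometry_invariant\<close> applies.\<close>

definition srad :: "real \<Rightarrow> (complex^'n) measure" where
  "srad r = distr sph borel (\<lambda>z. r *\<^sub>R z)"

lemma sets_srad [measurable_cong, simp]: "sets (srad r) = sets borel"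
  by (simp add: srad_def)

lemma space_srad [simp]: "space (srad r) = UNIV"
  by (simp add: srad_def)

lemma emeasure_srad [simp]: "emeasure (srad r) (UNIV :: (complex^'n) set) = 1"
  unfolding srad_def by (subst emeasure_distr) simp_all

lemma AE_srad: "0 < r \<Longrightarrow> AE z in srad r. norm (z :: complex^'n) = r"
  unfolding srad_def using AE_sph by (subst AE_distr_iff) (auto elim!: eventually_mono)

lemma integral_srad:
  fixes f :: "complex^'n \<Rightarrow> 'b::{banach,second_countable_topology}"
  assumes "f \<in> borel_measurable borel"
  shows "(\<integral>z. f z \<partial>srad r) = (\<integral>z. f (r *\<^sub>R z) \<partial>sph)"
  unfolding srad_def by (rule integral_distr) (use assms in simp_all)

lemma isometry_invariant_srad:
  assumes r: "0 < r" "r < 1"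
  shows "isometry_invariant (srad r :: (complex^'n) measure)"
proof (intro isometry_invariant.intro isometry_invariant_axioms.intro finite_measureI)
  show "AE z in srad r. z \<in> (ballN :: (complex^'n) set)"
    using AE_srad[OF r(1)] by eventually_elim (use r in \<open>simp add: ballN_def\<close>)
  show "distr (srad r) borel T = (srad r :: (complex^'n) measure)"
    if T: "orthogonal_transformation T" for T :: "complex^'n \<Rightarrow> complex^'n"
    unfolding srad_def
    by (rule distr_distr_commute[OF distr_sph[OF T] _ orthogonal_transformation_measurable[OF T]])
      (use T in \<open>simp_all add: orthogonal_transformation linear_cmul\<close>)
qed simp_all

text \<open>As |z| = r almost everywhere, the recursion has the same factor m + N above and below,
  whence the exponent N and \<rho> = r^2.\<close>

lemma moment_srad:
  fixes e :: "complex^'n"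
  assumes r: "0 < r" "r < 1" and e: "norm e = 1"
  shows "isometry_invariant.moment (srad r) m e = fact m / pochhammer (real CARD('n)) m * (r\<^sup>2) ^ m"
proof -
  interpret isometry_invariant "srad r :: (complex^'n) measure"
    by (rule isometry_invariant_srad[OF r])
  obtain i :: 'n where True by simp
  show ?thesis
  proof (rule moment_eq_pochhammer[OF _ _ _ e])
    show "measure (srad r) (UNIV :: (complex^'n) set) = 1" by (simp add: measure_def)
    fix m
    have "(\<integral>z. (norm z)\<^sup>2 * cmod (z $ i) ^ (2 * m) \<partial>srad r) = (\<integral>z. r\<^sup>2 * cmod ((z::complex^'n) $ i) ^ (2 * m) \<partial>srad r)"
      by (rule integral_cong_AE) (use AE_srad[OF r(1)] in \<open>auto elim!: eventually_mono\<close>)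
    also have "\<dots> = r\<^sup>2 * moment m (axis i 1)" by (simp add: moment_def)
    also have "\<dots> = r\<^sup>2 * (real m + real CARD('n)) / (real m + real CARD('n)) * moment m (axis i 1)"
    proof -
      have "real m + real CARD('n) > 0" by (simp add: add_nonneg_pos)
      thus ?thesis by simp
    qed
    finally show "(\<integral>z. (norm z)\<^sup>2 * cmod (z $ i) ^ (2 * m) \<partial>srad r)
      = r\<^sup>2 * (real m + real CARD('n)) / (real m + real CARD('n)) * moment m (axis i 1)" .
  qed simp
qed

section \<open>Integral means and the Hardy space\<close>

definition ball_fun :: "(complex^'n \<Rightarrow> complex) \<Rightarrow> bool" where
  "ball_fun f \<longleftrightarrow> holo_ball f \<and> (\<forall>z. z \<notin> ballN \<longrightarrow> f z = 0)"

lemma ball_fun_measurable: "ball_fun f \<Longrightarrow> f \<in> borel_measurable borel"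
  by (intro holo_ball_measurable) (auto simp: ball_fun_def)

lemma ball_fun_sqint:
  fixes f :: "complex^'n \<Rightarrow> complex"
  assumes f: "ball_fun f" and r: "0 < r" "r < 1"
  shows "sqint (srad r) f"
proof -
  interpret isometry_invariant "srad r :: (complex^'n) measure"
    by (rule isometry_invariant_srad[OF r])
  have "continuous_on (cball 0 r) f"
    using f r by (intro continuous_on_subset[OF holo_ball_continuous]) (auto simp: ball_fun_def ballN_def)
  hence "compact (f ` cball 0 r)" by (intro compact_continuous_image) simp_all
  then obtain K where "\<forall>x\<in>cball 0 r. cmod (f x) \<le> K"
    by (auto dest!: compact_imp_bounded simp: bounded_iff)
  hence "AE z in srad r. cmod (f z) \<le> K"
    using AE_srad[OF r(1)] by (auto elim!: eventually_mono)
  thus ?thesis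
    using ball_fun_measurable[OF f] by (intro sqint_bounded) simp_all
qed

lemma ball_fun_add: "ball_fun f \<Longrightarrow> ball_fun g \<Longrightarrow> ball_fun (\<lambda>z. f z + g z)"
  by (simp add: ball_fun_def holo_ball_add)

lemma ball_fun_scale: "ball_fun f \<Longrightarrow> ball_fun (\<lambda>z. c * f z)"
  by (simp add: ball_fun_def holo_ball_mult holo_ball_const)

definition mean_sq :: "(complex^'n \<Rightarrow> complex) \<Rightarrow> real \<Rightarrow> real" where
  "mean_sq f r = (\<integral>z. (cmod (f z))\<^sup>2 \<partial>srad r)"

text \<open>Integration by slices: averaging over scalar rotations turns the mean over the sphere
  into an average of one-variable means, each monotone in \<open>r\<close>.\<close>

lemma mean_sq_eq_circ:
  fixes f :: "complex^'n \<Rightarrow> complex"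
  assumes f: "ball_fun f" and r: "0 < r" "r < 1"
  shows "integrable sph (\<lambda>z. \<integral>l. (cmod (f (of_real r * l *s z)))\<^sup>2 \<partial>circ)"
    and "mean_sq f r = (\<integral>z. (\<integral>l. (cmod (f (of_real r * l *s z)))\<^sup>2 \<partial>circ) \<partial>sph)"
proof -
  interpret isometry_invariant "srad r :: (complex^'n) measure"
    by (rule isometry_invariant_srad[OF r])
  have [measurable]: "f \<in> borel_measurable borel" by (rule ball_fun_measurable[OF f])
  define g where "g = (\<lambda>z. complex_of_real ((cmod (f z))\<^sup>2))"
  have [measurable]: "g \<in> borel_measurable borel" unfolding g_def by measurable
  have g: "integrable (srad r) g"
    using ball_fun_sqint[OF f r] unfolding g_def by (intro integrable_of_real) (simp add: sqint_def)
  have R: "(\<lambda>(l, z). l *s z) \<in> borel_measurable (borel \<Otimes>\<^sub>M (borel :: (complex^'n) measure))" by measurable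
  obtain e :: "complex^'n" where e: "norm e = 1" using norm_axis_one by blast
  have O: "orthogonal_transformation ((*s) l :: complex^'n \<Rightarrow> complex^'n)" if "cmod l = 1" for l
  proof -
    have "rot e l l = (*s) l" by (rule ext) (rule rot_same)
    thus ?thesis using orthogonal_transformation_rot[OF e that that] by simp
  qed
  have avg: "integrable (srad r) (\<lambda>z. \<integral>l. g (l *s z) \<partial>circ)"
    "(\<integral>z. g z \<partial>srad r) = (\<integral>z. (\<integral>l. g (l *s z) \<partial>circ) \<partial>srad r)"
    by (rule isometry_average[OF g R O], assumption)+
  have inner: "(\<integral>l. g (l *s (r *\<^sub>R z)) \<partial>circ) = of_real (\<integral>l. (cmod (f (of_real r * l *s z)))\<^sup>2 \<partial>circ)" for z
    unfolding g_def integral_complex_of_real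
    by (simp add: scaleR_eq_smult vector_smult_assoc mult.commute)
  have m: "(\<lambda>z. \<integral>l. g (l *s z) \<partial>circ) \<in> borel_measurable borel" using avg(1) by simp
  have "integrable sph (\<lambda>z. \<integral>l. g (l *s (r *\<^sub>R z)) \<partial>circ)"
    using avg(1) m unfolding srad_def by (subst (asm) integrable_distr_eq) simp_all
  thus "integrable sph (\<lambda>z. \<integral>l. (cmod (f (of_real r * l *s z)))\<^sup>2 \<partial>circ)"
    unfolding inner by (simp only: complex_of_real_integrable_eq)
  have "complex_of_real (mean_sq f r) = (\<integral>z. g z \<partial>srad r)"
    unfolding mean_sq_def g_def integral_complex_of_real ..
  also have "\<dots> = (\<integral>z. (\<integral>l. g (l *s z) \<partial>circ) \<partial>srad r)" by (rule avg(2))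
  also have "\<dots> = (\<integral>z. (\<integral>l. g (l *s (r *\<^sub>R z)) \<partial>circ) \<partial>sph)" by (rule integral_srad[OF m])
  also have "\<dots> = of_real (\<integral>z. (\<integral>l. (cmod (f (of_real r * l *s z)))\<^sup>2 \<partial>circ) \<partial>sph)"
    unfolding inner integral_complex_of_real ..
  finally show "mean_sq f r = (\<integral>z. (\<integral>l. (cmod (f (of_real r * l *s z)))\<^sup>2 \<partial>circ) \<partial>sph)"
    unfolding of_real_eq_iff .
qed

lemma mean_sq_mono:
  fixes f :: "complex^'n \<Rightarrow> complex"
  assumes f: "ball_fun f" and r: "0 < r" "r \<le> r'" "r' < 1"
  shows "mean_sq f r \<le> mean_sq f r'"
proof -
  have r1: "r < 1" and r'0: "0 < r'" using r by auto
  have [measurable]: "f \<in> borel_measurable borel" by (rule ball_fun_measurable[OF f])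
  show ?thesis
    unfolding mean_sq_eq_circ(2)[OF f r(1) r1] mean_sq_eq_circ(2)[OF f r'0 r(3)]
  proof (rule integral_mono_AE[OF mean_sq_eq_circ(1)[OF f r(1) r1] mean_sq_eq_circ(1)[OF f r'0 r(3)]])
    show "AE z in sph. (\<integral>l. (cmod (f (of_real r * l *s z)))\<^sup>2 \<partial>circ) \<le> (\<integral>l. (cmod (f (of_real r' * l *s z)))\<^sup>2 \<partial>circ)"
      using AE_sph
    proof eventually_elim
      case (elim z)
      have "(\<lambda>l. f (0 + l *s z)) holomorphic_on ball 0 1"
        using f elim by (intro holo_ball_line_holomorphic) (auto simp: ball_fun_def ballN_def)
      thus ?case
        using circ_mean_mono[of "\<lambda>l. f (l *s z)" r r'] r by simp
    qed
  qed
qed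

lemma H2_iff:
  fixes f :: "complex^'n \<Rightarrow> complex"
  shows "f \<in> H2 \<longleftrightarrow> ball_fun f \<and> (\<exists>K. \<forall>r\<in>{0<..<1}. mean_sq f r \<le> K)"
proof -
  let ?I = "\<lambda>r. \<integral>\<^sup>+ \<zeta>. ennreal ((cmod (f (r *\<^sub>R \<zeta>)))\<^sup>2) \<partial>sph"
  let ?S = "SUP r\<in>{0<..<1::real}. ennreal (mean_sq f r)"
  have "(SUP r\<in>{0<..<1::real}. ?I r) < \<infinity> \<longleftrightarrow>
      (\<exists>K. \<forall>r\<in>{0<..<1}. mean_sq f r \<le> K)" if f: "ball_fun f"
  proof -
    have [measurable]: "f \<in> borel_measurable borel" by (rule ball_fun_measurable[OF f])
    have eq: "?I r = ennreal (mean_sq f r)"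
      if "r \<in> {0<..<1}" for r
    proof -
      have "?I r = (\<integral>\<^sup>+ z. ennreal ((cmod (f z))\<^sup>2) \<partial>srad r)"
        unfolding srad_def by (rule nn_integral_distr[symmetric]) simp_all
      also have "\<dots> = ennreal (mean_sq f r)"
        unfolding mean_sq_def using ball_fun_sqint[OF f] that
        by (intro nn_integral_eq_integral) (auto simp: sqint_def)
      finally show ?thesis .
    qed
    have sup: "(SUP r\<in>{0<..<1::real}. ?I r) = ?S"
      by (intro SUP_cong refl eq)
    have pos: "0 \<le> mean_sq f r" for r by (simp add: mean_sq_def)
    show ?thesis
      unfolding sup
    proof
      assume *: "?S < \<infinity>"
      have "mean_sq f r \<le> enn2real ?S" if "r \<in> {0<..<1}" for r
      proof -
        have "ennreal (mean_sq f r) \<le> ?S" using that by (intro SUP_upper)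
        from enn2real_mono[OF this] show ?thesis using * pos by simp
      qed
      thus "\<exists>K. \<forall>r\<in>{0<..<1}. mean_sq f r \<le> K" by blast
    next
      assume "\<exists>K. \<forall>r\<in>{0<..<1}. mean_sq f r \<le> K"
      then obtain K where "\<forall>r\<in>{0<..<1}. mean_sq f r \<le> K" ..
      hence "?S \<le> ennreal K"
        by (intro SUP_least ennreal_leI) auto
      thus "?S < \<infinity>" using order_le_less_trans by force
    qed
  qed
  thus ?thesis unfolding H2_def ball_fun_def by blast
qed

lemma H2I:
  fixes f :: "complex^'n \<Rightarrow> complex"
  assumes "ball_fun f" "\<And>r. 0 < r \<Longrightarrow> r < 1 \<Longrightarrow> mean_sq f r \<le> K"
  shows "f \<in> H2"
  unfolding H2_iff using assms by (intro conjI exI[of _ K]) auto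

lemma H2E:
  fixes f :: "complex^'n \<Rightarrow> complex"
  assumes "f \<in> H2"
  obtains K where "ball_fun f" "\<And>r. 0 < r \<Longrightarrow> r < 1 \<Longrightarrow> mean_sq f r \<le> K"
proof -
  obtain K where "ball_fun f" "\<forall>r\<in>{0<..<1}. mean_sq f r \<le> K"
    using assms unfolding H2_iff by blast
  thus ?thesis by (intro that[of K]) auto
qed

lemma eventually_at_left_1: "\<forall>\<^sub>F r in at_left (1::real). 0 < r \<and> r < 1"
  using eventually_at_left_real[of 0 "1::real"] by (auto elim!: eventually_mono)

lemma mean_sq_convergent:
  fixes f :: "complex^'n \<Rightarrow> complex"
  assumes "f \<in> H2"
  shows "\<exists>L. (mean_sq f \<longlongrightarrow> L) (at_left 1)"
proof -
  obtain K where f: "ball_fun f" and K: "\<And>r. 0 < r \<Longrightarrow> r < 1 \<Longrightarrow> mean_sq f r \<le> K"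
    using H2E[OF assms] by blast
  define L where "L = (SUP r\<in>{0<..<1}. mean_sq f r)"
  have bdd: "bdd_above (mean_sq f ` {0<..<1})" using K by (auto intro!: bdd_aboveI[of _ K])
  have "(mean_sq f \<longlongrightarrow> L) (at_left 1)"
  proof (rule increasing_tendsto)
    show "\<forall>\<^sub>F r in at_left 1. mean_sq f r \<le> L"
      using eventually_at_left_1 by eventually_elim (auto simp: L_def intro!: cSUP_upper bdd)
    fix x assume "x < L"
    then obtain r0 where r0: "r0 \<in> {0<..<1}" "x < mean_sq f r0"
      using bdd unfolding L_def by (subst (asm) less_cSUP_iff) auto
    have "\<forall>\<^sub>F r in at_left 1. r \<in> {r0<..<1}" using r0 by (intro eventually_at_left_real) auto
    thus "\<forall>\<^sub>F r in at_left 1. x < mean_sq f r"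
    proof eventually_elim
      case (elim r)
      thus ?case using mean_sq_mono[OF f, of r0 r] r0 by auto
    qed
  qed
  thus ?thesis ..
qed

lemma mean_sq_eq_L2ip: "complex_of_real (mean_sq f r) = L2ip (srad r) f f"
  by (simp add: mean_sq_def L2ip_self)

lemma mean_sq_add_le:
  fixes f g :: "complex^'n \<Rightarrow> complex"
  assumes "ball_fun f" "ball_fun g" "0 < r" "r < 1"
  shows "mean_sq (\<lambda>z. f z + g z) r \<le> 2 * mean_sq f r + 2 * mean_sq g r"
proof -
  note sq = ball_fun_sqint[OF _ assms(3,4)]
  have "mean_sq (\<lambda>z. f z + g z) r \<le> (\<integral>z. 2 * (cmod (f z))\<^sup>2 + 2 * (cmod (g z))\<^sup>2 \<partial>srad r)"
    unfolding mean_sq_def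
    using sq[OF ball_fun_add[OF assms(1,2)]] sq[OF assms(1)] sq[OF assms(2)] cmod_add_sq_le
    by (intro integral_mono) (auto simp: sqint_def)
  also have "\<dots> = 2 * mean_sq f r + 2 * mean_sq g r"
    using sq[OF assms(1)] sq[OF assms(2)] by (simp add: mean_sq_def sqint_def)
  finally show ?thesis .
qed

lemma H2_add:
  fixes f g :: "complex^'n \<Rightarrow> complex"
  assumes "f \<in> H2" "g \<in> H2"
  shows "(\<lambda>z. f z + g z) \<in> H2"
proof -
  obtain K where K: "ball_fun f" "\<And>r. 0 < r \<Longrightarrow> r < 1 \<Longrightarrow> mean_sq f r \<le> K"
    using H2E[OF assms(1)] by blast
  obtain K' where K': "ball_fun g" "\<And>r. 0 < r \<Longrightarrow> r < 1 \<Longrightarrow> mean_sq g r \<le> K'"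
    using H2E[OF assms(2)] by blast
  show ?thesis
  proof (rule H2I[OF ball_fun_add[OF K(1) K'(1)]])
    fix r :: real assume r: "0 < r" "r < 1"
    show "mean_sq (\<lambda>z. f z + g z) r \<le> 2 * K + 2 * K'"
      using mean_sq_add_le[OF K(1) K'(1) r] K(2)[OF r] K'(2)[OF r] by simp
  qed
qed

lemma H2_scale:
  fixes f :: "complex^'n \<Rightarrow> complex"
  assumes "f \<in> H2"
  shows "(\<lambda>z. c * f z) \<in> H2"
proof -
  obtain K where K: "ball_fun f" "\<And>r. 0 < r \<Longrightarrow> r < 1 \<Longrightarrow> mean_sq f r \<le> K"
    using H2E[OF assms] by blast
  show ?thesis
  proof (rule H2I[OF ball_fun_scale[OF K(1)]])
    fix r :: real assume r: "0 < r" "r < 1"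
    have "mean_sq (\<lambda>z. c * f z) r = (cmod c)\<^sup>2 * mean_sq f r"
      by (simp add: mean_sq_def norm_mult power_mult_distrib)
    thus "mean_sq (\<lambda>z. c * f z) r \<le> (cmod c)\<^sup>2 * K"
      using K(2)[OF r] by (simp add: mult_left_mono)
  qed
qed

text \<open>Carries the existence of limits over from squared norms to inner products.\<close>

lemma L2ip_polarization:
  assumes "sqint M f" "sqint M g"
  defines "D \<equiv> \<lambda>c. L2ip M (\<lambda>z. f z + c * g z) (\<lambda>z. f z + c * g z)"
  shows "L2ip M f g = (D 1 - D (-1) + \<i> * D \<i> - \<i> * D (-\<i>)) / 4"
proof -
  have exp: "D c = L2ip M f f + cnj c * L2ip M f g + c * L2ip M g f + c * cnj c * L2ip M g g" for c
  proof -
    have s: "sqint M (\<lambda>z. c * g z)" "sqint M (\<lambda>z. f z + c * g z)"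
      using assms(1,2) by (simp_all add: sqint_scale sqint_add)
    have r: "L2ip M h (\<lambda>z. f z + c * g z) = L2ip M h f + cnj c * L2ip M h g" if "sqint M h" for h
      by (subst (1 2 3) L2ip_commute) (simp add: L2ip_add_left[OF assms(1) s(1) that] L2ip_scale_left)
    show ?thesis
      unfolding D_def using assms(1,2) s by (simp add: L2ip_add_left L2ip_scale_left r algebra_simps)
  qed
  show ?thesis unfolding exp by (simp add: algebra_simps)
qed

text \<open>\<open>Lim\<close> says something only where a limit exists. For \<open>f = g\<close>
  one exists because the means are increasing and bounded; polarization extends this to all
  pairs.\<close>

lemma H2_ip_tendsto:
  fixes f g :: "complex^'n \<Rightarrow> complex"
  assumes f: "f \<in> H2" and g: "g \<in> H2"
  shows "((\<lambda>r. L2ip (srad r) f g) \<longlongrightarrow> H2_ip f g) (at_left 1)"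
proof -
  have bf: "ball_fun f" "ball_fun g" using f g by (auto simp: H2_iff)
  have lim: "\<exists>L. ((\<lambda>r. L2ip (srad r) h h) \<longlongrightarrow> L) (at_left 1)" if h: "h \<in> H2" for h :: "complex^'n \<Rightarrow> complex"
  proof -
    obtain L where "(mean_sq h \<longlongrightarrow> L) (at_left 1)" using mean_sq_convergent[OF h] ..
    from tendsto_of_real[OF this, where 'a=complex] show ?thesis
      unfolding mean_sq_eq_L2ip by blast
  qed
  define D where "D = (\<lambda>c r. L2ip (srad r) (\<lambda>z. f z + c * g z) (\<lambda>z. f z + c * g z))"
  have "\<exists>L. (D c \<longlongrightarrow> L) (at_left 1)" for c
    unfolding D_def by (intro lim H2_add H2_scale f g)
  then obtain L where L: "\<And>c. (D c \<longlongrightarrow> L c) (at_left 1)" by metis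
  define L0 where "L0 = (L 1 - L (-1) + \<i> * L \<i> - \<i> * L (-\<i>)) / 4"
  have "((\<lambda>r. (D 1 r - D (-1) r + \<i> * D \<i> r - \<i> * D (-\<i>) r) / 4) \<longlongrightarrow> L0) (at_left 1)"
    unfolding L0_def by (intro tendsto_intros L) simp
  moreover have "\<forall>\<^sub>F r in at_left 1.
      (D 1 r - D (-1) r + \<i> * D \<i> r - \<i> * D (-\<i>) r) / 4 = L2ip (srad r) f g"
    using eventually_at_left_1
  proof eventually_elim
    case (elim r)
    thus ?case unfolding D_def
      by (intro L2ip_polarization[symmetric] ball_fun_sqint bf) auto
  qed
  ultimately have *: "((\<lambda>r. L2ip (srad r) f g) \<longlongrightarrow> L0) (at_left 1)"
    by (rule Lim_transform_eventually)
  have [measurable]: "f \<in> borel_measurable borel" "g \<in> borel_measurable borel"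
    using bf ball_fun_measurable by auto
  have "(\<lambda>r. \<integral>\<zeta>. f (r *\<^sub>R \<zeta>) * cnj (g (r *\<^sub>R \<zeta>)) \<partial>sph) = (\<lambda>r. L2ip (srad r) f g)"
    unfolding L2ip_def by (subst integral_srad) simp_all
  hence "H2_ip f g = Lim (at_left 1) (\<lambda>r. L2ip (srad r) f g)" by (simp add: H2_ip_def)
  also have "\<dots> = L0"
    by (rule tendsto_Lim[OF _ *]) simp
  finally have eq: "H2_ip f g = L0" .
  show ?thesis unfolding eq by (rule *)
qed

text \<open>The properties of \<open>H2_ip\<close> hold for \<open>L2ip (srad r)\<close> with 0 < r
  < 1 and pass to the limit. The reproducing formula at radius \<open>r\<close> returns
  \<open>f\<close> at r^2 w, which tends to \<open>f w\<close> by continuity.\<close>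

lemma kernel_space_H2:
  "kernel_space (H2 :: (complex^'n \<Rightarrow> complex) set) H2_ip (real CARD('n)) 1"
proof -
  let ?S = "H2 :: (complex^'n \<Rightarrow> complex) set"
  let ?\<gamma> = "real CARD('n)"
  have bf: "ball_fun f" if "f \<in> ?S" for f using that by (simp add: H2_iff)
  have sq: "sqint (srad r) f" if "f \<in> ?S" "0 < r \<and> r < 1" for f r
    using ball_fun_sqint[OF bf[OF that(1)]] that by blast
  have uniq: "H2_ip f g = L" if "f \<in> ?S" "g \<in> ?S" "(h \<longlongrightarrow> L) (at_left 1)"
    "\<And>r. 0 < r \<and> r < 1 \<Longrightarrow> L2ip (srad r) f g = h r" for f g h L
  proof -
    have "(h \<longlongrightarrow> H2_ip f g) (at_left 1)"
      by (rule Lim_transform_eventually[OF H2_ip_tendsto[OF that(1,2)]])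
        (use eventually_at_left_1 that(4) in \<open>auto elim!: eventually_mono\<close>)
    thus ?thesis using that(3) by (intro tendsto_unique[of "at_left (1::real)"]) simp_all
  qed
  have \<gamma>: "?\<gamma> > 0" by simp
  have ker: "ker ?\<gamma> w \<in> ?S" if w: "w \<in> ballN" for w
  proof -
    define K where "K = (1 - norm w) powr (- ?\<gamma>)"
    have b: "ball_fun (ker ?\<gamma> w)" using w by (auto simp: ball_fun_def holo_ball_ker ker_def)
    have "mean_sq (ker ?\<gamma> w) r \<le> K\<^sup>2" if r: "0 < r" "r < 1" for r
    proof -
      interpret isometry_invariant "srad r :: (complex^'n) measure"
        using r by (intro isometry_invariant_srad) auto
      have "mean_sq (ker ?\<gamma> w) r \<le> (\<integral>z. K\<^sup>2 \<partial>(srad r :: (complex^'n) measure))"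
        unfolding mean_sq_def
        using ball_fun_sqint[OF b, of r] r ker_bounded[OF w \<gamma>]
        by (intro integral_mono power_mono) (auto simp: sqint_def K_def)
      thus ?thesis by (simp add: measure_def)
    qed
    thus ?thesis by (rule H2I[OF b])
  qed
  show ?thesis
  proof
    show "(\<lambda>x. f x + g x) \<in> ?S" if "f \<in> ?S" "g \<in> ?S" for f g by (rule H2_add[OF that])
    show "(\<lambda>x. c * f x) \<in> ?S" if "f \<in> ?S" for c f by (rule H2_scale[OF that])
    show "H2_ip (\<lambda>x. f x + g x) h = H2_ip f h + H2_ip g h" if "f \<in> ?S" "g \<in> ?S" "h \<in> ?S" for f g h
      by (rule uniq[OF H2_add[OF that(1,2)] that(3)
            tendsto_add[OF H2_ip_tendsto[OF that(1,3)] H2_ip_tendsto[OF that(2,3)]]])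
        (use that sq in \<open>simp add: L2ip_add_left\<close>)
    show "H2_ip (\<lambda>x. c * f x) g = c * H2_ip f g" if "f \<in> ?S" "g \<in> ?S" for c f g
      by (rule uniq[OF H2_scale[OF that(1)] that(2) tendsto_mult_left[OF H2_ip_tendsto[OF that]]])
        (simp add: L2ip_scale_left)
    show "H2_ip g f = cnj (H2_ip f g)" if "f \<in> ?S" "g \<in> ?S" for f g
      by (rule uniq[OF that(2,1) tendsto_cnj[OF H2_ip_tendsto[OF that]]]) (rule L2ip_commute)
    show "0 \<le> Re (H2_ip f f)" if "f \<in> ?S" for f
      by (rule tendsto_lowerbound[OF tendsto_Re[OF H2_ip_tendsto[OF that that]]])
        (simp_all add: L2ip_self)
    show "ker ?\<gamma> w \<in> ?S" if "w \<in> ballN" for w by (rule ker[OF that])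
    show "H2_ip f (ker ?\<gamma> w) = f w" if f: "f \<in> ?S" and w: "w \<in> ballN" for f w
    proof (rule uniq[OF f ker[OF w]])
      have "isCont f w"
        using holo_ball_continuous[of f] bf[OF f] w
        by (simp add: ball_fun_def ballN_eq_ball continuous_on_eq_continuous_at)
      moreover have "((\<lambda>r::real. (r\<^sup>2) *\<^sub>R w) \<longlongrightarrow> (1\<^sup>2) *\<^sub>R w) (at_left 1)"
        by (intro tendsto_intros)
      hence "((\<lambda>r::real. (r\<^sup>2) *\<^sub>R w) \<longlongrightarrow> w) (at_left 1)" by simp
      ultimately show "((\<lambda>r::real. f ((r\<^sup>2) *\<^sub>R w)) \<longlongrightarrow> f w) (at_left 1)"
        by (rule isCont_tendsto_compose)
      fix r :: real assume r: "0 < r \<and> r < 1"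
      interpret isometry_invariant "srad r :: (complex^'n) measure"
        using r by (intro isometry_invariant_srad) auto
      show "L2ip (srad r) f (ker ?\<gamma> w) = f ((r\<^sup>2) *\<^sub>R w)"
        unfolding L2ip_def scaleR_eq_smult
        by (rule integral_mult_ker[OF _ _ w \<gamma>])
          (use r bf[OF f] moment_srad sqint_integrable[OF sq[OF f r]] in \<open>auto simp: ball_fun_def power_le_one\<close>)
    qed
    show "Re (H2_ip f f) \<le> c1 * Re (H2_ip g g) + c2 * 1"
      if fg: "f \<in> ?S" "g \<in> ?S" and "0 \<le> c1" "0 \<le> c2"
        and dom: "\<And>z. z \<in> ballN \<Longrightarrow> (cmod (f z))\<^sup>2 \<le> c1 * (cmod (g z))\<^sup>2 + c2" for f g c1 c2
    proof (rule tendsto_le)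
      show "((\<lambda>r. Re (L2ip (srad r) f f)) \<longlongrightarrow> Re (H2_ip f f)) (at_left 1)"
        by (intro tendsto_Re H2_ip_tendsto fg)
      show "((\<lambda>r. c1 * Re (L2ip (srad r) g g) + c2 * 1) \<longlongrightarrow> c1 * Re (H2_ip g g) + c2 * 1) (at_left 1)"
        by (intro tendsto_intros H2_ip_tendsto fg)
      show "\<forall>\<^sub>F r in at_left 1. Re (L2ip (srad r) f f) \<le> c1 * Re (L2ip (srad r) g g) + c2 * 1"
        using eventually_at_left_1
      proof eventually_elim
        case (elim r)
        interpret isometry_invariant "srad r :: (complex^'n) measure"
          using elim by (intro isometry_invariant_srad) auto
        have "AE z in srad r. (cmod (f z))\<^sup>2 \<le> c1 * (cmod (g z))\<^sup>2 + c2"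
          using AE_ball by eventually_elim (rule dom)
        from L2ip_dominated[OF finite_measure_axioms sq[OF fg(1) elim] sq[OF fg(2) elim] this]
        show ?case by (simp add: measure_def)
      qed
    qed simp
  qed (rule \<gamma>)
qed

theorem theorem4p1:
  fixes A :: "complex^('n::{finite,linorder})^('n::{finite,linorder})" and B C :: "complex^('n::{finite,linorder})" and d :: complex
    and k :: nat
  assumes "1 \<le> k" and "k \<le> CARD('n)"
    and "lf_selfmap A B C d"
    and "lf_map A B C d ` ballK k \<subseteq> ballK k"
    and "bij_betw (lf_map A B C d) (ballK k) (ballK k)"
    and "\<not> rotation_on_Bk k (lf_map A B C d)"
  shows "\<not> ess_normal H2 H2_ip (Cop (lf_map A B C d)) \<and>
         (\<forall>s::real. s > -1 \<longrightarrow> \<not> ess_normal (A2 s) (A2_ip s) (Cop (lf_map A B C d)))"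
proof (intro conjI allI impI)
  have lf: "lf_automorphism A B C d k"
    using assms by unfold_locales
  have *: "\<not> ess_normal S ip (Cop (lf_map A B C d))" if "kernel_space S ip \<gamma> mass" for S ip \<gamma> mass
    using kernel_space_automorphism.not_ess_normal[OF kernel_space_automorphism.intro[OF that lf]] assms(6) .
  show "\<not> ess_normal H2 H2_ip (Cop (lf_map A B C d))" by (rule *[OF kernel_space_H2])
  show "\<not> ess_normal (A2 s) (A2_ip s) (Cop (lf_map A B C d))" if "s > -1" for s
    by (rule *[OF kernel_space_A2[OF that]])
qed

end
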